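(* Let $T>0$, $\epsilon>0$, $I=(0,1)$, $I_T=I\times(0,T)$, $G(x)=\sqrt{x^2+\epsilon^2}$. Let $\kappa^0\in\mathrm{Lip}(I)$ and $\rho^0\in C_0^\infty(I)$ with $\kappa^0_x\ge G(\rho^0_x)$ a.e. in $I$, and let $\rho$ be the solution of $\rho_t=\rho_{xx}$ in $I\times(0,\infty)$, $\rho(\cdot,0)=\rho^0$ in $I$, $\rho(0,t)=\rho(1,t)=0$ for $t\ge0$. Then there exists a viscosity solution $\kappa\in\mathrm{Lip}(\overline{I}_T)$ of $$\kappa_t\kappa_x=\rho_t\rho_x\ \text{in }I_T,\quad\kappa(x,0)=\kappa^0(x)\ \text{in }I,\quad\kappa(0,t)=\kappa^0(0),\ \kappa(1,t)=\kappa^0(1)\ \ \forall t\in[0,T],$$ unique among the viscosity solutions of this problem satisfying $\kappa_x\ge G(\rho_x)$ a.e. in $\overline{I}_T$.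
   Context: A viscosity solution of this Dirichlet problem is a function $\kappa\in C(\overline{I}_T)$ which is a (Crandall–Lions) viscosity solution in $I_T$ of $F((x,t),\nabla\kappa)=0$ with $F((x,t),(p_1,p_2))=p_1p_2-\rho_t(x,t)\rho_x(x,t)$, attains the initial datum $\kappa^0$ at $t=0$, and equals the prescribed boundary values at $x=0$ and $x=1$. $\kappa^0\in\mathrm{Lip}(I)$ extends continuously to $[0,1]$. *)

theory Defs
  imports "HOL-Analysis.Analysis"
begin

definition G :: "real \<Rightarrow> real \<Rightarrow> real" where
  "G \<epsilon> y = sqrt (y\<^sup>2 + \<epsilon>\<^sup>2)"

definition px :: "(real \<times> real \<Rightarrow> real) \<Rightarrow> real \<times> real \<Rightarrow> real" where
  "px f p = deriv (\<lambda>y. f (y, snd p)) (fst p)"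

definition pt :: "(real \<times> real \<Rightarrow> real) \<Rightarrow> real \<times> real \<Rightarrow> real" where
  "pt f p = deriv (\<lambda>s. f (fst p, s)) (snd p)"

definition smooth_compact_I :: "(real \<Rightarrow> real) \<Rightarrow> bool" where
  "smooth_compact_I f \<longleftrightarrow>
     (\<forall>k x. ((deriv ^^ k) f) differentiable (at x)) \<and>
     (\<exists>a b. 0 < a \<and> a \<le> b \<and> b < 1 \<and> (\<forall>x. x \<notin> {a..b} \<longrightarrow> f x = 0))"

definition heat_solution :: "(real \<Rightarrow> real) \<Rightarrow> (real \<times> real \<Rightarrow> real) \<Rightarrow> bool" where
  "heat_solution \<rho>0 \<rho> \<longleftrightarrow>
     continuous_on ({0..1} \<times> {0..}) \<rho> \<and>
     (\<forall>p \<in> {0<..<1} \<times> {0<..}.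
        (\<lambda>y. \<rho> (y, snd p)) differentiable (at (fst p)) \<and>
        (\<lambda>s. \<rho> (fst p, s)) differentiable (at (snd p)) \<and>
        (\<lambda>y. px \<rho> (y, snd p)) differentiable (at (fst p)) \<and>
        pt \<rho> p = px (px \<rho>) p) \<and>
     continuous_on ({0<..<1} \<times> {0<..}) (px \<rho>) \<and>
     continuous_on ({0<..<1} \<times> {0<..}) (px (px \<rho>)) \<and>
     continuous_on ({0<..<1} \<times> {0<..}) (pt \<rho>) \<and>
     (\<forall>x \<in> {0..1}. \<rho> (x, 0) = \<rho>0 x) \<and>
     (\<forall>t \<ge> 0. \<rho> (0, t) = 0 \<and> \<rho> (1, t) = 0)"

definition Ham :: "(real \<times> real \<Rightarrow> real) \<Rightarrow> real \<times> real \<Rightarrow> real \<times> real \<Rightarrow> real" where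
  "Ham \<rho> z q = fst q * snd q - pt \<rho> z * px \<rho> z"

definition visc_sub :: "(real \<times> real \<Rightarrow> real \<times> real \<Rightarrow> real) \<Rightarrow> (real \<times> real) set \<Rightarrow> (real \<times> real \<Rightarrow> real) \<Rightarrow> bool" where
  "visc_sub F U u \<longleftrightarrow>
     (\<forall>\<phi> D z. (\<forall>q \<in> U. (\<phi> has_derivative (\<lambda>h. D q \<bullet> h)) (at q)) \<and> continuous_on U D \<and>
        z \<in> U \<and> (\<exists>e>0. \<forall>q \<in> ball z e \<inter> U. u q - \<phi> q \<le> u z - \<phi> z)
        \<longrightarrow> F z (D z) \<le> 0)"

definition visc_super :: "(real \<times> real \<Rightarrow> real \<times> real \<Rightarrow> real) \<Rightarrow> (real \<times> real) set \<Rightarrow> (real \<times> real \<Rightarrow> real) \<Rightarrow> bool" where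
  "visc_super F U u \<longleftrightarrow>
     (\<forall>\<phi> D z. (\<forall>q \<in> U. (\<phi> has_derivative (\<lambda>h. D q \<bullet> h)) (at q)) \<and> continuous_on U D \<and>
        z \<in> U \<and> (\<exists>e>0. \<forall>q \<in> ball z e \<inter> U. u q - \<phi> q \<ge> u z - \<phi> z)
        \<longrightarrow> F z (D z) \<ge> 0)"

definition visc_dirichlet ::
  "real \<Rightarrow> (real \<times> real \<Rightarrow> real) \<Rightarrow> (real \<Rightarrow> real) \<Rightarrow> (real \<times> real \<Rightarrow> real) \<Rightarrow> bool" where
  "visc_dirichlet T \<rho> \<kappa>0 \<kappa> \<longleftrightarrow>
     continuous_on ({0..1} \<times> {0..T}) \<kappa> \<and>
     visc_sub (Ham \<rho>) ({0<..<1} \<times> {0<..<T}) \<kappa> \<and>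
     visc_super (Ham \<rho>) ({0<..<1} \<times> {0<..<T}) \<kappa> \<and>
     (\<forall>x \<in> {0<..<1}. \<kappa> (x, 0) = \<kappa>0 x) \<and>
     (\<forall>t \<in> {0..T}. \<kappa> (0, t) = \<kappa>0 0 \<and> \<kappa> (1, t) = \<kappa>0 1)"

text \<open>kappa_x \<ge> G(rho_x) a.e. in I_T (the x-derivative exists a.e. by Lipschitz continuity).\<close>
definition grad_constraint ::
  "real \<Rightarrow> real \<Rightarrow> (real \<times> real \<Rightarrow> real) \<Rightarrow> (real \<times> real \<Rightarrow> real) \<Rightarrow> bool" where
  "grad_constraint \<epsilon> T \<rho> \<kappa> \<longleftrightarrow>
     (AE p in lebesgue. p \<in> {0<..<1} \<times> {0<..<T} \<longrightarrow>
        (\<exists>d. ((\<lambda>y. \<kappa> (y, snd p)) has_real_derivative d) (at (fst p)) \<and> d \<ge> G \<epsilon> (px \<rho> p)))"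

end

theory Submission
  imports Defs "HOL-Probability.Probability" "HOL-Real_Asymp.Real_Asymp" "HOL-Complex_Analysis.Great_Picard"
begin

text \<open>
  Existence. The initial datum \<open>\<rho>\<^sup>0\<close> is extended oddly and 2-periodically to the line, so that \<open>\<rho>\<close> is a Gaussian
  average of a smooth bounded function and \<open>f = \<rho>\<^sub>t \<rho>\<^sub>x\<close> is bounded, Lipschitz and vanishes at \<open>x = 0\<close> and
  \<open>x = 1\<close>. The equation \<open>\<kappa>\<^sub>t = f / \<kappa>\<^sub>x\<close>, with \<open>1 / p\<close> replaced by \<open>1 / max p (\<epsilon> / 2)\<close>, is solved by an explicit
  upwind scheme on the whole line; the scheme is discrete in time only, its spatial differences being taken at every
  real \<open>x\<close>. Monotonicity under a CFL condition, together with translations, gives uniform Lipschitz bounds. The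
  discrete solutions moreover increase at least as fast as \<open>\<integral>G(\<rho>\<^sub>x)\<close>, because \<open>G(\<rho>\<^sub>x)\<close> is a subsolution of
  \<open>u\<^sub>t = (f / u)\<^sub>x\<close>. Arzela--Ascoli and the stability of viscosity solutions under monotone schemes yield \<open>\<kappa>\<close>; its slope
  is at least \<open>\<epsilon>\<close>, so the truncation is inactive.

  Uniqueness. In the doubling of variables both functions see the same slope \<open>p\<close>, and \<open>p \<ge> \<epsilon>\<close> as soon
  as one of them has slope at least \<open>\<epsilon>\<close>; the Hamiltonian \<open>p q - f\<close> is then strictly increasing in \<open>q\<close>.
\<close>

section \<open>Lipschitz functions of one variable\<close>

text \<open>The gradient condition is an almost-everywhere statement, while the scheme and the
  doubling argument need increments. It is therefore carried as a lower bound of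
  \<open>u y - u x\<close> by the integral of \<open>v\<close> over [x, y], a form that survives
  monotone steps and uniform limits. Entering this form from the hypothesis on
  \<open>\<kappa>0\<close> requires that a Lipschitz function with a.e. nonnegative derivative be
  nondecreasing; leaving it towards \<open>grad_constraint\<close> requires x-derivatives a.e. in
  the plane. Both come from one density argument. No boundary condition is imposed on the scheme.
  The odd reflection makes \<rho>_xx = \<rho>_t, hence f, vanish at x = 0 and x = 1, and where f
  vanishes the update is the identity, so the Dirichlet data persist. Compact support of
  \<open>\<rho>0\<close> inside I keeps the reflection smooth and the derivatives bounded down to t
  = 0. The obstacle is that p q - f is monotone in q only where p > 0. Both the return from the
  truncated to the product equation and the comparison of two solutions therefore first prove p
  \<ge> \<epsilon> for the slope of the test function.\<close>

lemma le_of_right_growth: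
  fixes F :: "real \<Rightarrow> real"
  assumes "a \<le> b" "continuous_on {a..b} F"
    and step: "\<And>x. a \<le> x \<Longrightarrow> x < b \<Longrightarrow> \<exists>y. x < y \<and> y \<le> b \<and> F x \<le> F y"
  shows "F a \<le> F b"
proof -
  define S where "S = {x \<in> {a..b}. F a \<le> F x}"
  have "closed S"
    unfolding S_def using assms(2)
    by (intro continuous_on_closed_Collect_le) (auto intro: continuous_intros)
  moreover have "S \<noteq> {}" "bdd_above S" using assms(1) unfolding S_def by (auto intro: bdd_aboveI[of _ b])
  ultimately have s: "Sup S \<in> S" using closed_contains_Sup by blast
  have "\<not> Sup S < b"
  proof
    assume "Sup S < b"
    then obtain y where y: "Sup S < y" "y \<le> b" "F (Sup S) \<le> F y"
      using step[of "Sup S"] s unfolding S_def by auto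
    hence "y \<in> S" using s unfolding S_def by auto
    thus False using cSup_upper[OF _ \<open>bdd_above S\<close>] y(1) by force
  qed
  thus ?thesis using s unfolding S_def by (metis (mono_tags, lifting) atLeastAtMost_iff linorder_not_le mem_Collect_eq order_antisym)
qed

lemma measure_Int_interval_split:
  fixes K :: "real set"
  assumes "closed K" "a \<le> x" "x \<le> y"
  shows "measure lebesgue (K \<inter> {a..y}) = measure lebesgue (K \<inter> {a..x}) + measure lebesgue (K \<inter> {x..y})"
proof -
  have 1: "K \<inter> {p..q} \<in> lmeasurable" for p q
    using assms(1) by (intro lmeasurable_compact closed_Int_compact) auto
  have "K \<inter> {a..y} = (K \<inter> {a..x}) \<union> (K \<inter> {x..y})" using assms by auto
  moreover have "negligible ((K \<inter> {a..x}) \<inter> (K \<inter> {x..y}))"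
    by (rule negligible_subset[of "{x}"]) auto
  ultimately show ?thesis
    by (simp add: 1 measure_Un3 negligible_imp_measure0)
qed

lemma measure_Int_interval_le:
  fixes K :: "real set"
  assumes "closed K" "x \<le> y"
  shows "measure lebesgue (K \<inter> {x..y}) \<le> y - x"
proof -
  have "K \<inter> {x..y} \<in> lmeasurable"
    using assms(1) by (intro lmeasurable_compact closed_Int_compact) auto
  hence "measure lebesgue (K \<inter> {x..y}) \<le> measure lebesgue {x..y}"
    by (intro measure_mono_fmeasurable) auto
  thus ?thesis using assms by simp
qed

text \<open>Counts slope \<open>s\<close> on \<open>K\<close> and the worst slope \<open>-L\<close>
  off it. At points of \<open>K\<close> only one good right increment at arbitrarily small distance
  is assumed, so there is no derivative to integrate and a monotone auxiliary function is used
  instead.\<close>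

lemma lipschitz_growth_right:
  fixes f :: "real \<Rightarrow> real"
  assumes ab: "a \<le> b" and L: "\<And>x y. x \<in> {a..b} \<Longrightarrow> y \<in> {a..b} \<Longrightarrow> \<bar>f x - f y\<bar> \<le> L * \<bar>x - y\<bar>"
    and K: "closed K" and s: "- L \<le> s"
    and up: "\<And>x \<delta>. x \<in> K \<Longrightarrow> a \<le> x \<Longrightarrow> x < b \<Longrightarrow> \<delta> > 0 \<Longrightarrow> \<exists>y. x < y \<and> y < x + \<delta> \<and> s * (y - x) \<le> f y - f x"
  shows "f b - f a \<ge> s * measure lebesgue (K \<inter> {a..b}) - L * (b - a - measure lebesgue (K \<inter> {a..b}))"
proof -
  define U where "U x = measure lebesgue (K \<inter> {a..x})" for x
  \<comment> \<open>Off \<open>K\<close> the measure \<open>U\<close> is locally constant and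
    \<open>L * (x - a)\<close> absorbs the decrease of \<open>f\<close>; on \<open>K\<close> the
    growth \<open>s\<close> of \<open>f\<close> compensates \<open>(s + L) * U\<close>, as
    \<open>U\<close> grows at most at rate 1. Hence \<open>F\<close> admits a nonnegative right
    increment at every point.\<close>
  define F where "F x = f x + L * (x - a) - (s + L) * U x" for x
  have U: "0 \<le> U y - U x" "U y - U x \<le> y - x" if "a \<le> x" "x \<le> y" for x y
    using measure_Int_interval_split[OF K that] measure_Int_interval_le[OF K that(2)] 
    by (auto simp: U_def)
  have "continuous_on {a..b} U"
  proof (rule lipschitz_on_continuous_on[of 1], rule lipschitz_onI)
    fix x y assume "x \<in> {a..b}" "y \<in> {a..b}"
    thus "dist (U x) (U y) \<le> 1 * dist x y"
      using U[of x y] U[of y x] by (cases "x \<le> y") (auto simp: dist_real_def)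
  qed simp
  moreover have "continuous_on {a..b} f"
  proof (rule lipschitz_on_continuous_on[of "\<bar>L\<bar>"], rule lipschitz_onI)
    fix x y assume "x \<in> {a..b}" "y \<in> {a..b}"
    have "L * \<bar>x - y\<bar> \<le> \<bar>L\<bar> * \<bar>x - y\<bar>" by (intro mult_right_mono) auto
    with L[OF \<open>x \<in> _\<close> \<open>y \<in> _\<close>] show "dist (f x) (f y) \<le> \<bar>L\<bar> * dist x y"
      unfolding dist_real_def by linarith
  qed simp
  ultimately have F: "continuous_on {a..b} F" unfolding F_def by (intro continuous_intros)
  have "F a \<le> F b"
  proof (rule le_of_right_growth[OF ab F])
    fix x assume x: "a \<le> x" "x < b"
    show "\<exists>y. x < y \<and> y \<le> b \<and> F x \<le> F y"
    proof (cases "x \<in> K")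
      case True
      obtain y where y: "x < y" "y < x + (b - x)" "s * (y - x) \<le> f y - f x"
        using up[OF True x, of "b - x"] x by auto
      have "(s + L) * (U y - U x) \<le> (s + L) * (y - x)"
        using U[of x y] x y s by (intro mult_left_mono) auto
      hence "F x \<le> F y" using y(3) unfolding F_def by (simp add: algebra_simps)
      thus ?thesis using y by auto
    next
      case False
      then obtain e where e: "e > 0" "ball x e \<subseteq> - K"
        using K by (metis ComplI openE open_Compl)
      define y where "y = min b (x + e / 2)"
      have y: "x < y" "y \<le> b" "y < x + e" using x e by (auto simp: y_def)
      have "{x..y} \<subseteq> ball x e" using y by (auto simp: dist_real_def)
      hence "K \<inter> {x..y} = {}" using e(2) by auto
      hence "U y = U x" using measure_Int_interval_split[OF K x(1), of y] y by (auto simp: U_def)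
      moreover have "f x - f y \<le> L * (y - x)" using L[of x y] x y by auto
      ultimately have "F x \<le> F y" unfolding F_def by (simp add: algebra_simps)
      thus ?thesis using y by auto
    qed
  qed
  moreover have "U a = 0"
  proof -
    have "negligible (K \<inter> {a..a})" by (rule negligible_subset[of "{a}"]) auto
    thus ?thesis unfolding U_def using negligible_imp_measure0 by blast
  qed
  ultimately show ?thesis unfolding F_def U_def by (simp add: algebra_simps)
qed

text \<open>Vitali covering: disjoint small intervals inside an open \<open>T\<close> containing
  \<open>K\<close> cover \<open>K\<close> up to a null set, and \<open>K\<close> fills at most the
  fraction \<theta> of each. So |K| \<le> \<theta> |T|, with |T| as close to |K| as desired.\<close>

lemma measure_zero_if_density_less_one:
  fixes K :: "real set"
  assumes "compact K" "\<theta> < 1"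
    and den: "\<And>a b. a \<le> b \<Longrightarrow> measure lebesgue (K \<inter> {a..b}) \<le> \<theta> * (b - a)"
  shows "measure lebesgue K = 0"
proof (rule ccontr)
  assume "measure lebesgue K \<noteq> 0"
  hence pos: "measure lebesgue K > 0" by (simp add: zero_less_measure_iff)
  have th: "0 \<le> \<theta>" using order_trans[OF measure_nonneg den[of 0 1]] by simp
  have Kl: "K \<in> lmeasurable" using assms(1) by (rule lmeasurable_compact)
  \<comment> \<open>With this excess, |K| - \<theta> (|K| + e) = (1 - \<theta>)^2 |K|, which is
    positive.\<close>
  define e where "e = (1 - \<theta>) * measure lebesgue K"
  have "e > 0" using pos assms by (simp add: e_def)
  obtain T where T: "open T" "K \<subseteq> T" "(T - K) \<in> lmeasurable" "emeasure lebesgue (T - K) < ennreal e"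
    using sets_lebesgue_outer_open[OF fmeasurableD[OF Kl] \<open>e > 0\<close>] by blast
  have mTK: "measure lebesgue (T - K) < e"
    using T(3,4) \<open>e > 0\<close> by (simp add: emeasure_eq_measure2 ennreal_less_iff)
  have Tl: "T \<in> lmeasurable" 
    using fmeasurable.Un[OF T(3) Kl] T(2) by (metis Diff_partition Un_commute)
  have "T = K \<union> (T - K)" using T by auto
  hence mT: "measure lebesgue T < measure lebesgue K + e"
    using measure_Un_le[OF fmeasurableD[OF Kl] fmeasurableD[OF T(3)]] mTK by simp
  define I where "I = {(x::real, r). x \<in> K \<and> 0 < r \<and> cball x r \<subseteq> T}"
  have I1: "0 < snd i" if "i \<in> I" for i using that by (auto simp: I_def)
  have I2: "\<exists>i. i \<in> I \<and> x \<in> cball (fst i) (snd i) \<and> snd i < d" if xd: "x \<in> K" "0 < d" for x d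
  proof -
    obtain r where r: "r > 0" "cball x r \<subseteq> T" using T xd by (meson open_contains_cball subset_eq)
    have "cball x (min r (d/2)) \<subseteq> cball x r" by (rule subset_cball) simp
    hence "(x, min r (d/2)) \<in> I" using r xd unfolding I_def by auto
    thus ?thesis using r xd by (intro exI[of _ "(x, min r (d/2))"]) auto
  qed
  obtain C where C: "countable C" "C \<subseteq> I"
     "pairwise (\<lambda>i j. disjnt (cball (fst i) (snd i)) (cball (fst j) (snd j))) C"
     "negligible(K - (\<Union>i \<in> C. cball (fst i) (snd i)))"
    by (rule Vitali_covering_theorem_cballs[of I snd K fst, OF I1 I2]) (assumption | rule that)+
  have 1: "K \<inter> (\<Union>i\<in>C. cball (fst i) (snd i)) = (\<Union>i\<in>C. K \<inter> cball (fst i) (snd i))" by auto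
  have fm: "K \<inter> cball x r \<in> lmeasurable" for x r
    using assms(1) by (intro lmeasurable_compact compact_Int) auto
  have fin: "measure lebesgue (\<Union>i\<in>F. K \<inter> cball (fst i) (snd i)) \<le> \<theta> * measure lebesgue T"
    if F: "F \<subseteq> C" "finite F" for F
  proof -
    have "measure lebesgue (\<Union>i\<in>F. K \<inter> cball (fst i) (snd i)) \<le> (\<Sum>i\<in>F. measure lebesgue (K \<inter> cball (fst i) (snd i)))"
      using F fm by (intro measure_UNION_le) auto
    also have "\<dots> \<le> (\<Sum>i\<in>F. \<theta> * measure lebesgue (cball (fst i) (snd i)))"
    proof (rule sum_mono)
      fix i assume "i \<in> F"
      hence r: "snd i > 0" using F C by (auto simp: I_def)
      have cb: "cball (fst i) (snd i) = {fst i - snd i..fst i + snd i}" by (simp add: cball_eq_atLeastAtMost)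
      show "measure lebesgue (K \<inter> cball (fst i) (snd i)) \<le> \<theta> * measure lebesgue (cball (fst i) (snd i))"
        using den[of "fst i - snd i" "fst i + snd i"] r unfolding cb by simp
    qed
    also have "\<dots> = \<theta> * measure lebesgue (\<Union>i\<in>F. cball (fst i) (snd i))"
    proof -
      have "pairwise (\<lambda>i j. disjnt (cball (fst i) (snd i)) (cball (fst j) (snd j))) F"
        using C(3) F by (meson pairwise_subset)
      hence "disjoint_family_on (\<lambda>i. cball (fst i) (snd i)) F"
        by (auto simp: disjoint_family_on_def pairwise_def disjnt_def)
      hence "measure lebesgue (\<Union>i\<in>F. cball (fst i) (snd i)) = (\<Sum>i\<in>F. measure lebesgue (cball (fst i) (snd i)))"
        using F by (intro measure_finite_Union) (auto simp: emeasure_eq_measure2)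
      thus ?thesis by (simp add: sum_distrib_left)
    qed
    also have "\<dots> \<le> \<theta> * measure lebesgue T"
    proof (intro mult_left_mono measure_mono_fmeasurable th Tl)
      show "(\<Union>i\<in>F. cball (fst i) (snd i)) \<subseteq> T" using F C by (fastforce simp: I_def)
      show "(\<Union>i\<in>F. cball (fst i) (snd i)) \<in> sets lebesgue" using F by (intro sets.finite_UN) auto
    qed
    finally show ?thesis .
  qed
  have "measure lebesgue (\<Union>i\<in>C. K \<inter> cball (fst i) (snd i)) \<le> \<theta> * measure lebesgue T"
    using measure_UN_bound[OF C(1), of "\<lambda>i. K \<inter> cball (fst i) (snd i)" lebesgue "\<theta> * measure lebesgue T"] fm fin by blast
  moreover have "measure lebesgue K = measure lebesgue (\<Union>i\<in>C. K \<inter> cball (fst i) (snd i))"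
    unfolding 1[symmetric]
    by (rule measure_negligible_symdiff[OF Kl, symmetric]) (rule negligible_subset[OF C(4)], auto)
  ultimately have "measure lebesgue K \<le> \<theta> * measure lebesgue T" by simp
  also have "\<dots> \<le> \<theta> * (measure lebesgue K + e)" using mT th by (intro mult_left_mono) auto
  also have "\<dots> < measure lebesgue K"
  proof -
    have "measure lebesgue K - \<theta> * (measure lebesgue K + e) = (1 - \<theta>)^2 * measure lebesgue K"
      unfolding e_def by (simp add: algebra_simps power2_eq_square)
    moreover have "(1 - \<theta>)^2 * measure lebesgue K > 0" using pos assms by simp
    ultimately show ?thesis by linarith
  qed
  finally show False by simp
qed


section \<open>Dini-type conditions and differentiability almost everywhere\<close>

lemma measure_lebesgue_uminus_closed:
  fixes S :: "real set"
  assumes "closed S"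
  shows "measure lebesgue (uminus ` S) = measure lebesgue S"
proof -
  have "closed (uminus ` S)" using assms closed_negations by blast
  hence b: "uminus ` S \<in> sets borel" "S \<in> sets borel" using assms by auto
  have "measure lebesgue (uminus ` S) = measure lborel (uminus ` S)" using b by simp
  also have "\<dots> = measure (distr lborel borel uminus) (uminus ` S)" by (simp add: lborel_distr_uminus)
  also have "\<dots> = measure lborel (uminus -` uminus ` S)" using b by (subst measure_distr) auto
  also have "uminus -` uminus ` S = S" by (auto simp: image_iff)
  finally show ?thesis using b by simp
qed

text \<open>A Dini condition: the difference quotients on the side \<sigma> (right for 1, left for
  -1) exceed \<open>s\<close> at arbitrarily small scales. Applied to \<open>-f\<close> with
  \<open>-r\<close>, it says that they fall below \<open>r\<close>. The quotient is multiplied out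
  and the inequality is strict, so that each increment gives an open condition on the point.\<close>

definition one_sided_gt :: "real \<Rightarrow> real \<Rightarrow> (real \<Rightarrow> real) \<Rightarrow> real \<Rightarrow> bool" where
  "one_sided_gt \<sigma> s f x \<longleftrightarrow> (\<forall>\<delta>>0. \<exists>h. 0 < h \<and> h < \<delta> \<and> s * h < \<sigma> * (f (x + \<sigma> * h) - f x))"

text \<open>The left-sided case is the right-sided one for x \<mapsto> - f (- x) on the reflected
  set.\<close>

lemma lipschitz_growth:
  fixes f :: "real \<Rightarrow> real"
  assumes ab: "a \<le> b" and L: "\<And>x y. \<bar>f x - f y\<bar> \<le> L * \<bar>x - y\<bar>"
    and K: "closed K" and s: "- L \<le> s" and \<sigma>: "\<sigma> = 1 \<or> \<sigma> = -1"
    and up: "\<And>x. x \<in> K \<Longrightarrow> one_sided_gt \<sigma> s f x"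
  shows "f b - f a \<ge> s * measure lebesgue (K \<inter> {a..b}) - L * (b - a - measure lebesgue (K \<inter> {a..b}))"
  using \<sigma>
proof
  assume "\<sigma> = 1"
  show ?thesis
  proof (rule lipschitz_growth_right[OF ab L K s])
    fix x \<delta> :: real assume "x \<in> K" "\<delta> > 0"
    then obtain h where "0 < h" "h < \<delta>" "s * h < f (x + h) - f x"
      using up[of x] \<open>\<sigma> = 1\<close> by (auto simp: one_sided_gt_def)
    thus "\<exists>y>x. y < x + \<delta> \<and> s * (y - x) \<le> f y - f x" by (intro exI[of _ "x + h"]) auto
  qed
next
  assume "\<sigma> = -1"
  have *: "uminus ` K \<inter> {-b..-a} = uminus ` (K \<inter> {a..b})" by force
  have m: "measure lebesgue (uminus ` K \<inter> {-b..-a}) = measure lebesgue (K \<inter> {a..b})"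
    unfolding * using K by (intro measure_lebesgue_uminus_closed) auto
  have "s * measure lebesgue (uminus ` K \<inter> {-b..-a}) - L * (- a - (- b) - measure lebesgue (uminus ` K \<inter> {-b..-a}))
      \<le> - f (- (- a)) - - f (- (- b))"
  proof (rule lipschitz_growth_right)
    show "-b \<le> -a" using ab by simp
    show "\<bar>- f (- x) - - f (- y)\<bar> \<le> L * \<bar>x - y\<bar>" for x y using L[of "-x" "-y"] by (simp add: abs_minus_commute)
    show "closed (uminus ` K)" using K closed_negations by blast
    show "- L \<le> s" by fact
    fix x \<delta> :: real assume x: "x \<in> uminus ` K" "\<delta> > 0"
    hence "one_sided_gt \<sigma> s f (- x)" using up by auto
    hence "\<exists>h. 0 < h \<and> h < \<delta> \<and> s * h < -1 * (f (- x + -1 * h) - f (- x))"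
      using x(2) \<open>\<sigma> = -1\<close> unfolding one_sided_gt_def by blast
    then obtain h where "0 < h" "h < \<delta>" "s * h < - (f (- x - h) - f (- x))" by auto
    thus "\<exists>y>x. y < x + \<delta> \<and> s * (y - x) \<le> - f (- y) - - f (- x)" by (intro exI[of _ "x + h"]) auto
  qed
  thus ?thesis unfolding m by simp
qed

lemma open_increment_gt:
  fixes f :: "'a::topological_space \<Rightarrow> real"
  assumes "continuous_on UNIV f" "continuous_on UNIV g"
  shows "open {x. s * h < \<sigma> * (f (g x) - f x)}"
  by (intro open_Collect_less continuous_intros continuous_on_compose2[OF assms(1) assms(2)] assms) auto

text \<open>A countable intersection of open sets, jointly in both coordinates. Measurability in the
  plane is what the Fubini argument of \<open>AE_partial_derivative\<close> needs.\<close>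

lemma borel_one_sided_gt:
  fixes f :: "real \<times> real \<Rightarrow> real"
  assumes "continuous_on UNIV f"
  shows "{p. one_sided_gt \<sigma> s (\<lambda>y. f (y, snd p)) (fst p)} \<in> sets borel"
proof -
  have "{p. one_sided_gt \<sigma> s (\<lambda>y. f (y, snd p)) (fst p)} =
     (\<Inter>n. \<Union>h\<in>{0<..<inverse (real (Suc n))}. {p. s * h < \<sigma> * (f (fst p + \<sigma> * h, snd p) - f p)})" (is "?A = ?B")
  proof (intro equalityI subsetI)
    fix p assume p: "p \<in> ?A"
    show "p \<in> ?B"
    proof
      fix n
      define \<delta> where "\<delta> = inverse (real (Suc n))"
      have "\<delta> > 0" by (simp add: \<delta>_def)
      then obtain h where "0 < h" "h < inverse (real (Suc n))" "s * h < \<sigma> * (f (fst p + \<sigma> * h, snd p) - f p)"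
        using p unfolding one_sided_gt_def mem_Collect_eq prod.collapse \<delta>_def[symmetric] by blast
      thus "p \<in> (\<Union>h\<in>{0<..<inverse (real (Suc n))}. {p. s * h < \<sigma> * (f (fst p + \<sigma> * h, snd p) - f p)})" by auto
    qed
  next
    fix p assume p: "p \<in> ?B"
    have "\<exists>h. 0 < h \<and> h < \<delta> \<and> s * h < \<sigma> * (f (fst p + \<sigma> * h, snd p) - f (fst p, snd p))" if "\<delta> > 0" for \<delta>
    proof -
      obtain n where "inverse (real (Suc n)) < \<delta>" using reals_Archimedean[OF \<open>\<delta> > 0\<close>] by blast
      moreover obtain h where "h \<in> {0<..<inverse (real (Suc n))}" "s * h < \<sigma> * (f (fst p + \<sigma> * h, snd p) - f p)"
        using p by blast
      ultimately show ?thesis by (intro exI[of _ h]) auto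
    qed
    thus "p \<in> ?A" unfolding one_sided_gt_def by auto
  qed
  also have "\<dots> \<in> sets borel"
  proof (intro sets.countable_INT'' borel_open open_UN ballI)
    show "open {p. s * h < \<sigma> * (f (fst p + \<sigma> * h, snd p) - f p)}" for h
      by (rule open_increment_gt[OF assms]) (auto intro!: continuous_intros)
  qed auto
  finally show ?thesis .
qed

text \<open>On a compact part \<open>K\<close> of the set, \<open>f\<close> grows at rate
  \<open>s\<close> and \<open>-f\<close> at rate \<open>-r\<close>. Adding the two growth estimates
  on [a, b] cancels \<open>f\<close> and leaves (2 M + s - r) |K \<inter> [a, b]| \<le> 2 M (b - a),
  a density bound below 1. Inner regularity passes from compact parts to the whole set.\<close>

lemma negligible_one_sided_gap:
  fixes f :: "real \<Rightarrow> real"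
  assumes L: "\<And>x y. \<bar>f x - f y\<bar> \<le> L * \<bar>x - y\<bar>"
    and \<sigma>: "\<sigma> = 1 \<or> \<sigma> = -1" "\<tau> = 1 \<or> \<tau> = -1" and "r < s"
    and meas: "{x. one_sided_gt \<sigma> s f x \<and> one_sided_gt \<tau> (-r) (\<lambda>x. - f x) x} \<in> sets lebesgue"
  shows "negligible {x. one_sided_gt \<sigma> s f x \<and> one_sided_gt \<tau> (-r) (\<lambda>x. - f x) x}" (is "negligible ?A")
proof -
  \<comment> \<open>Enlarged beyond \<open>L\<close> so that both -M \<le> s and -M \<le> -r hold,
    as \<open>lipschitz_growth\<close> demands.\<close>
  define M where "M = max L (max \<bar>s\<bar> \<bar>r\<bar>)"
  have M: "\<bar>f x - f y\<bar> \<le> M * \<bar>x - y\<bar>" for x y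
    using L[of x y] mult_right_mono[of L M "\<bar>x - y\<bar>"] by (auto simp: M_def)
  have Ms: "- M \<le> s" "- M \<le> - r" by (auto simp: M_def)
  have M0: "2 * M + (s - r) > 0" "M \<ge> 0" using \<open>r < s\<close> by (auto simp: M_def)
  have comp: "measure lebesgue K = 0" if K: "compact K" "K \<subseteq> ?A" for K
  proof (rule measure_zero_if_density_less_one[OF K(1), of "2 * M / (2 * M + (s - r))"])
    show "2 * M / (2 * M + (s - r)) < 1" using M0 \<open>r < s\<close> by (simp add: field_simps)
    fix a b :: real assume ab: "a \<le> b"
    define m where "m = measure lebesgue (K \<inter> {a..b})"
    have cK: "closed K" using K compact_imp_closed by blast
    have 1: "f b - f a \<ge> s * m - M * (b - a - m)" unfolding m_def
      by (rule lipschitz_growth[OF ab M cK Ms(1) \<sigma>(1)]) (use K in auto)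
    have 2: "- f b - - f a \<ge> - r * m - M * (b - a - m)" unfolding m_def
      by (rule lipschitz_growth[OF ab _ cK Ms(2) \<sigma>(2), where f = "\<lambda>x. - f x"])
         (use K M in \<open>auto simp: abs_minus_commute\<close>)
    have "(2 * M + (s - r)) * m \<le> 2 * M * (b - a)" using 1 2 by (simp add: algebra_simps)
    thus "m \<le> 2 * M / (2 * M + (s - r)) * (b - a)" using M0 by (simp add: field_simps)
  qed
  have "?A \<inter> {-real n..real n} \<in> null_sets lebesgue" for n
  proof (rule ccontr)
    let ?S = "?A \<inter> {-real n..real n}"
    assume "?S \<notin> null_sets lebesgue"
    have bd: "bounded X" if "X \<subseteq> ?S" for X
      by (rule bounded_subset[of "{-real n..real n}"]) (use that in auto)
    have S: "?S \<in> lmeasurable" using meas bd[of ?S]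
      by (intro bounded_set_imp_lmeasurable) auto
    have pos: "measure lebesgue ?S > 0"
    proof (rule ccontr)
      assume "\<not> 0 < measure lebesgue ?S"
      hence "measure lebesgue ?S = 0" by (simp add: zero_less_measure_iff)
      hence "emeasure lebesgue ?S = 0" using emeasure_eq_measure2[OF S] by simp
      thus False using \<open>?S \<notin> null_sets lebesgue\<close> fmeasurableD[OF S] by (auto intro: null_setsI)
    qed
    obtain T where T: "closed T" "T \<subseteq> ?S" "?S - T \<in> lmeasurable" "emeasure lebesgue (?S - T) < ennreal (measure lebesgue ?S)"
      using sets_lebesgue_inner_closed[OF fmeasurableD[OF S] pos] by blast
    have "compact T" using T(1) bd[OF T(2)] by (simp add: compact_eq_bounded_closed)
    hence T0: "measure lebesgue T = 0" "T \<in> lmeasurable"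
      by (rule comp, use T(2) in blast) (rule lmeasurable_compact, fact)
    have "?S = T \<union> (?S - T)" using T by auto
    hence "measure lebesgue ?S \<le> measure lebesgue T + measure lebesgue (?S - T)"
      using measure_Un_le[of T lebesgue "?S - T"] T0 T by (metis fmeasurableD)
    moreover have "measure lebesgue (?S - T) < measure lebesgue ?S"
      using T(3,4) pos by (simp add: emeasure_eq_measure2 ennreal_less_iff)
    ultimately show False using T0 by simp
  qed
  hence "(\<Union>n. ?A \<inter> {-real n..real n}) \<in> null_sets lebesgue" by blast
  moreover have "(\<Union>n. ?A \<inter> {-real n..real n}) = ?A"
  proof -
    have "\<exists>n. x \<in> {-real n..real n}" for x
    proof -
      obtain n where "\<bar>x\<bar> \<le> real n" using real_arch_simple by blast
      thus ?thesis by (intro exI[of _ n]) auto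
    qed
    thus ?thesis by auto
  qed
  ultimately show ?thesis by (simp add: negligible_iff_null_sets)
qed

lemma one_sided_gt_if_frequently:
  assumes fr: "frequently (\<lambda>h. s < (f (x + h) - f x) / h) (at 0)"
  shows "\<exists>\<sigma>\<in>{1,-1}. one_sided_gt \<sigma> s f x"
proof (rule ccontr)
  assume "\<not> ?thesis"
  then obtain d1 d2 where d: "d1 > 0" "d2 > 0" 
    "\<And>h. 0 < h \<Longrightarrow> h < d1 \<Longrightarrow> \<not> s * h < f (x + h) - f x"
    "\<And>h. 0 < h \<Longrightarrow> h < d2 \<Longrightarrow> \<not> s * h < - (f (x - h) - f x)"
    unfolding one_sided_gt_def by auto
  obtain h where h: "h \<noteq> 0" "\<bar>h\<bar> < min d1 d2" "s < (f (x + h) - f x) / h"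
    using fr[unfolded frequently_at, rule_format, of "min d1 d2"] d(1,2) by (auto simp: dist_real_def)
  show False
  proof (cases "h > 0")
    case True thus False using d(3)[of h] h by (simp add: field_simps)
  next
    case False thus False using d(4)[of "-h"] h by (simp add: field_simps)
  qed
qed

text \<open>Bounded difference quotients without a limit would exceed some \<open>s\<close> and fall
  below some smaller \<open>r\<close> at arbitrarily small increments. Rational \<open>r\<close> and
  \<open>s\<close> suffice, so only countably many exceptional sets arise. The derivative is the
  upper limit of the quotients, obtained as \<open>Sup S\<close>.\<close>

lemma differentiable_if_no_gap:
  fixes f :: "real \<Rightarrow> real"
  assumes L: "\<And>y. \<bar>f y - f x\<bar> \<le> L * \<bar>y - x\<bar>"
    and gap: "\<And>r s \<sigma> \<tau>. r \<in> \<rat> \<Longrightarrow> s \<in> \<rat> \<Longrightarrow> r < s \<Longrightarrow> \<sigma> \<in> {1, -1} \<Longrightarrow> \<tau> \<in> {1, -1} \<Longrightarrow>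
       \<not> (one_sided_gt \<sigma> s f x \<and> one_sided_gt \<tau> (-r) (\<lambda>x. - f x) x)"
  shows "\<exists>d. (f has_real_derivative d) (at x)"
proof -
  define q where "q h = (f (x + h) - f x) / h" for h
  have qb: "\<bar>q h\<bar> \<le> \<bar>L\<bar>" for h
  proof (cases "h = 0")
    case False
    have "\<bar>f (x + h) - f x\<bar> \<le> \<bar>L\<bar> * \<bar>h\<bar>" 
    proof -
      have "L * \<bar>h\<bar> \<le> \<bar>L\<bar> * \<bar>h\<bar>" by (intro mult_right_mono) auto
      thus ?thesis using L[of "x + h"] by simp
    qed
    thus ?thesis using False by (simp add: q_def divide_le_eq)
  qed (auto simp: q_def)
  have fu: "\<exists>\<sigma>\<in>{1,-1}. one_sided_gt \<sigma> s f x" if "frequently (\<lambda>h. q h > s) (at 0)" for s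
    by (rule one_sided_gt_if_frequently) (use that in \<open>simp add: q_def\<close>)
  have fl: "\<exists>\<tau>\<in>{1,-1}. one_sided_gt \<tau> (-r) (\<lambda>x. - f x) x" if "frequently (\<lambda>h. q h < r) (at 0)" for r
    by (rule one_sided_gt_if_frequently) (use that in \<open>simp add: q_def minus_divide_left[symmetric] diff_divide_distrib less_diff_eq diff_less_eq algebra_simps\<close>)
  have key: False if "frequently (\<lambda>h. q h > s) (at 0)" "frequently (\<lambda>h. q h < r) (at 0)" "r < s" for r s
  proof -
    obtain r' where r': "r' \<in> \<rat>" "r < r'" "r' < s" using Rats_dense_in_real[OF \<open>r < s\<close>] by blast
    obtain s' where s': "s' \<in> \<rat>" "r' < s'" "s' < s" using Rats_dense_in_real[OF r'(3)] by blast
    have "frequently (\<lambda>h. q h > s') (at 0)" by (rule frequently_elim1[OF that(1)]) (use s' in auto)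
    moreover have "frequently (\<lambda>h. q h < r') (at 0)" by (rule frequently_elim1[OF that(2)]) (use r' in auto)
    ultimately obtain \<sigma> \<tau> where "\<sigma> \<in> {1,-1}" "\<tau> \<in> {1,-1}" "one_sided_gt \<sigma> s' f x" "one_sided_gt \<tau> (-r') (\<lambda>x. - f x) x"
      using fu fl by meson
    thus False using gap[OF r'(1) s'(1) s'(2)] by blast
  qed
  define S where "S = {s. frequently (\<lambda>h. q h > s) (at 0)}"
  have "- \<bar>L\<bar> - 1 \<in> S" unfolding S_def mem_Collect_eq
  proof (rule eventually_frequently)
    show "\<forall>\<^sub>F h in at 0. q h > - \<bar>L\<bar> - 1" using qb by (intro always_eventually allI) (smt (verit))
  qed simp
  moreover have bdd: "bdd_above S"
  proof (rule bdd_aboveI)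
    fix s assume "s \<in> S"
    then obtain h where "q h > s" unfolding S_def using frequently_ex by blast
    thus "s \<le> \<bar>L\<bar>" using qb[of h] by linarith
  qed
  ultimately have ne: "S \<noteq> {}" by auto
  define c where "c = Sup S"
  have "(q \<longlongrightarrow> c) (at 0)"
  proof (rule tendstoI)
    fix e :: real assume "e > 0"
    have "c + e / 2 \<notin> S" using cSup_upper[OF _ bdd, of "c + e / 2"] \<open>e > 0\<close> by (auto simp: c_def)
    hence 1: "\<forall>\<^sub>F h in at 0. q h \<le> c + e / 2" by (simp add: S_def frequently_def not_less)
    obtain s where s: "s \<in> S" "c - e / 4 < s" using less_cSup_iff[OF ne bdd, of "c - e / 4"] \<open>e > 0\<close> by (auto simp: c_def)
    hence "\<not> frequently (\<lambda>h. q h < c - e / 2) (at 0)" using key[of s "c - e / 2"] \<open>e > 0\<close> by (auto simp: S_def)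
    hence "\<forall>\<^sub>F h in at 0. q h \<ge> c - e / 2" by (simp add: frequently_def not_less)
    with 1 show "\<forall>\<^sub>F h in at 0. dist (q h) c < e"
      by eventually_elim (use \<open>e > 0\<close> in \<open>auto simp: dist_real_def abs_if\<close>)
  qed
  hence "(f has_real_derivative c) (at x)" unfolding DERIV_def q_def .
  thus ?thesis by blast
qed

text \<open>A closed subset \<open>K\<close> of the good set misses less than measure
  \<open>e\<close>. From its points small right increments have slope at least -e, elsewhere the
  slope is at least -L; the total loss e (b - a) + L e tends to 0.\<close>

lemma nondecreasing_if_AE_deriv_nonneg:
  fixes f :: "real \<Rightarrow> real"
  assumes ab: "a \<le> b" and L': "\<And>x y. x \<in> {a..b} \<Longrightarrow> y \<in> {a..b} \<Longrightarrow> \<bar>f x - f y\<bar> \<le> L' * \<bar>x - y\<bar>"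
    and AE: "AE x in lebesgue. x \<in> {a<..<b} \<longrightarrow> (\<exists>d\<ge>0. (f has_real_derivative d) (at x))"
  shows "f a \<le> f b"
proof -
  obtain N where N: "N \<in> null_sets lebesgue"
    "\<And>x. x \<in> {a<..<b} \<Longrightarrow> x \<notin> N \<Longrightarrow> \<exists>d\<ge>0. (f has_real_derivative d) (at x)"
    using AE by (auto elim!: AE_E3)
  define S where "S = {a<..<b} - N"
  have Sl: "S \<in> lmeasurable" unfolding S_def
    by (rule fmeasurable.Diff) (use N in \<open>auto intro: null_setsD2 fmeasurableI_null_sets\<close>)
  have neg: "negligible N" using N by (simp add: negligible_iff_null_sets)
  have mS: "measure lebesgue S = b - a"
  proof -
    have "measure lebesgue S = measure lebesgue {a<..<b}"
      by (rule measure_negligible_symdiff) (auto simp: S_def intro!: negligible_subset[OF neg])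
    thus ?thesis using ab by simp
  qed
  define L where "L = \<bar>L'\<bar> + 1"
  have L0: "L > 0" by (simp add: L_def)
  have L: "\<bar>f x - f y\<bar> \<le> L * \<bar>x - y\<bar>" if "x \<in> {a..b}" "y \<in> {a..b}" for x y
  proof -
    have "L' * \<bar>x - y\<bar> \<le> L * \<bar>x - y\<bar>" unfolding L_def by (intro mult_right_mono) auto
    thus ?thesis using L'[OF that] by linarith
  qed
  have main: "f b - f a \<ge> - (e * (b - a) + L * e)" if e: "e > 0" for e
  proof -
    \<comment> \<open>Capped by \<open>L\<close> because \<open>lipschitz_growth_right\<close> needs
      -L \<le> -s.\<close>
    define s where "s = min e L"
    obtain K where K: "closed K" "K \<subseteq> S" "S - K \<in> lmeasurable" "emeasure lebesgue (S - K) < ennreal e"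
      using sets_lebesgue_inner_closed[OF fmeasurableD[OF Sl] e] by blast
    have KI: "K \<inter> {a..b} = K" using K(2) by (auto simp: S_def)
    have Kl: "K \<in> lmeasurable"
      using lmeasurable_compact[OF closed_Int_compact[OF K(1), of "{a..b}"]] KI by simp
    define m where "m = measure lebesgue (K \<inter> {a..b})"
    have "S = K \<union> (S - K)" using K by auto
    hence "measure lebesgue S \<le> measure lebesgue K + measure lebesgue (S - K)"
      using measure_Un_le[OF fmeasurableD[OF Kl] fmeasurableD[OF K(3)]] by simp
    moreover have "measure lebesgue (S - K) < e"
      using K(3,4) e by (simp add: emeasure_eq_measure2 ennreal_less_iff)
    ultimately have 1: "b - a - m \<le> e" unfolding m_def KI mS by simp
    have 2: "m \<le> b - a" unfolding m_def by (rule measure_Int_interval_le[OF K(1) ab])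
    have m0: "m \<ge> 0" by (simp add: m_def)
    have "- s * m - L * (b - a - m) \<le> f b - f a" unfolding m_def
    proof (rule lipschitz_growth_right[OF ab L K(1)])
      show "- L \<le> - s" by (simp add: s_def)
      fix x \<delta> :: real assume x: "x \<in> K" "0 < \<delta>"
      have "x \<in> {a<..<b}" "x \<notin> N" using x(1) K(2) by (auto simp: S_def)
      then obtain d where d: "d \<ge> 0" "(f has_real_derivative d) (at x)" using N(2) by blast
      show "\<exists>y>x. y < x + \<delta> \<and> - s * (y - x) \<le> f y - f x"
      proof -
        have "s > 0" using L0 e by (simp add: s_def)
        have "((\<lambda>h. (f (x + h) - f x) / h) \<longlongrightarrow> d) (at 0)" using d(2) by (simp add: DERIV_def)
        hence "\<forall>\<^sub>F h in at 0. (f (x + h) - f x) / h > - s"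
          by (rule order_tendstoD) (use d \<open>s > 0\<close> in auto)
        then obtain r where r: "r > 0" "\<And>h. h \<noteq> 0 \<Longrightarrow> \<bar>h\<bar> < r \<Longrightarrow> (f (x + h) - f x) / h > - s"
          unfolding eventually_at by (auto simp: dist_real_def)
        define h where "h = min r \<delta> / 2"
        have h: "h > 0" "h < r" "h < \<delta>" using r x by (auto simp: h_def)
        have "- s * h \<le> f (x + h) - f x" using r(2)[of h] h by (simp add: field_simps)
        thus ?thesis using h by (intro exI[of _ "x + h"]) auto
      qed
    qed
    moreover have "s * m \<le> e * (b - a)" using 2 m0 e by (intro mult_mono) (auto simp: s_def)
    moreover have "L * (b - a - m) \<le> L * e" using 1 L0 by (intro mult_left_mono) auto
    ultimately show ?thesis by simp
  qed
  show ?thesis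
  proof (rule ccontr)
    assume "\<not> f a \<le> f b"
    hence p: "f a - f b > 0" by simp
    define c where "c = b - a + L"
    have c: "c > 0" using ab L0 by (simp add: c_def add_nonneg_pos)
    \<comment> \<open>Makes the loss exactly half of the assumed drop
      \<open>f a - f b\<close>.\<close>
    define X where "X = (f a - f b) / (2 * c)"
    have "X > 0" using p c by (simp add: X_def)
    have "f b - f a \<ge> - (X * (b - a) + L * X)" by (rule main[OF \<open>X > 0\<close>])
    also have "X * (b - a) + L * X = X * c" unfolding c_def by (simp add: algebra_simps)
    also have "\<dots> = (f a - f b) / 2" using c by (simp add: X_def)
    finally show False using p by (simp add: field_simps)
  qed
qed

text \<open>Each horizontal slice is Lipschitz, so for fixed r < s and fixed sides its gap set is
  null. Fubini turns this into a planar null set, and the countably many sets with rational r, s are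
  removed together.\<close>

lemma AE_partial_derivative:
  fixes f :: "real \<times> real \<Rightarrow> real"
  assumes cont: "continuous_on UNIV f"
    and L: "\<And>x y t. \<bar>f (x, t) - f (y, t)\<bar> \<le> L * \<bar>x - y\<bar>"
  shows "AE p in lebesgue. \<exists>d. ((\<lambda>y. f (y, snd p)) has_real_derivative d) (at (fst p))"
proof -
  define gap where "gap a c r s p \<longleftrightarrow> one_sided_gt a s (\<lambda>y. f (y, snd p)) (fst p)
     \<and> one_sided_gt c (-r) (\<lambda>y. - f (y, snd p)) (fst p)" for a c r s p
  have AE1: "AE p in lborel. \<not> gap a c r s p" if a: "a \<in> {1,-1}" "c \<in> {1,-1}" and "r < s" for a c r s
  proof -
    have "continuous_on UNIV (\<lambda>p. - f p)" using cont by (intro continuous_intros)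
    note meas = borel_one_sided_gt[OF cont, of a s] borel_one_sided_gt[OF this, of c "-r"]
    have A: "{p. gap a c r s p} \<in> sets borel"
      using sets.Int[OF meas] unfolding gap_def by (simp add: Collect_conj_eq)
    have A': "{p \<in> space (lborel \<Otimes>\<^sub>M lborel). \<not> gap a c r s p} \<in> sets (lborel \<Otimes>\<^sub>M lborel)"
    proof -
      have "{p. \<not> gap a c r s p} = - {p. gap a c r s p}" by auto
      also have "\<dots> \<in> sets borel" using A by (rule borel_comp)
      finally show ?thesis unfolding lborel_prod by simp
    qed
    have "AE x in lborel. \<not> gap a c r s (x, t)" for t
    proof -
      have "(\<lambda>x. (x, t)) -` {p. gap a c r s p} \<inter> space borel \<in> sets borel"
        by (rule measurable_sets[OF _ A]) (auto intro!: borel_measurable_continuous_onI continuous_intros)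
      hence "{x. gap a c r s (x, t)} \<in> sets borel" by (simp add: vimage_def)
      hence "{x. gap a c r s (x, t)} \<in> sets lebesgue" "{x. gap a c r s (x, t)} \<in> sets lborel" by auto
      moreover have "negligible {x. gap a c r s (x, t)}"
        using calculation(1) a \<open>r < s\<close> L unfolding gap_def fst_conv snd_conv
        by (intro negligible_one_sided_gap) auto
      ultimately have "{x. gap a c r s (x, t)} \<in> null_sets lborel"
        by (simp add: negligible_iff_null_sets null_sets_completion_iff)
      thus ?thesis by (intro AE_I'[of "{x. gap a c r s (x, t)}"]) auto
    qed
    hence "AE t in lborel. AE x in lborel. \<not> gap a c r s (x, t)" by simp
    \<comment> \<open>The slices fix the second coordinate, whereas \<open>AE_pair_measure\<close>
      wants the inner quantifier to run over it; hence the exchange.\<close>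
    hence "AE x in lborel. AE t in lborel. \<not> gap a c r s (x, t)"
      using lborel_pair.AE_commute[of "\<lambda>x t. \<not> gap a c r s (x, t)"] A' by simp
    thus ?thesis using lborel_pair.AE_pair_measure[OF A'] unfolding lborel_prod by simp
  qed
  have "AE p in lborel. \<forall>r\<in>\<rat>. \<forall>s\<in>\<rat>. \<forall>a\<in>{1,-1}. \<forall>c\<in>{1,-1}. r < s \<longrightarrow> \<not> gap a c r s p"
    using AE1 by (auto simp: AE_ball_countable countable_rat simp del: ball_simps)
  hence "AE p in lborel. \<exists>d. ((\<lambda>y. f (y, snd p)) has_real_derivative d) (at (fst p))"
  proof (rule eventually_mono)
    fix p assume p: "\<forall>r\<in>\<rat>. \<forall>s\<in>\<rat>. \<forall>a\<in>{1,-1}. \<forall>c\<in>{1,-1}. r < s \<longrightarrow> \<not> gap a c r s p"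
    show "\<exists>d. ((\<lambda>y. f (y, snd p)) has_real_derivative d) (at (fst p))"
      by (rule differentiable_if_no_gap[OF L]) (use p in \<open>unfold gap_def, blast\<close>)
  qed
  thus ?thesis by (rule AE_completion)
qed

section \<open>The Gaussian semigroup\<close>

text \<open>Meant for Gaussian means: a remainder bound of \<open>g\<close> that is uniform in the
  base point survives averaging, so nothing has to be differentiated under the integral
  sign.\<close>

lemma DERIV_if_quadratic_remainder:
  fixes F :: "real \<Rightarrow> real"
  assumes "\<And>h. \<bar>F (x + h) - F x - h * D\<bar> \<le> C * h\<^sup>2"
  shows "(F has_real_derivative D) (at x)"
  unfolding DERIV_def
proof (rule LIM_I)
  fix r :: real assume r: "r > 0"
  have C: "C \<ge> 0" using order_trans[OF abs_ge_zero assms[of 1]] by simp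
  define s where "s = r / (C + 1)"
  have s: "s > 0" using r C by (simp add: s_def)
  show "\<exists>s>0. \<forall>h. h \<noteq> 0 \<and> norm (h - 0) < s \<longrightarrow> norm ((F (x + h) - F x) / h - D) < r"
  proof (intro exI[of _ s] conjI allI impI s)
    fix h :: real assume h: "h \<noteq> 0 \<and> norm (h - 0) < s"
    have "norm ((F (x + h) - F x) / h - D) = \<bar>F (x + h) - F x - h * D\<bar> / \<bar>h\<bar>"
      using h by (simp add: abs_divide[symmetric] diff_divide_distrib)
    also have "\<dots> \<le> C * h\<^sup>2 / \<bar>h\<bar>" using assms[of h] by (intro divide_right_mono) auto
    also have "\<dots> = C * \<bar>h\<bar>" using h by (cases "h > 0") (auto simp: power2_eq_square)
    also have "\<dots> \<le> C * s" using h C by (intro mult_left_mono) auto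
    also have "\<dots> < r" using r C by (simp add: s_def field_simps)
    finally show "norm ((F (x + h) - F x) / h - D) < r" .
  qed
qed

lemma continuous_on_if_DERIV:
  fixes g :: "real \<Rightarrow> real"
  assumes "\<And>x. (g has_real_derivative g' x) (at x)"
  shows "continuous_on A g"
  by (intro continuous_at_imp_continuous_on ballI DERIV_isCont[OF assms])

lemma lipschitz_of_bounded_deriv:
  fixes g :: "real \<Rightarrow> real"
  assumes "\<And>x. (g has_real_derivative g' x) (at x)" "\<And>x. \<bar>g' x\<bar> \<le> C"
  shows "\<bar>g y - g x\<bar> \<le> C * \<bar>y - x\<bar>"
proof -
  have "norm (g y - g x) \<le> C * norm (y - x)"
    by (rule field_differentiable_bound[of UNIV g g']) (use assms in auto)
  thus ?thesis by simp
qed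

lemma quadratic_remainder:
  fixes g :: "real \<Rightarrow> real"
  assumes g: "\<And>x. (g has_real_derivative g' x) (at x)" "\<And>x. (g' has_real_derivative g'' x) (at x)"
    and C: "\<And>x. \<bar>g'' x\<bar> \<le> C"
  shows "\<bar>g (y + h) - g y - h * g' y\<bar> \<le> C * h\<^sup>2"
proof -
  have C0: "C \<ge> 0" using order_trans[OF abs_ge_zero C[of 0]] .
  have "norm ((g (y + h) - (y + h) * g' y) - (g y - y * g' y)) \<le> (C * \<bar>h\<bar>) * norm (y + h - y)"
  proof (rule field_differentiable_bound[of "cball y \<bar>h\<bar>"])
    fix z assume z: "z \<in> cball y \<bar>h\<bar>"
    show "((\<lambda>z. g z - z * g' y) has_real_derivative g' z - g' y) (at z within cball y \<bar>h\<bar>)"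
      by (rule has_field_derivative_at_within) (auto intro!: derivative_eq_intros g)
    have "\<bar>g' z - g' y\<bar> \<le> C * \<bar>z - y\<bar>" by (rule lipschitz_of_bounded_deriv[OF g(2) C])
    also have "\<dots> \<le> C * \<bar>h\<bar>" using z C0 by (intro mult_left_mono) (auto simp: dist_real_def)
    finally show "norm (g' z - g' y) \<le> C * \<bar>h\<bar>" by simp
  qed (auto simp: dist_real_def)
  thus ?thesis by (simp add: algebra_simps power2_eq_square abs_mult_self_eq)
qed

abbreviation gauss_mean :: "(real \<Rightarrow> real) \<Rightarrow> real" where
  "gauss_mean h \<equiv> (\<integral>z. std_normal_density z * h z \<partial>lborel)"

text \<open>The mean of g (x + s Z) for a standard normal Z. The parameter is the standard deviation
  and not the time: for Lipschitz \<open>g\<close> the mean is then Lipschitz in \<open>s\<close> up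
  to s = 0, where it returns \<open>g\<close>.\<close>

definition gauss :: "(real \<Rightarrow> real) \<Rightarrow> real \<Rightarrow> real \<Rightarrow> real" where
  "gauss g x s = gauss_mean (\<lambda>z. g (x + s * z))"

lemma integrable_gauss_weight:
  fixes h :: "real \<Rightarrow> real"
  assumes "continuous_on UNIV h" "\<And>z. \<bar>h z\<bar> \<le> C * \<bar>z\<bar> ^ k"
  shows "integrable lborel (\<lambda>z. std_normal_density z * h z)"
proof (rule Bochner_Integration.integrable_bound)
  show "integrable lborel (\<lambda>z. C * (std_normal_density z * \<bar>z\<bar> ^ k))"
    by (intro integrable_mult_right integrable_std_normal_moment_abs)
  show "(\<lambda>z. std_normal_density z * h z) \<in> borel_measurable lborel"
    using borel_measurable_continuous_onI[OF assms(1)] by measurable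
  show "AE z in lborel. norm (std_normal_density z * h z) \<le> norm (C * (std_normal_density z * \<bar>z\<bar> ^ k))"
  proof (rule AE_I2)
    fix z
    have "norm (std_normal_density z * h z) = std_normal_density z * \<bar>h z\<bar>" by (simp add: abs_mult)
    also have "\<dots> \<le> std_normal_density z * (C * \<bar>z\<bar> ^ k)" by (intro mult_left_mono assms) auto
    also have "\<dots> \<le> norm (C * (std_normal_density z * \<bar>z\<bar> ^ k))" by (simp add: mult_ac)
    finally show "norm (std_normal_density z * h z) \<le> norm (C * (std_normal_density z * \<bar>z\<bar> ^ k))" .
  qed
qed

lemma gauss_weight_bound:
  fixes h :: "real \<Rightarrow> real"
  assumes "continuous_on UNIV h" "\<And>z. \<bar>h z\<bar> \<le> C * \<bar>z\<bar> ^ k"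
  shows "\<bar>gauss_mean h\<bar> \<le> C * gauss_mean (\<lambda>z. \<bar>z\<bar> ^ k)"
proof -
  have "\<bar>gauss_mean h\<bar> \<le> (\<integral>z. \<bar>std_normal_density z * h z\<bar> \<partial>lborel)"
    using integral_norm_bound[of lborel "\<lambda>z. std_normal_density z * h z"] by simp
  also have "\<dots> \<le> (\<integral>z. C * (std_normal_density z * \<bar>z\<bar> ^ k) \<partial>lborel)"
  proof (rule integral_mono)
    show "integrable lborel (\<lambda>z. \<bar>std_normal_density z * h z\<bar>)"
      by (intro integrable_abs integrable_gauss_weight[OF assms])
    show "integrable lborel (\<lambda>z. C * (std_normal_density z * \<bar>z\<bar> ^ k))"
      by (intro integrable_mult_right integrable_std_normal_moment_abs)
    fix z
    have "std_normal_density z * \<bar>h z\<bar> \<le> std_normal_density z * (C * \<bar>z\<bar> ^ k)" by (intro mult_left_mono assms) auto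
    thus "\<bar>std_normal_density z * h z\<bar> \<le> C * (std_normal_density z * \<bar>z\<bar> ^ k)" by (simp add: abs_mult mult_ac)
  qed
  finally show ?thesis by simp
qed

lemma gauss_integrable:
  assumes "continuous_on UNIV g" "\<And>x. \<bar>g x\<bar> \<le> C"
  shows "integrable lborel (\<lambda>z. std_normal_density z * g (x + s * z))"
proof (rule integrable_gauss_weight[of _ C 0])
  show "continuous_on UNIV (\<lambda>z. g (x + s * z))"
    by (rule continuous_on_compose2[OF assms(1)]) (auto intro!: continuous_intros)
qed (use assms in auto)

lemma gauss_integrable_mult:
  assumes "continuous_on UNIV g" "\<And>x. \<bar>g x\<bar> \<le> C"
  shows "integrable lborel (\<lambda>z. std_normal_density z * (z * g (x + s * z)))"
proof (rule integrable_gauss_weight[of _ C 1])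
  have "continuous_on UNIV (\<lambda>z. g (x + s * z))"
    by (rule continuous_on_compose2[OF assms(1)]) (auto intro!: continuous_intros)
  thus "continuous_on UNIV (\<lambda>z. z * g (x + s * z))" by (intro continuous_intros)
  show "\<bar>z * g (x + s * z)\<bar> \<le> C * \<bar>z\<bar> ^ 1" for z
    using mult_right_mono[OF assms(2)[of "x + s * z"], of "\<bar>z\<bar>"] by (simp add: abs_mult mult.commute)
qed

lemma normal_moment0: "gauss_mean (\<lambda>z. \<bar>z\<bar> ^ 0) = 1"
  using integral_std_normal_moment_even[of 0] by simp

lemma normal_moment2: "gauss_mean (\<lambda>z. \<bar>z\<bar> ^ 2) = 1"
  using integral_std_normal_moment_even[of 1] by (simp add: power2_eq_square)

lemma normal_moment1: "gauss_mean (\<lambda>z. \<bar>z\<bar> ^ 1) \<le> 1"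
proof -
  have "sqrt (2 / pi) \<le> 1" using pi_gt3 by simp
  thus ?thesis using integral_std_normal_moment_abs_odd[of 0] by simp
qed

lemma gauss_bound:
  assumes "continuous_on UNIV g" "\<And>x. \<bar>g x\<bar> \<le> C"
  shows "\<bar>gauss g x s\<bar> \<le> C"
proof -
  have "continuous_on UNIV (\<lambda>z. g (x + s * z))"
    by (rule continuous_on_compose2[OF assms(1)]) (auto intro!: continuous_intros)
  from gauss_weight_bound[OF this, of C 0] show ?thesis
    using assms(2) unfolding normal_moment0 gauss_def by simp
qed

lemma gauss_0: "gauss g x 0 = g x"
proof -
  have "gauss g x 0 = gauss_mean (\<lambda>z. g x)" by (simp add: gauss_def)
  also have "\<dots> = gauss_mean (\<lambda>z. \<bar>z\<bar> ^ 0) * g x"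
    unfolding power_0 mult_1_right by (rule integral_mult_left_zero)
  finally show ?thesis unfolding normal_moment0 by simp
qed

lemma integral_second_difference:
  fixes a b c :: "real \<Rightarrow> real"
  assumes "integrable lborel a" "integrable lborel b" "integrable lborel c" "\<And>z. F z = a z - b z - h * c z"
  shows "(\<integral>z. a z \<partial>lborel) - (\<integral>z. b z \<partial>lborel) - h * (\<integral>z. c z \<partial>lborel) = (\<integral>z. F z \<partial>lborel)"
proof -
  have "(\<integral>z. F z \<partial>lborel) = (\<integral>z. a z - b z - h * c z \<partial>lborel)" by (simp only: assms(4))
  also have "\<dots> = (\<integral>z. a z \<partial>lborel) - (\<integral>z. b z \<partial>lborel) - (\<integral>z. h * c z \<partial>lborel)"
    using assms(1-3) by simp
  finally show ?thesis by simp
qed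

lemma gauss_DERIV_x:
  assumes g: "\<And>x. (g has_real_derivative g' x) (at x)" "\<And>x. (g' has_real_derivative g'' x) (at x)"
    and b: "\<And>x. \<bar>g x\<bar> \<le> C0" "\<And>x. \<bar>g' x\<bar> \<le> C1" "\<And>x. \<bar>g'' x\<bar> \<le> C2"
  shows "((\<lambda>x. gauss g x s) has_real_derivative gauss g' x s) (at x)"
proof (rule DERIV_if_quadratic_remainder[where C = C2])
  fix h
  have c: "continuous_on UNIV g" "continuous_on UNIV g'" using continuous_on_if_DERIV[OF g(1)] continuous_on_if_DERIV[OF g(2)] by auto
  note i = gauss_integrable[OF c(1) b(1)] gauss_integrable[OF c(2) b(2)]
  have eq: "gauss g (x + h) s - gauss g x s - h * gauss g' x s =
    gauss_mean (\<lambda>z. (g (x + s * z + h) - g (x + s * z) - h * g' (x + s * z)))"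
    unfolding gauss_def
    by (rule integral_second_difference[OF i(1)[of "x + h" s] i(1)[of x s] i(2)[of x s]]) (simp add: algebra_simps)
  have "\<bar>gauss_mean (\<lambda>z. (g (x + s * z + h) - g (x + s * z) - h * g' (x + s * z)))\<bar>
      \<le> C2 * h\<^sup>2 * gauss_mean (\<lambda>z. \<bar>z\<bar> ^ 0)"
  proof (rule gauss_weight_bound)
    show "continuous_on UNIV (\<lambda>z. g (x + s * z + h) - g (x + s * z) - h * g' (x + s * z))"
      by (intro continuous_intros continuous_on_compose2[OF c(1)] continuous_on_compose2[OF c(2)]) auto
    show "\<bar>g (x + s * z + h) - g (x + s * z) - h * g' (x + s * z)\<bar> \<le> C2 * h\<^sup>2 * \<bar>z\<bar> ^ 0" for z
      using quadratic_remainder[OF g b(3)] by simp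
  qed
  thus "\<bar>gauss g (x + h) s - gauss g x s - h * gauss g' x s\<bar> \<le> C2 * h\<^sup>2"
    unfolding eq normal_moment0 by (simp only: mult_1_right)
qed

text \<open>As for the x-derivative, but the argument moves by h z, so the quadratic remainder is
  averaged against the second moment, which equals 1.\<close>

lemma gauss_DERIV_sigma:
  assumes g: "\<And>x. (g has_real_derivative g' x) (at x)" "\<And>x. (g' has_real_derivative g'' x) (at x)"
    and b: "\<And>x. \<bar>g x\<bar> \<le> C0" "\<And>x. \<bar>g' x\<bar> \<le> C1" "\<And>x. \<bar>g'' x\<bar> \<le> C2"
  shows "((\<lambda>s. gauss g x s) has_real_derivative gauss_mean (\<lambda>z. (z * g' (x + s * z)))) (at s)"
proof (rule DERIV_if_quadratic_remainder[where C = C2])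
  fix h
  have c: "continuous_on UNIV g" "continuous_on UNIV g'" using continuous_on_if_DERIV[OF g(1)] continuous_on_if_DERIV[OF g(2)] by auto
  note i = gauss_integrable[OF c(1) b(1)] gauss_integrable_mult[OF c(2) b(2)]
  have eq: "gauss g x (s + h) - gauss g x s - h * gauss_mean (\<lambda>z. (z * g' (x + s * z))) =
    gauss_mean (\<lambda>z. (g (x + s * z + h * z) - g (x + s * z) - (h * z) * g' (x + s * z)))"
    unfolding gauss_def
    by (rule integral_second_difference[OF i(1)[of x "s + h"] i(1)[of x s] i(2)[of x s]]) (simp add: algebra_simps)
  have "\<bar>gauss_mean (\<lambda>z. (g (x + s * z + h * z) - g (x + s * z) - (h * z) * g' (x + s * z)))\<bar>
      \<le> C2 * h\<^sup>2 * gauss_mean (\<lambda>z. \<bar>z\<bar> ^ 2)"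
  proof (rule gauss_weight_bound)
    show "continuous_on UNIV (\<lambda>z. g (x + s * z + h * z) - g (x + s * z) - (h * z) * g' (x + s * z))"
      by (intro continuous_intros continuous_on_compose2[OF c(1)] continuous_on_compose2[OF c(2)]) auto
    show "\<bar>g (x + s * z + h * z) - g (x + s * z) - (h * z) * g' (x + s * z)\<bar> \<le> C2 * h\<^sup>2 * \<bar>z\<bar> ^ 2" for z
      using quadratic_remainder[OF g b(3), of "x + s * z" "h * z"] by (simp add: power_mult_distrib mult.assoc)
  qed
  thus "\<bar>gauss g x (s + h) - gauss g x s - h * gauss_mean (\<lambda>z. (z * g' (x + s * z)))\<bar> \<le> C2 * h\<^sup>2"
    unfolding eq normal_moment2 by (simp only: mult_1_right)
qed

lemma std_normal_density_DERIV:
  "(std_normal_density has_real_derivative - z * std_normal_density z) (at z)"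
proof -
  have "((\<lambda>z. c * exp (- z\<^sup>2 / 2)) has_real_derivative - z * (c * exp (- z\<^sup>2 / 2))) (at z)" for c :: real
    by (auto intro!: derivative_eq_intros simp: power2_eq_square)
  thus ?thesis unfolding std_normal_density_def[abs_def] .
qed

text \<open>Stein's identity. The normal density \<phi> satisfies \<phi>' = - z \<phi>, so the
  difference of the two integrands is the derivative of \<phi> h, which vanishes at both
  infinities.\<close>

lemma gauss_integration_by_parts:
  assumes h: "\<And>z. (h has_real_derivative h' z) (at z)" and c: "continuous_on UNIV h'"
    and b: "\<And>z. \<bar>h z\<bar> \<le> C0" "\<And>z. \<bar>h' z\<bar> \<le> C1"
  shows "gauss_mean (\<lambda>z. (z * h z)) = gauss_mean (\<lambda>z. h' z)"
proof -
  have ch: "continuous_on UNIV h" by (rule continuous_on_if_DERIV[OF h])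
  have i1: "integrable lborel (\<lambda>z. std_normal_density z * (z * h z))"
    using gauss_integrable_mult[OF ch b(1), of 0 1] by simp
  have i2: "integrable lborel (\<lambda>z. std_normal_density z * h' z)"
    using gauss_integrable[OF c b(2), of 0 1] by simp
  define f where "f z = std_normal_density z * h' z - std_normal_density z * (z * h z)" for z
  have d: "((\<lambda>z. std_normal_density z * h z) has_real_derivative f z) (at z)" for z
    unfolding f_def by (auto intro!: derivative_eq_intros std_normal_density_DERIV h simp: algebra_simps)
  have lim: "((\<lambda>z. std_normal_density z * h z) \<longlongrightarrow> 0) F"
    if "(std_normal_density \<longlongrightarrow> 0) F" for F
  proof (rule Lim_null_comparison)
    show "\<forall>\<^sub>F z in F. norm (std_normal_density z * h z) \<le> std_normal_density z * C0"
      by (intro always_eventually allI) (auto simp: abs_mult intro: mult_left_mono b)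
    show "((\<lambda>z. std_normal_density z * C0) \<longlongrightarrow> 0) F" using tendsto_mult_right[OF that, of C0] by simp
  qed
  have "(LBINT z=-\<infinity>..\<infinity>. f z) = 0 - 0"
  proof (rule interval_integral_FTC_integrable)
    show "((\<lambda>z. std_normal_density z * h z) has_vector_derivative f z) (at z)" for z
      using d by (simp add: has_real_derivative_iff_has_vector_derivative)
    show "isCont f z" for z
    proof -
      have "isCont h' z" "isCont h z" using c ch by (auto simp: continuous_on_eq_continuous_at)
      moreover have "isCont std_normal_density z" using std_normal_density_DERIV by (rule DERIV_isCont)
      ultimately show ?thesis unfolding f_def by (intro continuous_intros)
    qed
    show "set_integrable lborel (einterval (- \<infinity>) \<infinity>) f"
      unfolding f_def using i1 i2 by (simp add: set_integrable_def)
    have "(std_normal_density \<longlongrightarrow> 0) at_top" "(std_normal_density \<longlongrightarrow> 0) at_bot"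
      unfolding std_normal_density_def[abs_def] by real_asymp+
    thus "(((\<lambda>z. std_normal_density z * h z) \<circ> real_of_ereal) \<longlongrightarrow> 0) (at_right (- \<infinity>))"
      "(((\<lambda>z. std_normal_density z * h z) \<circ> real_of_ereal) \<longlongrightarrow> 0) (at_left \<infinity>)"
      by (auto simp: ereal_tendsto_simps intro!: lim)
  qed simp
  hence "(\<integral>z. f z \<partial>lborel) = 0" by (simp add: interval_integral_to_infinity_eq interval_lebesgue_integral_def set_lebesgue_integral_def)
  thus ?thesis unfolding f_def using i1 i2 by simp
qed

text \<open>Variance 2 t belongs to u_t = u_xx with unit coefficient. Since \<open>sqrt\<close> is
  odd and continuous on the whole line, bounds and continuity can be stated without a restriction on
  t.\<close>

definition heat_ext :: "(real \<Rightarrow> real) \<Rightarrow> real \<Rightarrow> real \<Rightarrow> real" where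
  "heat_ext g x t = gauss g x (sqrt (2 * t))"

text \<open>By Stein's identity the s-derivative is s times the mean of g'', and this factor s
  cancels the derivative 1/s of sqrt (2 t).\<close>

lemma heat_ext_DERIV_t:
  assumes g: "\<And>x. (g has_real_derivative g' x) (at x)" "\<And>x. (g' has_real_derivative g'' x) (at x)"
    and c: "continuous_on UNIV g''"
    and b: "\<And>x. \<bar>g x\<bar> \<le> C0" "\<And>x. \<bar>g' x\<bar> \<le> C1" "\<And>x. \<bar>g'' x\<bar> \<le> C2" and t: "t > 0"
  shows "((\<lambda>t. heat_ext g x t) has_real_derivative heat_ext g'' x t) (at t)"
proof -
  define s where "s = sqrt (2 * t)"
  have s: "s > 0" using t by (simp add: s_def)
  have "gauss_mean (\<lambda>z. (z * g' (x + s * z))) = gauss_mean (\<lambda>z. (s * g'' (x + s * z)))"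
  proof (rule gauss_integration_by_parts[where ?C0.0 = C1 and ?C1.0 = "s * C2"])
    show "((\<lambda>z. g' (x + s * z)) has_real_derivative s * g'' (x + s * z)) (at z)" for z
    proof -
      have "((\<lambda>z. x + s * z) has_real_derivative s) (at z)" by (auto intro!: derivative_eq_intros)
      from DERIV_chain2[OF g(2) this] show ?thesis by (simp add: mult.commute)
    qed
    show "continuous_on UNIV (\<lambda>z. s * g'' (x + s * z))"
      by (intro continuous_intros continuous_on_compose2[OF c]) auto
  qed (use b s in \<open>auto simp: abs_mult\<close>)
  also have "\<dots> = s * gauss g'' x s" 
    unfolding gauss_def by (subst integral_mult_right_zero[symmetric]) (simp add: mult_ac)
  finally have d: "(gauss g x has_real_derivative s * gauss g'' x s) (at s)"
    using gauss_DERIV_sigma[OF g b, of x s] by simp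
  have "((\<lambda>t. sqrt (2 * t)) has_real_derivative 1 / s) (at t)"
    unfolding s_def using t by (auto intro!: derivative_eq_intros simp: field_simps)
  from DERIV_chain2[OF d[unfolded s_def] this]
  show ?thesis unfolding heat_ext_def using s by (simp add: s_def)
qed

lemma gauss_lipschitz:
  assumes g: "\<And>x. (g has_real_derivative g' x) (at x)"
    and b: "\<And>x. \<bar>g x\<bar> \<le> C0" "\<And>x. \<bar>g' x\<bar> \<le> C1"
  shows "\<bar>gauss g x s - gauss g y s'\<bar> \<le> C1 * (\<bar>x - y\<bar> + \<bar>s - s'\<bar>)"
proof -
  have c: "continuous_on UNIV g" by (rule continuous_on_if_DERIV[OF g])
  have C1: "C1 \<ge> 0" using order_trans[OF abs_ge_zero b(2)[of 0]] .
  note i = gauss_integrable[OF c b(1)]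
  have cc: "continuous_on UNIV (\<lambda>z. g (x + s * z) - g (x' + s' * z))" for x s x' s'
    by (intro continuous_intros continuous_on_compose2[OF c]) auto
  have "gauss g x s - gauss g y s = gauss_mean (\<lambda>z. (g (x + s * z) - g (y + s * z)))"
    unfolding gauss_def using i[of x s] i[of y s] by (simp add: algebra_simps)
  also have "\<bar>\<dots>\<bar> \<le> C1 * \<bar>x - y\<bar> * gauss_mean (\<lambda>z. \<bar>z\<bar> ^ 0)"
  proof (rule gauss_weight_bound[OF cc])
    show "\<bar>g (x + s * z) - g (y + s * z)\<bar> \<le> C1 * \<bar>x - y\<bar> * \<bar>z\<bar> ^ 0" for z
      using lipschitz_of_bounded_deriv[OF g b(2), of "x + s * z" "y + s * z"] by simp
  qed
  finally have 1: "\<bar>gauss g x s - gauss g y s\<bar> \<le> C1 * \<bar>x - y\<bar>" unfolding normal_moment0 by simp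
  have "gauss g y s - gauss g y s' = gauss_mean (\<lambda>z. (g (y + s * z) - g (y + s' * z)))"
    unfolding gauss_def using i[of y s] i[of y s'] by (simp add: algebra_simps)
  also have "\<bar>\<dots>\<bar> \<le> C1 * \<bar>s - s'\<bar> * gauss_mean (\<lambda>z. \<bar>z\<bar> ^ 1)"
  proof (rule gauss_weight_bound[OF cc])
    show "\<bar>g (y + s * z) - g (y + s' * z)\<bar> \<le> C1 * \<bar>s - s'\<bar> * \<bar>z\<bar> ^ 1" for z
      using lipschitz_of_bounded_deriv[OF g b(2), of "y + s * z" "y + s' * z"]
      by (simp add: left_diff_distrib[symmetric] abs_mult mult.assoc)
  qed
  also have "\<dots> \<le> C1 * \<bar>s - s'\<bar> * 1" using C1 normal_moment1 by (intro mult_left_mono) auto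
  finally have 2: "\<bar>gauss g y s - gauss g y s'\<bar> \<le> C1 * \<bar>s - s'\<bar>" by simp
  show ?thesis using 1 2 by (simp add: algebra_simps)
qed

lemma continuous_heat_ext:
  assumes g: "\<And>x. (g has_real_derivative g' x) (at x)"
    and b: "\<And>x. \<bar>g x\<bar> \<le> C0" "\<And>x. \<bar>g' x\<bar> \<le> C1"
  shows "continuous_on UNIV (\<lambda>p. heat_ext g (fst p) (snd p))"
proof -
  have C1: "C1 \<ge> 0" using order_trans[OF abs_ge_zero b(2)[of 0]] .
  have "continuous_on UNIV (\<lambda>q. gauss g (fst q) (snd q))"
  proof (rule lipschitz_on_continuous_on[of "2 * C1"], rule lipschitz_onI)
    fix p q :: "real \<times> real"
    have "\<bar>gauss g (fst p) (snd p) - gauss g (fst q) (snd q)\<bar> \<le> C1 * (\<bar>fst p - fst q\<bar> + \<bar>snd p - snd q\<bar>)"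
      by (rule gauss_lipschitz[OF g b])
    also have "\<dots> \<le> C1 * (dist p q + dist p q)"
      using C1 dist_fst_le[of p q] dist_snd_le[of p q] by (intro mult_left_mono add_mono) (auto simp: dist_real_def)
    finally show "dist (gauss g (fst p) (snd p)) (gauss g (fst q) (snd q)) \<le> 2 * C1 * dist p q"
      by (simp add: dist_real_def)
  qed (use C1 in auto)
  moreover have "continuous_on UNIV (\<lambda>p::real \<times> real. (fst p, sqrt (2 * snd p)))" by (intro continuous_intros)
  ultimately have "continuous_on UNIV (\<lambda>p::real \<times> real. gauss g (fst (fst p, sqrt (2 * snd p))) (snd (fst p, sqrt (2 * snd p))))"
    by (rule continuous_on_compose2) auto
  thus ?thesis by (simp add: heat_ext_def)
qed

text \<open>The substitution z \<mapsto> -z preserves the density and turns the mean into its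
  negative.\<close>

lemma gauss_odd:
  assumes "\<And>y. g (c - y) = - g (c + y)"
  shows "gauss g c s = 0"
proof -
  have "gauss g c s = (\<integral>z. std_normal_density (0 + -1 * z) * g (c + s * (0 + -1 * z)) \<partial>lborel)"
    unfolding gauss_def by (subst lborel_integral_real_affine[of "-1" _ 0]) auto
  also have "\<dots> = - gauss g c s"
    unfolding gauss_def using assms by (simp add: std_normal_density_def)
  finally show ?thesis by simp
qed

section \<open>The heat equation on the interval\<close>

text \<open>The 2-periodic continuation by reflection across the integers, even for \<sigma> = 1 and
  odd for \<sigma> = -1. Both signs are kept because differentiation exchanges them.\<close>

definition reflect_ext :: "real \<Rightarrow> (real \<Rightarrow> real) \<Rightarrow> real \<Rightarrow> real" where
  "reflect_ext \<sigma> f x = (if even \<lfloor>x\<rfloor> then f (x - of_int \<lfloor>x\<rfloor>) else \<sigma> * f (of_int \<lfloor>x\<rfloor> + 1 - x))"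

text \<open>Between integers this is the chain rule, the reflected branch producing the sign. Around
  an integer the extension vanishes identically, because the support of \<open>f\<close> stays away
  from 0 and 1; so the branches glue without a matching condition.\<close>

lemma reflect_ext_DERIV:
  assumes d: "\<And>x. (f has_real_derivative f' x) (at x)"
    and ab: "0 < a" "b < 1" and supp: "\<And>x. x \<notin> {a..b} \<Longrightarrow> f x = 0" "\<And>x. x \<notin> {a..b} \<Longrightarrow> f' x = 0"
  shows "(reflect_ext \<sigma> f has_real_derivative reflect_ext (- \<sigma>) f' x) (at x)"
proof (cases "x \<in> \<int>")
  case False
  define k where "k = \<lfloor>x\<rfloor>"
  have k: "of_int k < x" "x < of_int k + 1" using False unfolding k_def
    by (metis Ints_of_int floor_correct order_le_less, linarith)
  have fl: "\<lfloor>y\<rfloor> = k" if "y \<in> {of_int k<..<of_int k + 1}" for y using that by (simp add: floor_unique)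
  show ?thesis
  proof (cases "even k")
    case True
    have "((\<lambda>y. f (y - of_int k)) has_real_derivative f' (x - of_int k) * (1 - 0)) (at x)"
      by (rule DERIV_chain2[OF d]) (intro derivative_intros)
    hence "(reflect_ext \<sigma> f has_real_derivative f' (x - of_int k) * (1 - 0)) (at x)"
      by (rule has_field_derivative_transform_within_open[where S = "{of_int k<..<of_int k + 1}"])
         (use k True fl in \<open>auto simp: reflect_ext_def\<close>)
    thus ?thesis using True by (simp add: reflect_ext_def k_def[symmetric])
  next
    case odd: False
    have "((\<lambda>y. \<sigma> * f (of_int k + 1 - y)) has_real_derivative \<sigma> * (f' (of_int k + 1 - x) * (0 - 1))) (at x)"
      by (rule DERIV_cmult[OF DERIV_chain2[OF d]]) (intro derivative_intros)
    hence "(reflect_ext \<sigma> f has_real_derivative \<sigma> * (f' (of_int k + 1 - x) * (0 - 1))) (at x)"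
      by (rule has_field_derivative_transform_within_open[where S = "{of_int k<..<of_int k + 1}"])
         (use k odd fl in \<open>auto simp: reflect_ext_def\<close>)
    thus ?thesis using odd by (simp add: reflect_ext_def k_def[symmetric])
  qed
next
  case True
  then obtain k where k: "x = of_int k" by (auto elim: Ints_cases)
  define c where "c = min (min a (1 - b)) 1"
  have c: "c > 0" "c \<le> a" "c \<le> 1 - b" "c \<le> 1" using ab by (auto simp: c_def)
  have z: "reflect_ext \<sigma> f y = 0" if y: "y \<in> {of_int k - c<..<of_int k + c}" for y
  proof (cases "y < of_int k")
    case True
    hence "\<lfloor>y\<rfloor> = k - 1" using y c by (intro floor_unique) auto
    thus ?thesis using y True c by (auto simp: reflect_ext_def intro!: supp)
  next
    case False
    hence "\<lfloor>y\<rfloor> = k" using y c by (intro floor_unique) auto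
    thus ?thesis using y False c by (auto simp: reflect_ext_def intro!: supp)
  qed
  have "((\<lambda>y. 0) has_real_derivative 0) (at x)" by simp
  hence "(reflect_ext \<sigma> f has_real_derivative 0) (at x)"
    by (rule has_field_derivative_transform_within_open[where S = "{of_int k - c<..<of_int k + c}"])
       (use k c z in auto)
  moreover have "reflect_ext (- \<sigma>) f' x = 0" unfolding k reflect_ext_def using supp(2)[of 0] supp(2)[of 1] ab by auto
  ultimately show ?thesis by simp
qed

lemma reflect_ext_bound:
  assumes "\<And>x. \<bar>f x\<bar> \<le> C" "\<bar>\<sigma>\<bar> = 1"
  shows "\<bar>reflect_ext \<sigma> f x\<bar> \<le> C"
  using assms by (auto simp: reflect_ext_def abs_mult)

lemma reflect_ext_odd:
  assumes "f 0 = 0" "f 1 = 0"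
  shows "reflect_ext (-1) f (of_int n - y) = - reflect_ext (-1) f (of_int n + y)"
proof (cases "y \<in> \<int>")
  case True
  then obtain m where "y = of_int m" by (auto elim: Ints_cases)
  hence e: "of_int n - y = of_int (n - m)" "of_int n + y = of_int (n + m)" by auto
  show ?thesis unfolding e using assms by (simp add: reflect_ext_def del: of_int_add of_int_diff)
next
  case False
  define k where "k = \<lfloor>y\<rfloor>"
  have k: "of_int k < y" "y < of_int k + 1" using False unfolding k_def
    by (metis Ints_of_int floor_correct order_le_less, linarith)
  have fl: "\<lfloor>of_int n - y\<rfloor> = n - k - 1" "\<lfloor>of_int n + y\<rfloor> = n + k" using k by (intro floor_unique; simp)+
  have ev: "even (n - k - 1) \<longleftrightarrow> odd (n + k)" by presburger
  have e: "of_int n - y - of_int (n - k - 1) = of_int (n + k) + 1 - (of_int n + y)"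
    "of_int (n - k - 1) + 1 - (of_int n - y) = of_int n + y - of_int (n + k)" by simp_all
  show ?thesis unfolding reflect_ext_def fl ev e by simp
qed

lemma reflect_ext_unit: "x \<in> {0..<1} \<Longrightarrow> reflect_ext \<sigma> f x = f x"
proof -
  assume "x \<in> {0..<1}"
  hence "\<lfloor>x\<rfloor> = 0" by (intro floor_unique) auto
  thus ?thesis by (simp add: reflect_ext_def)
qed

lemma smooth_compact_I_deriv:
  assumes "smooth_compact_I f"
  obtains a b C where "0 < a" "b < 1" "\<And>k x. x \<notin> {a..b} \<Longrightarrow> (deriv ^^ k) f x = 0"
    "\<And>k x. ((deriv ^^ k) f has_real_derivative (deriv ^^ Suc k) f x) (at x)"
    "\<And>k x. \<bar>(deriv ^^ k) f x\<bar> \<le> C k"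
proof -
  obtain a b where ab: "0 < a" "a \<le> b" "b < 1" "\<And>x. x \<notin> {a..b} \<Longrightarrow> f x = 0"
    using assms unfolding smooth_compact_I_def by auto
  have d: "((deriv ^^ k) f has_real_derivative (deriv ^^ Suc k) f x) (at x)" for k x
    using assms unfolding smooth_compact_I_def by (simp add: DERIV_deriv_iff_real_differentiable)
  have z: "(deriv ^^ k) f x = 0" if "x \<notin> {a..b}" for k x
    using that
  proof (induction k arbitrary: x)
    case 0 thus ?case using ab by auto
  next
    case (Suc k)
    have "((\<lambda>y. 0) has_real_derivative 0) (at x)" by simp
    hence "((deriv ^^ k) f has_real_derivative 0) (at x)"
      by (rule has_field_derivative_transform_within_open[where S = "- {a..b}"]) (use Suc in auto)
    thus ?case using DERIV_unique[OF d] by blast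
  qed
  have "\<exists>C. \<forall>x. \<bar>(deriv ^^ k) f x\<bar> \<le> C" for k
  proof -
    have "compact ((deriv ^^ k) f ` {a..b})"
      by (intro compact_continuous_image continuous_on_if_DERIV[OF d]) auto
    from compact_imp_bounded[OF this] obtain C where "\<forall>y \<in> (deriv ^^ k) f ` {a..b}. norm y \<le> C"
      unfolding bounded_iff by blast
    hence C: "\<And>x. x \<in> {a..b} \<Longrightarrow> \<bar>(deriv ^^ k) f x\<bar> \<le> C" by simp
    hence "C \<ge> 0" using ab(2) by (meson abs_ge_zero atLeastAtMost_iff order_refl order_trans)
    hence "\<bar>(deriv ^^ k) f x\<bar> \<le> C" for x using C z[of x k] by (cases "x \<in> {a..b}") auto
    thus ?thesis by blast
  qed
  then obtain C where C: "\<And>k x. \<bar>(deriv ^^ k) f x\<bar> \<le> C k" by metis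
  show ?thesis
    by (rule that[of a b C, OF ab(1) ab(3)]; (rule d | rule C | rule z)?; assumption?)
qed

text \<open>\<open>r k\<close> is the heat flow of the k-th derivative of the reflected datum, hence
  the k-th space derivative of the solution, and the heat equation makes \<open>r (k + 2)\<close>
  the time derivative of \<open>r k\<close>. Even orders come from odd reflections and therefore
  vanish at every integer.\<close>

lemma smooth_heat_extension:
  assumes "smooth_compact_I f"
  obtains r :: "nat \<Rightarrow> real \<Rightarrow> real \<Rightarrow> real" and C :: "nat \<Rightarrow> real" where
    "\<And>k x t. ((\<lambda>x. r k x t) has_real_derivative r (Suc k) x t) (at x)"
    "\<And>k x t. t > 0 \<Longrightarrow> (r k x has_real_derivative r (k + 2) x t) (at t)"
    "\<And>k x t. \<bar>r k x t\<bar> \<le> C k"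
    "\<And>k. continuous_on UNIV (\<lambda>p. r k (fst p) (snd p))"
    "\<And>k x. x \<in> {0..<1} \<Longrightarrow> r k x 0 = (deriv ^^ k) f x"
    "\<And>k t n. even k \<Longrightarrow> r k (of_int n) t = 0"
proof -
  obtain a b C where ab: "0 < a" "b < 1" and z: "\<And>k x. x \<notin> {a..b} \<Longrightarrow> (deriv ^^ k) f x = 0"
    and d: "\<And>k x. ((deriv ^^ k) f has_real_derivative (deriv ^^ Suc k) f x) (at x)"
    and C: "\<And>k x. \<bar>(deriv ^^ k) f x\<bar> \<le> C k"
    using smooth_compact_I_deriv[OF assms] by metis
  \<comment> \<open>Each derivative flips the sign of the reflection, starting from the odd one at k
    = 0.\<close>
  define g where "g k = reflect_ext ((-1) ^ Suc k) ((deriv ^^ k) f)" for k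
  have gd: "(g k has_real_derivative g (Suc k) x) (at x)" for k x
    using reflect_ext_DERIV[OF d ab z z, of "(-1) ^ Suc k" k x] by (simp add: g_def)
  have gC: "\<bar>g k x\<bar> \<le> C k" for k x unfolding g_def by (rule reflect_ext_bound[OF C]) simp
  define r where "r k x t = heat_ext (g k) x t" for k x t
  have 1: "((\<lambda>x. r k x t) has_real_derivative r (Suc k) x t) (at x)" for k x t
    unfolding r_def heat_ext_def by (rule gauss_DERIV_x[OF gd gd gC gC gC])
  have 2: "(r k x has_real_derivative r (k + 2) x t) (at t)" if "t > 0" for k x t
    using heat_ext_DERIV_t[OF gd gd continuous_on_if_DERIV[OF gd] gC gC gC that, of k x]
    by (simp add: r_def[abs_def])
  have 3: "\<bar>r k x t\<bar> \<le> C k" for k x t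
    unfolding r_def heat_ext_def by (rule gauss_bound[OF continuous_on_if_DERIV[OF gd] gC])
  have 4: "continuous_on UNIV (\<lambda>p. r k (fst p) (snd p))" for k
    unfolding r_def by (rule continuous_heat_ext[OF gd gC gC])
  have 5: "r k x 0 = (deriv ^^ k) f x" if "x \<in> {0..<1}" for k x
    using reflect_ext_unit[OF that] by (simp add: r_def heat_ext_def gauss_0 g_def)
  have 6: "r k (of_int n) t = 0" if "even k" for k t n
    unfolding r_def heat_ext_def
  proof (rule gauss_odd)
    show "g k (of_int n - y) = - g k (of_int n + y)" for y
      using reflect_ext_odd[of "(deriv ^^ k) f" n y] z[of 0 k] z[of 1 k] ab that by (simp add: g_def)
  qed
  show ?thesis using that[OF 1 2 3 4 5 6] .
qed

text \<open>After subtracting \<eta> t, a positive value yields a maximum inside the interval, where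
  backward differences in time force d_t \<ge> \<eta> > 0. By the equation d_xx > 0 there while d_x
  = 0, so \<open>d\<close> increases to the right, against maximality. The maximum may lie on the
  final time line, since only earlier times are compared.\<close>

lemma heat_maximum_principle:
  fixes d :: "real \<times> real \<Rightarrow> real"
  assumes c: "continuous_on ({0..1} \<times> {0..}) d"
    and dx: "\<And>x t. 0 < x \<Longrightarrow> x < 1 \<Longrightarrow> 0 < t \<Longrightarrow> ((\<lambda>y. d (y, t)) has_real_derivative d1 x t) (at x)"
    and dxx: "\<And>x t. 0 < x \<Longrightarrow> x < 1 \<Longrightarrow> 0 < t \<Longrightarrow> ((\<lambda>y. d1 y t) has_real_derivative d2 x t) (at x)"
    and dt: "\<And>x t. 0 < x \<Longrightarrow> x < 1 \<Longrightarrow> 0 < t \<Longrightarrow> ((\<lambda>s. d (x, s)) has_real_derivative d2 x t) (at t)"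
    and bd: "\<And>x. x \<in> {0..1} \<Longrightarrow> d (x, 0) \<le> 0" "\<And>t. t \<ge> 0 \<Longrightarrow> d (0, t) \<le> 0" "\<And>t. t \<ge> 0 \<Longrightarrow> d (1, t) \<le> 0"
    and x: "x \<in> {0..1}" and t: "t \<ge> 0"
  shows "d (x, t) \<le> 0"
proof (rule ccontr)
  assume "\<not> d (x, t) \<le> 0"
  hence pos: "d (x, t) > 0" by simp
  hence t0: "t > 0" using t bd(1)[OF x] by (cases "t = 0") auto
  \<comment> \<open>Half of d (x, t) / t, so that the penalised function is still positive at (x,
    t).\<close>
  define \<eta> where "\<eta> = d (x, t) / (2 * t)"
  have \<eta>: "\<eta> > 0" using pos t0 by (simp add: \<eta>_def)
  define m where "m p = d p - \<eta> * snd p" for p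
  have "continuous_on ({0..1} \<times> {0..t}) m" unfolding m_def
    by (intro continuous_intros continuous_on_subset[OF c]) auto
  moreover have "compact ({0..1::real} \<times> {0..t})" by (intro compact_Times) auto
  moreover have xt: "(x, t) \<in> {0..1} \<times> {0..t}" using x t by auto
  ultimately obtain p where p: "p \<in> {0..1} \<times> {0..t}" "\<And>q. q \<in> {0..1} \<times> {0..t} \<Longrightarrow> m q \<le> m p"
    using continuous_attains_sup[of "{0..1} \<times> {0..t}" m] by blast
  obtain x1 t1 where p_eq: "p = (x1, t1)" by (cases p)
  have "m (x, t) = d (x, t) / 2" using t0 by (simp add: m_def \<eta>_def)
  hence mp: "m p > 0" using p(2)[OF xt] pos by simp
  hence dp: "d (x1, t1) > 0" using p(1) \<eta> unfolding p_eq m_def by (auto simp: intro: less_le_trans) (smt (verit) mult_nonneg_nonneg)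
  have t1: "t1 > 0" "t1 \<le> t" using p(1) dp bd(1)[of x1] unfolding p_eq by (cases "t1 = 0", auto)
  have x1: "0 < x1" "x1 < 1"
    using p(1) dp bd(2)[of t1] bd(3)[of t1] unfolding p_eq by (cases "x1 = 0"; cases "x1 = 1"; auto)+
  have "d2 x1 t1 - \<eta> \<ge> 0"
  proof (rule ccontr)
    assume "\<not> ?thesis"
    moreover have "((\<lambda>s. m (x1, s)) has_real_derivative d2 x1 t1 - \<eta>) (at t1)"
      unfolding m_def snd_conv by (auto intro!: derivative_eq_intros dt x1 t1)
    ultimately obtain e where e: "e > 0" "\<And>h. 0 < h \<Longrightarrow> h < e \<Longrightarrow> m (x1, t1) < m (x1, t1 - h)"
      using DERIV_neg_dec_left[of "\<lambda>s. m (x1, s)" "d2 x1 t1 - \<eta>" t1] by auto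
    define h where "h = min (e / 2) t1"
    have h: "0 < h" "h < e" "h \<le> t1" using e t1 by (auto simp: h_def)
    have "m (x1, t1 - h) \<le> m p" using h t1 x1 by (intro p(2)) auto
    thus False using e(2)[OF h(1,2)] by (simp add: p_eq)
  qed
  hence d2: "d2 x1 t1 > 0" using \<eta> by simp
  have max: "d (y, t1) \<le> d (x1, t1)" if "y \<in> {0..1}" for y
    using p(2)[of "(y, t1)"] that t1 by (simp add: p_eq m_def)
  have "d1 x1 t1 = 0"
  proof (rule DERIV_local_max[OF dx[OF x1 t1(1)]])
    show "0 < min x1 (1 - x1)" using x1 by simp
    show "\<forall>y. \<bar>x1 - y\<bar> < min x1 (1 - x1) \<longrightarrow> d (y, t1) \<le> d (x1, t1)"
      by (intro allI impI max) auto
  qed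
  obtain e where e: "e > 0" "\<And>h. 0 < h \<Longrightarrow> h < e \<Longrightarrow> d1 x1 t1 < d1 (x1 + h) t1"
    using DERIV_pos_inc_right[OF dxx[OF x1 t1(1)] d2] by auto
  define h where "h = min (e / 2) ((1 - x1) / 2)"
  have h: "0 < h" "h < e" "x1 + h < 1" using e x1 by (auto simp: h_def field_simps min_def)
  obtain z where z: "x1 < z" "z < x1 + h" "d (x1 + h, t1) - d (x1, t1) = (x1 + h - x1) * d1 z t1"
    using MVT2[of x1 "x1 + h" "\<lambda>y. d (y, t1)" "\<lambda>y. d1 y t1"] h x1 t1 dx by auto
  have "d1 z t1 > 0" using e(2)[of "z - x1"] z h \<open>d1 x1 t1 = 0\<close> by simp
  hence "d (x1 + h, t1) > d (x1, t1)" using z(3) h(1) by (smt (verit) mult_pos_pos)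
  thus False using max[of "x1 + h"] h x1 by auto
qed

text \<open>The maximum principle, applied to the difference and to its negative, identifies the
  given \<rho> with the Gaussian representation. This is where control of derivatives up to the
  parabolic boundary comes from: \<open>heat_solution\<close> speaks of them in the open strip
  only.\<close>

lemma heat_solution_unique:
  assumes sol: "heat_solution f \<rho>"
    and rx: "\<And>k x t. ((\<lambda>x. r k x t) has_real_derivative r (Suc k) x t) (at x)"
    and rt: "\<And>k x t. t > 0 \<Longrightarrow> (r k x has_real_derivative r (k + 2) x t) (at t)"
    and rc: "\<And>k. continuous_on UNIV (\<lambda>p. r k (fst p) (snd p))"
    and r0: "\<And>x. x \<in> {0..1} \<Longrightarrow> r 0 x 0 = f x" and rb: "\<And>t. r 0 0 t = 0" "\<And>t. r 0 1 t = 0"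
    and xt: "x \<in> {0..1}" "t \<ge> 0"
  shows "\<rho> (x, t) = r (0::nat) x t"
proof -
  have c: "continuous_on ({0..1} \<times> {0..}) \<rho>" 
    and ini: "\<And>x. x \<in> {0..1} \<Longrightarrow> \<rho> (x, 0) = f x" and bd: "\<And>t. t \<ge> 0 \<Longrightarrow> \<rho> (0, t) = 0 \<and> \<rho> (1, t) = 0"
    using sol unfolding heat_solution_def by blast+
  have dd: "((\<lambda>y. \<rho> (y, t)) has_real_derivative px \<rho> (x, t)) (at x)"
    "((\<lambda>y. px \<rho> (y, t)) has_real_derivative px (px \<rho>) (x, t)) (at x)"
    "((\<lambda>s. \<rho> (x, s)) has_real_derivative px (px \<rho>) (x, t)) (at t)" if "0 < x" "x < 1" "0 < t" for x t
  proof -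
    have "(x, t) \<in> {0<..<1} \<times> {0<..}" using that by auto
    hence *: "(\<lambda>y. \<rho> (y, t)) differentiable (at x)" "(\<lambda>s. \<rho> (x, s)) differentiable (at t)"
      "(\<lambda>y. px \<rho> (y, t)) differentiable (at x)" "pt \<rho> (x, t) = px (px \<rho>) (x, t)"
      using sol unfolding heat_solution_def by fastforce+
    show "((\<lambda>y. \<rho> (y, t)) has_real_derivative px \<rho> (x, t)) (at x)"
      using *(1) by (simp add: px_def[of \<rho> "(x, t)"] DERIV_deriv_iff_real_differentiable)
    show "((\<lambda>y. px \<rho> (y, t)) has_real_derivative px (px \<rho>) (x, t)) (at x)"
      using *(3) by (simp add: px_def[of "px \<rho>"] DERIV_deriv_iff_real_differentiable)
    show "((\<lambda>s. \<rho> (x, s)) has_real_derivative px (px \<rho>) (x, t)) (at t)"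
      using *(2) unfolding *(4)[symmetric] by (simp add: pt_def DERIV_deriv_iff_real_differentiable)
  qed
  have rc': "continuous_on S (\<lambda>p. r 0 (fst p) (snd p))" for S using continuous_on_subset[OF rc] by blast
  have rt': "((\<lambda>s. r 0 x s) has_real_derivative r (Suc (Suc 0)) x t) (at t)" if "t > 0" for x t
    using rt[OF that, of 0 x] by (simp add: numeral_2_eq_2)
  have "\<rho> (x, t) - r 0 x t \<le> 0"
    using heat_maximum_principle[where d = "\<lambda>p. \<rho> p - r 0 (fst p) (snd p)" and ?d1.0 = "\<lambda>x t. px \<rho> (x, t) - r (Suc 0) x t"
        and ?d2.0 = "\<lambda>x t. px (px \<rho>) (x, t) - r (Suc (Suc 0)) x t", OF _ _ _ _ _ _ _ xt]
    by (simp add: continuous_on_diff[OF c rc'] DERIV_diff dd rx rt' ini r0 bd rb)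
  moreover have "- (\<rho> (x, t) - r 0 x t) \<le> 0"
    using heat_maximum_principle[where d = "\<lambda>p. - (\<rho> p - r 0 (fst p) (snd p))" and ?d1.0 = "\<lambda>x t. - (px \<rho> (x, t) - r (Suc 0) x t)"
        and ?d2.0 = "\<lambda>x t. - (px (px \<rho>) (x, t) - r (Suc (Suc 0)) x t)", OF _ _ _ _ _ _ _ xt]
    by (simp add: continuous_on_diff[OF c rc'] continuous_on_minus DERIV_diff DERIV_minus dd rx rt' ini r0 bd rb del: minus_diff_eq)
  ultimately show ?thesis by simp
qed

lemma heat_solution_partials:
  assumes eq: "\<And>x t. x \<in> {0..1} \<Longrightarrow> t \<ge> 0 \<Longrightarrow> \<rho> (x, t) = r (0::nat) x t"
    and rx: "\<And>k x t. ((\<lambda>x. r k x t) has_real_derivative r (Suc k) x t) (at x)"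
    and rt: "\<And>k x t. t > 0 \<Longrightarrow> (r k x has_real_derivative r (k + 2) x t) (at t)"
    and xt: "0 < x" "x < 1" "0 < t"
  shows "px \<rho> (x, t) = r 1 x t" "pt \<rho> (x, t) = r 2 x t"
proof -
  have "((\<lambda>y. \<rho> (y, t)) has_real_derivative r (Suc 0) x t) (at x)"
    by (rule has_field_derivative_transform_within_open[OF rx, of "{0<..<1}"]) (use xt eq in auto)
  thus "px \<rho> (x, t) = r 1 x t" unfolding px_def by (simp add: DERIV_imp_deriv)
  have "((\<lambda>s. \<rho> (x, s)) has_real_derivative r (0 + 2) x t) (at t)"
    by (rule has_field_derivative_transform_within_open[OF rt[OF xt(3)], of "{0<..}"]) (use xt eq in auto)
  thus "pt \<rho> (x, t) = r 2 x t" unfolding pt_def by (simp add: DERIV_imp_deriv numeral_2_eq_2)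
qed

section \<open>A monotone upwind scheme\<close>

text \<open>Flooring the slope at \<epsilon>/2 gives the bound 2/\<epsilon> and the Lipschitz
  constant 4/\<epsilon>^2, from which the constants of the scheme derive.\<close>

definition trunc_inv :: "real \<Rightarrow> real \<Rightarrow> real" where
  "trunc_inv \<epsilon> p = 1 / max p (\<epsilon> / 2)"

lemma trunc_inv_bounds:
  assumes "\<epsilon> > 0"
  shows "0 < trunc_inv \<epsilon> p" "trunc_inv \<epsilon> p \<le> 2 / \<epsilon>"
proof -
  have "max p (\<epsilon> / 2) \<ge> \<epsilon> / 2" "max p (\<epsilon> / 2) > 0" using assms by auto
  thus "0 < trunc_inv \<epsilon> p" "trunc_inv \<epsilon> p \<le> 2 / \<epsilon>"
    unfolding trunc_inv_def using assms by (auto simp: divide_simps mult.commute)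
qed

lemma trunc_inv_antimono: "\<epsilon> > 0 \<Longrightarrow> p \<le> q \<Longrightarrow> trunc_inv \<epsilon> q \<le> trunc_inv \<epsilon> p"
  unfolding trunc_inv_def by (intro divide_left_mono) auto

lemma trunc_inv_eq: "\<epsilon> > 0 \<Longrightarrow> p \<ge> \<epsilon> \<Longrightarrow> trunc_inv \<epsilon> p = 1 / p"
  by (simp add: trunc_inv_def max_def)

lemma trunc_inv_lipschitz:
  assumes "\<epsilon> > 0"
  shows "\<bar>trunc_inv \<epsilon> p - trunc_inv \<epsilon> q\<bar> \<le> 4 / \<epsilon>\<^sup>2 * \<bar>p - q\<bar>"
proof -
  define P Q where "P = max p (\<epsilon> / 2)" and "Q = max q (\<epsilon> / 2)"
  have P: "P \<ge> \<epsilon> / 2" "Q \<ge> \<epsilon> / 2" "P > 0" "Q > 0" using assms by (auto simp: P_def Q_def)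
  have "\<bar>P - Q\<bar> \<le> \<bar>p - q\<bar>" unfolding P_def Q_def by (auto simp: max_def)
  have "trunc_inv \<epsilon> p - trunc_inv \<epsilon> q = (Q - P) / (P * Q)"
    using P unfolding trunc_inv_def P_def[symmetric] Q_def[symmetric] by (simp add: field_simps)
  hence "\<bar>trunc_inv \<epsilon> p - trunc_inv \<epsilon> q\<bar> = \<bar>P - Q\<bar> / (P * Q)" using P by (simp add: abs_minus_commute)
  also have "\<dots> \<le> \<bar>p - q\<bar> / (\<epsilon> / 2 * (\<epsilon> / 2))"
    using P assms \<open>\<bar>P - Q\<bar> \<le> \<bar>p - q\<bar>\<close> by (intro frac_le mult_mono) auto
  also have "\<dots> = 4 / \<epsilon>\<^sup>2 * \<bar>p - q\<bar>" by (simp add: power2_eq_square mult.commute)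
  finally show ?thesis .
qed

lemma continuous_trunc_inv: "\<epsilon> > 0 \<Longrightarrow> isCont (trunc_inv \<epsilon>) p"
proof -
  assume e: "\<epsilon> > 0"
  have "continuous_on UNIV (trunc_inv \<epsilon>)"
    by (rule lipschitz_on_continuous_on[of "4 / \<epsilon>\<^sup>2"], rule lipschitz_onI)
       (use trunc_inv_lipschitz[OF e] in \<open>auto simp: dist_real_def\<close>)
  thus ?thesis by (simp add: continuous_on_eq_continuous_at)
qed

text \<open>\<open>A\<close> and \<open>B\<close> stand for the backward and the forward difference
  quotient. As \<open>trunc_inv\<close> is antitone, its product with \<open>c\<close> falls with
  the slope for c \<ge> 0 and rises for c < 0; using the backward quotient in the first case and the
  forward one in the second makes the update nondecreasing in the neighbouring values.\<close>

definition upwind :: "real \<Rightarrow> real \<Rightarrow> real \<Rightarrow> real \<Rightarrow> real" where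
  "upwind \<epsilon> c A B = c * trunc_inv \<epsilon> (if 0 \<le> c then A else B)"

lemma upwind_bound:
  assumes "\<epsilon> > 0"
  shows "\<bar>upwind \<epsilon> c A B\<bar> \<le> 2 / \<epsilon> * \<bar>c\<bar>"
proof -
  have "\<bar>upwind \<epsilon> c A B\<bar> = \<bar>c\<bar> * trunc_inv \<epsilon> (if 0 \<le> c then A else B)"
    by (simp add: upwind_def abs_mult abs_of_pos[OF trunc_inv_bounds(1)[OF assms]])
  also have "\<dots> \<le> \<bar>c\<bar> * (2 / \<epsilon>)" by (intro mult_left_mono trunc_inv_bounds assms) auto
  finally show ?thesis by (simp add: mult.commute)
qed

text \<open>Coefficients of opposite sign use different quotients, so nothing cancels; but then |c|
  + |d| = |c - d| and the crude bounds suffice.\<close>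

lemma upwind_diff:
  assumes "\<epsilon> > 0"
  shows "\<bar>upwind \<epsilon> c A B - upwind \<epsilon> d A B\<bar> \<le> 2 / \<epsilon> * \<bar>c - d\<bar>"
proof -
  have *: "\<bar>c * trunc_inv \<epsilon> X - d * trunc_inv \<epsilon> X\<bar> \<le> 2 / \<epsilon> * \<bar>c - d\<bar>" for X
  proof -
    have "\<bar>c * trunc_inv \<epsilon> X - d * trunc_inv \<epsilon> X\<bar> = \<bar>c - d\<bar> * trunc_inv \<epsilon> X"
      using trunc_inv_bounds(1)[OF assms, of X] by (simp add: left_diff_distrib[symmetric] abs_mult)
    also have "\<dots> \<le> \<bar>c - d\<bar> * (2 / \<epsilon>)" by (intro mult_left_mono trunc_inv_bounds assms) auto
    finally show ?thesis by (simp add: mult.commute)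
  qed
  have opp: "\<bar>upwind \<epsilon> c A B - upwind \<epsilon> d A B\<bar> \<le> 2 / \<epsilon> * \<bar>c - d\<bar>" if "c \<ge> 0 \<and> d < 0 \<or> c < 0 \<and> d \<ge> 0"
  proof -
    have "\<bar>upwind \<epsilon> c A B - upwind \<epsilon> d A B\<bar> \<le> 2 / \<epsilon> * \<bar>c\<bar> + 2 / \<epsilon> * \<bar>d\<bar>"
      using upwind_bound[OF assms, of c A B] upwind_bound[OF assms, of d A B] by linarith
    also have "\<dots> = 2 / \<epsilon> * \<bar>c - d\<bar>" using that by (auto simp: distrib_left[symmetric] diff_divide_distrib add_divide_distrib)
    finally show ?thesis .
  qed
  show ?thesis
  proof (cases "c \<ge> 0 \<longleftrightarrow> d \<ge> 0")
    case True
    thus ?thesis using *[of A] *[of B] by (auto simp: upwind_def)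
  next
    case False thus ?thesis by (intro opp) auto
  qed
qed

definition upwind_op :: "real \<Rightarrow> (real \<Rightarrow> real \<Rightarrow> real) \<Rightarrow> real \<Rightarrow> real \<Rightarrow> (real \<Rightarrow> real) \<Rightarrow> real \<Rightarrow> real" where
  "upwind_op \<epsilon> f h t u x = upwind \<epsilon> (f x t) ((u x - u (x - h)) / h) ((u (x + h) - u x) / h)"

text \<open>\<open>f\<close> is the right-hand side and \<open>v\<close> the lower bound of the
  slope to be propagated, later G(\<rho>_x). \<open>v_sub\<close> is v_t \<le> (f / v)_x integrated
  over an interval and a time step, with a second-order error; \<open>u0_growth\<close> starts the
  propagation.\<close>

locale upwind_data =
  fixes f v :: "real \<Rightarrow> real \<Rightarrow> real" and \<epsilon> Fm Lf :: real and u0 :: "real \<Rightarrow> real" and L0 M Lv Cs :: real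
  assumes data_pos: "\<epsilon> > 0" "Fm \<ge> 0" "Lf \<ge> 0" "Lv \<ge> 0" "Cs \<ge> 0"
    and f_bound: "\<And>x t. \<bar>f x t\<bar> \<le> Fm"
    and f_lip: "\<And>x y t. t \<ge> 0 \<Longrightarrow> \<bar>f x t - f y t\<bar> \<le> Lf * \<bar>x - y\<bar>"
    and u0_lip: "\<And>x y. \<bar>u0 x - u0 y\<bar> \<le> L0 * \<bar>x - y\<bar>"
    and v_bounds: "\<And>x t. t \<ge> 0 \<Longrightarrow> \<epsilon> \<le> v x t" "\<And>x t. t \<ge> 0 \<Longrightarrow> v x t \<le> M"
    and v_lip: "\<And>x y t. t \<ge> 0 \<Longrightarrow> \<bar>v x t - v y t\<bar> \<le> Lv * \<bar>x - y\<bar>"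
    and v_sub: "\<And>x y s t. x \<le> y \<Longrightarrow> 0 \<le> s \<Longrightarrow> 0 \<le> t \<Longrightarrow>
       integral {x..y} (\<lambda>z. v z (t + s)) - integral {x..y} (\<lambda>z. v z t) \<le> s * (f y t / v y t - f x t / v x t) + Cs * s\<^sup>2"
    and u0_growth: "\<And>x y. x \<le> y \<Longrightarrow> u0 y - u0 x \<ge> integral {x..y} (\<lambda>z. v z 0)"

text \<open>\<open>CFL\<close> is the condition for monotonicity in the central value, given the
  Lipschitz constant 4/\<epsilon>^2 of \<open>trunc_inv\<close> and quotients with denominator
  \<open>h\<close>. \<open>dt_le\<close> lets second-order time errors count as O(h) per unit
  time.\<close>

locale upwind_scheme = upwind_data +
  fixes h dt :: real
  assumes grid_pos: "h > 0" "dt > 0" and dt_le: "dt \<le> h" and CFL: "4 * Fm * dt \<le> \<epsilon>\<^sup>2 * h"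
begin

lemmas pos = data_pos(1) grid_pos data_pos(2,3)
lemmas pos' = data_pos(4,5)

definition step :: "real \<Rightarrow> real \<Rightarrow> (real \<Rightarrow> real) \<Rightarrow> real \<Rightarrow> real" where
  "step s t u x = u x + s * upwind_op \<epsilon> f h t u x"

text \<open>Raising a neighbour raises the update by the choice of side. Raising the central value
  by \<delta> changes the quotient by \<delta>/h and costs at most s |f| (4/\<epsilon>^2)
  \<delta>/h, which \<open>CFL\<close> bounds by \<delta>.\<close>

lemma step_mono:
  assumes s: "0 \<le> s" "s \<le> dt" and le: "u (x - h) \<le> u' (x - h)" "u x \<le> u' x" "u (x + h) \<le> u' (x + h)"
  shows "step s t u x \<le> step s t u' x"
proof -
  let ?g = "trunc_inv \<epsilon>"
  have sF: "0 \<le> s * \<bar>f x t\<bar>" "s * \<bar>f x t\<bar> \<le> dt * Fm" using s f_bound pos by (auto intro: mult_mono)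
  have key: "s * \<bar>f x t\<bar> * (?g p - ?g q) \<le> u' x - u x" if pq: "q \<le> p + (u' x - u x) / h" for p q
  proof -
    have "?g p - ?g q \<le> ?g p - ?g (p + (u' x - u x) / h)" using trunc_inv_antimono[OF pos(1) pq] by simp
    also have "\<dots> \<le> 4 / \<epsilon>\<^sup>2 * ((u' x - u x) / h)"
      using trunc_inv_lipschitz[OF pos(1), of p "p + (u' x - u x) / h"] le(2) pos by (simp add: abs_mult)
    finally have "s * \<bar>f x t\<bar> * (?g p - ?g q) \<le> s * \<bar>f x t\<bar> * (4 / \<epsilon>\<^sup>2 * ((u' x - u x) / h))"
      by (rule mult_left_mono) (rule sF)
    also have "\<dots> \<le> dt * Fm * (4 / \<epsilon>\<^sup>2 * ((u' x - u x) / h))"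
      using sF le(2) pos by (intro mult_right_mono) auto
    also have "\<dots> = (4 * Fm * dt) / (\<epsilon>\<^sup>2 * h) * (u' x - u x)" by simp
    also have "\<dots> \<le> 1 * (u' x - u x)" using CFL pos le(2) by (intro mult_right_mono) (auto simp: divide_simps)
    finally show ?thesis by simp
  qed
  show ?thesis
  proof (cases "f x t \<ge> 0")
    case True
    have "(u' x - u' (x - h)) / h \<le> (u x - u (x - h)) / h + (u' x - u x) / h"
      using le pos by (simp add: add_divide_distrib[symmetric] divide_right_mono)
    from key[OF this] show ?thesis using True by (simp add: step_def upwind_op_def upwind_def algebra_simps)
  next
    case False
    have "(u (x + h) - u x) / h \<le> (u' (x + h) - u' x) / h + (u' x - u x) / h"
      using le pos by (simp add: add_divide_distrib[symmetric] divide_right_mono)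
    from key[OF this] show ?thesis using False by (simp add: step_def upwind_op_def upwind_def algebra_simps)
  qed
qed

section \<open>Uniform Lipschitz bounds in space and time\<close>

definition speed :: real where "speed = 2 * Fm / \<epsilon>"

definition slope_rate :: real where "slope_rate = 2 / \<epsilon> * Lf"

lemma slope_rate_nonneg: "slope_rate \<ge> 0"
  using pos by (simp add: slope_rate_def)

lemma step_add_const: "step s t (\<lambda>y. u y + c) x = step s t u x + c"
  by (simp add: step_def upwind_op_def)

lemma step_0: "step 0 t u = u"
  by (rule ext) (simp add: step_def)

lemma step_diff: "\<bar>step a t u x - step b t u x\<bar> \<le> speed * \<bar>a - b\<bar>"
proof -
  have "step a t u x - step b t u x = (a - b) * upwind_op \<epsilon> f h t u x"
    by (simp add: step_def algebra_simps)
  hence "\<bar>step a t u x - step b t u x\<bar> = \<bar>a - b\<bar> * \<bar>upwind_op \<epsilon> f h t u x\<bar>" by (simp add: abs_mult)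
  also have "\<dots> \<le> \<bar>a - b\<bar> * (2 / \<epsilon> * \<bar>f x t\<bar>)" unfolding upwind_op_def by (intro mult_left_mono upwind_bound pos) auto
  also have "\<dots> \<le> \<bar>a - b\<bar> * (2 / \<epsilon> * Fm)" using pos f_bound by (intro mult_left_mono) auto
  finally show ?thesis by (simp add: mult_ac speed_def)
qed

text \<open>The translate of \<open>u\<close> by y - x lies below u + l |x - y|. The step is
  monotone and commutes with adding constants, so only the x-dependence of \<open>f\<close> can
  enlarge the Lipschitz constant.\<close>

lemma step_lipschitz:
  assumes s: "0 \<le> s" "s \<le> dt" and t: "t \<ge> 0" and u: "\<And>x y. \<bar>u x - u y\<bar> \<le> l * \<bar>x - y\<bar>"
  shows "\<bar>step s t u x - step s t u y\<bar> \<le> (l + s * slope_rate) * \<bar>x - y\<bar>"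
proof -
  have *: "step s t u y - step s t u x \<le> (l + s * slope_rate) * \<bar>x - y\<bar>" for x y
  proof -
    define u' where "u' z = u (z + (y - x))" for z
    have "step s t u y - step s t u' x =
       s * (upwind \<epsilon> (f y t) ((u' x - u' (x - h)) / h) ((u' (x + h) - u' x) / h) - upwind \<epsilon> (f x t) ((u' x - u' (x - h)) / h) ((u' (x + h) - u' x) / h))"
      by (simp add: step_def upwind_op_def u'_def algebra_simps)
    also have "\<dots> \<le> s * (2 / \<epsilon> * \<bar>f y t - f x t\<bar>)"
      using s by (intro mult_left_mono order_trans[OF abs_ge_self upwind_diff] pos) auto
    also have "\<dots> \<le> s * (2 / \<epsilon> * (Lf * \<bar>x - y\<bar>))"
      using s pos f_lip[OF t, of y x] by (intro mult_left_mono) (auto simp: abs_minus_commute)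
    finally have 1: "step s t u y - step s t u' x \<le> s * (2 / \<epsilon> * (Lf * \<bar>x - y\<bar>))" .
    have "u' z \<le> u z + l * \<bar>x - y\<bar>" for z
      using u[of "z + (y - x)" z] by (auto simp: u'_def abs_minus_commute)
    hence "step s t u' x \<le> step s t (\<lambda>z. u z + l * \<bar>x - y\<bar>) x" by (intro step_mono s)
    hence "step s t u' x \<le> step s t u x + l * \<bar>x - y\<bar>" unfolding step_add_const .
    moreover have "s * (2 / \<epsilon> * (Lf * \<bar>x - y\<bar>)) = s * slope_rate * \<bar>x - y\<bar>" by (simp add: slope_rate_def)
    ultimately show ?thesis using 1 unfolding distrib_right by linarith
  qed
  show ?thesis using *[of x y] *[of y x] by (simp add: abs_le_iff abs_minus_commute)
qed

primrec grid_sol :: "nat \<Rightarrow> real \<Rightarrow> real" where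
  "grid_sol 0 = u0"
| "grid_sol (Suc n) = step dt (real n * dt) (grid_sol n)"

text \<open>Between grid times a partial step is taken. It is affine in its length, so this is
  linear interpolation in time, and it stays monotone because its length is at most
  \<open>dt\<close>.\<close>

definition sol :: "real \<Rightarrow> real \<Rightarrow> real" where
  "sol x t = step (t - real (nat \<lfloor>t / dt\<rfloor>) * dt) (real (nat \<lfloor>t / dt\<rfloor>) * dt) (grid_sol (nat \<lfloor>t / dt\<rfloor>)) x"

lemma sol_half_open:
  assumes "real n * dt \<le> t" "t < real (Suc n) * dt"
  shows "sol x t = step (t - real n * dt) (real n * dt) (grid_sol n) x"
proof -
  have "\<lfloor>t / dt\<rfloor> = int n" using assms pos by (intro floor_unique) (auto simp: field_simps)
  thus ?thesis by (simp add: sol_def)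
qed

lemma sol_grid: "sol x (real n * dt) = grid_sol n x"
  using sol_half_open[of n "real n * dt" x] pos by (simp add: step_0 algebra_simps)

lemma sol_between:
  assumes "real n * dt \<le> t" "t \<le> real (Suc n) * dt"
  shows "sol x t = step (t - real n * dt) (real n * dt) (grid_sol n) x"
proof (cases "t = real (Suc n) * dt")
  case True
  have "t - real n * dt = dt" unfolding True by (simp add: algebra_simps)
  thus ?thesis using sol_grid[of x "Suc n"] unfolding True by simp
qed (use assms sol_half_open in auto)

lemma grid_index:
  assumes "t \<ge> 0"
  obtains n where "real n * dt \<le> t" "t \<le> real (Suc n) * dt"
proof -
  define n where "n = nat \<lfloor>t / dt\<rfloor>"
  have "0 \<le> t / dt" using assms pos by simp
  hence "real n \<le> t / dt" "t / dt \<le> real (Suc n)" unfolding n_def by linarith+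
  thus ?thesis using pos by (intro that[of n]) (auto simp: field_simps)
qed

lemma sol_0: "sol x 0 = u0 x"
  using sol_grid[of x 0] by simp

text \<open>The ceiling selects a grid time strictly before t, also when t is itself a grid time;
  the limit argument divides by t - t'.\<close>

lemma sol_step:
  assumes "t > 0"
  shows "\<exists>t'. 0 \<le> t' \<and> t' < t \<and> t - t' \<le> dt \<and> (\<forall>x. sol x t = step (t - t') t' (\<lambda>y. sol y t') x)"
proof -
  define n where "n = nat (\<lceil>t / dt\<rceil> - 1)"
  have "t / dt > 0" using assms pos by simp
  hence n: "real n < t / dt" "t / dt \<le> real n + 1" unfolding n_def by linarith+
  hence n': "real n * dt < t" "t \<le> real (Suc n) * dt" using pos by (auto simp: field_simps)
  show ?thesis
  proof (intro exI[of _ "real n * dt"] conjI allI)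
    show "t - real n * dt \<le> dt" using n' by (simp add: algebra_simps)
    show "sol x t = step (t - real n * dt) (real n * dt) (\<lambda>y. sol y (real n * dt)) x" for x
      unfolding sol_grid by (rule sol_between) (use n' in auto)
  qed (use n' pos in auto)
qed

lemma grid_sol_lipschitz: "\<bar>grid_sol n x - grid_sol n y\<bar> \<le> (L0 + real n * dt * slope_rate) * \<bar>x - y\<bar>"
proof (induction n arbitrary: x y)
  case 0 thus ?case using u0_lip by simp
next
  case (Suc n)
  have "\<bar>grid_sol (Suc n) x - grid_sol (Suc n) y\<bar> \<le> (L0 + real n * dt * slope_rate + dt * slope_rate) * \<bar>x - y\<bar>"
    unfolding grid_sol.simps using pos by (intro step_lipschitz Suc) auto
  thus ?case by (simp add: algebra_simps)
qed

lemma sol_lipschitz_x: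
  assumes "t \<ge> 0"
  shows "\<bar>sol x t - sol y t\<bar> \<le> (L0 + t * slope_rate) * \<bar>x - y\<bar>"
proof -
  obtain n where n: "real n * dt \<le> t" "t \<le> real (Suc n) * dt" using grid_index[OF assms] .
  have "\<bar>step (t - real n * dt) (real n * dt) (grid_sol n) x - step (t - real n * dt) (real n * dt) (grid_sol n) y\<bar>
     \<le> (L0 + real n * dt * slope_rate + (t - real n * dt) * slope_rate) * \<bar>x - y\<bar>"
    by (rule step_lipschitz) (use n pos grid_sol_lipschitz in \<open>auto simp: algebra_simps\<close>)
  thus ?thesis unfolding sol_between[OF n] by (simp add: algebra_simps)
qed

lemma grid_sol_lipschitz_t: "\<bar>grid_sol (n + k) x - grid_sol n x\<bar> \<le> speed * (real k * dt)"
proof (induction k)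
  case (Suc k)
  have "\<bar>grid_sol (n + Suc k) x - grid_sol (n + k) x\<bar> \<le> speed * dt"
    using step_diff[of dt "real (n + k) * dt" "grid_sol (n + k)" x 0] pos by (simp add: step_0)
  thus ?case using Suc by (simp add: algebra_simps)
qed simp

lemma sol_lipschitz_t:
  assumes "0 \<le> s" "s \<le> t"
  shows "\<bar>sol x t - sol x s\<bar> \<le> speed * (t - s)"
proof -
  obtain m where m: "real m * dt \<le> s" "s \<le> real (Suc m) * dt" using grid_index[OF assms(1)] .
  obtain n where n: "real n * dt \<le> t" "t \<le> real (Suc n) * dt" using grid_index[of t] assms by auto
  show ?thesis
  proof (cases "real (Suc m) * dt \<le> t")
    case False
    hence "real m * dt \<le> t" "t \<le> real (Suc m) * dt" using m assms by auto
    note eq = sol_between[OF this] sol_between[OF m]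
    show ?thesis unfolding eq
      using step_diff[of "t - real m * dt" "real m * dt" "grid_sol m" x "s - real m * dt"] assms by simp
  next
    case True
    hence "real (Suc m) * dt \<le> real (Suc n) * dt" using n by linarith
    hence "Suc m \<le> Suc n" using pos by (simp only: mult_le_cancel_right_pos of_nat_le_iff)
    have 1: "\<bar>sol x s - grid_sol (Suc m) x\<bar> \<le> speed * (real (Suc m) * dt - s)"
      using step_diff[of "s - real m * dt" "real m * dt" "grid_sol m" x dt] m unfolding sol_between[OF m]
      by (simp add: algebra_simps abs_if split: if_splits)
    show ?thesis
    proof (cases "Suc m \<le> n")
      case le: True
      have 2: "\<bar>grid_sol n x - grid_sol (Suc m) x\<bar> \<le> speed * (real n * dt - real (Suc m) * dt)"
        using grid_sol_lipschitz_t[of "Suc m" "n - Suc m" x] le by (simp add: of_nat_diff algebra_simps)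
      have 3: "\<bar>sol x t - grid_sol n x\<bar> \<le> speed * (t - real n * dt)"
        unfolding sol_between[OF n] using step_diff[of "t - real n * dt" _ _ x 0] n(1) by (simp add: step_0)
      have "speed * (real (Suc m) * dt - s) + speed * (real n * dt - real (Suc m) * dt) + speed * (t - real n * dt) = speed * (t - s)"
        by (simp only: distrib_left[symmetric]) simp
      thus ?thesis using 1 2 3 by linarith
    next
      case False
      hence "n = m" using \<open>Suc m \<le> Suc n\<close> by simp
      hence "t = real (Suc m) * dt" using True n by simp
      thus ?thesis using 1 sol_grid[of x "Suc m"] by (simp add: abs_minus_commute)
    qed
  qed
qed

text \<open>A vanishing coefficient makes the update zero whatever the slopes are. This holds the
  Dirichlet values at x = 0 and x = 1.\<close>

lemma sol_fixed:
  assumes "\<And>t. f x t = 0"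
  shows "sol x t = u0 x"
proof -
  have s: "step s t u x = u x" for s t u using assms by (simp add: step_def upwind_op_def upwind_def)
  have "grid_sol n x = u0 x" for n by (induction n) (simp_all add: s)
  thus ?thesis by (simp add: sol_def s)
qed

section \<open>Lower bound for the increments of the discrete solution\<close>

abbreviation V :: "real \<Rightarrow> real \<Rightarrow> real \<Rightarrow> real" where
  "V x y t \<equiv> integral {x..y} (\<lambda>z. v z t)"

lemma v_continuous: "t \<ge> 0 \<Longrightarrow> continuous_on S (\<lambda>z. v z t)"
  by (rule lipschitz_on_continuous_on[of Lv], rule lipschitz_onI) (use v_lip pos' in \<open>auto simp: dist_real_def\<close>)

lemma v_integrable: "t \<ge> 0 \<Longrightarrow> (\<lambda>z. v z t) integrable_on {x..y}"
  by (intro integrable_continuous_real v_continuous)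

lemma V_split: "t \<ge> 0 \<Longrightarrow> x \<le> y \<Longrightarrow> y \<le> z \<Longrightarrow> V x z t = V x y t + V y z t"
  using Henstock_Kurzweil_Integration.integral_combine[of x y z "\<lambda>z. v z t"] v_integrable by auto

lemma V_bounds:
  assumes "t \<ge> 0" "x \<le> y"
    and "\<And>z. z \<in> {x..y} \<Longrightarrow> a \<le> v z t" "\<And>z. z \<in> {x..y} \<Longrightarrow> v z t \<le> b"
  shows "a * (y - x) \<le> V x y t" "V x y t \<le> b * (y - x)"
proof -
  have "integral {x..y} (\<lambda>z. a) \<le> V x y t" "V x y t \<le> integral {x..y} (\<lambda>z. b)"
    by (intro integral_le integrable_const_ivl v_integrable assms; assumption)+
  thus "a * (y - x) \<le> V x y t" "V x y t \<le> b * (y - x)" using assms(2) by (simp_all add: mult.commute)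
qed

definition consistency :: real where "consistency = Fm * (4 / \<epsilon>\<^sup>2) * Lv"

lemma consistency_nonneg: "consistency \<ge> 0"
  using pos pos' by (simp add: consistency_def)

text \<open>The difference quotients of the primitive of \<open>v\<close> are means over a cell next
  to x, hence within Lv h of \<open>v x t\<close>; and v \<ge> \<epsilon> makes
  \<open>trunc_inv\<close> the plain reciprocal at \<open>v x t\<close>.\<close>

lemma step_V:
  assumes t: "t \<ge> 0" and s: "s \<ge> 0" and x: "x0 \<le> x - h"
  shows "\<bar>step s t (\<lambda>z. V x0 z t) x - (V x0 x t + s * (f x t / v x t))\<bar> \<le> s * (consistency * h)"
proof -
  define q where "q = (if 0 \<le> f x t then (V x0 x t - V x0 (x - h) t) / h else (V x0 (x + h) t - V x0 x t) / h)"
  have diff: "\<bar>V a b t / h - v x t\<bar> \<le> Lv * h" if ab: "b = a + h" "x \<in> {a, b}" for a b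
  proof -
    have near: "v x t - Lv * h \<le> v z t" "v z t \<le> v x t + Lv * h" if "z \<in> {a..b}" for z
    proof -
      have "Lv * \<bar>z - x\<bar> \<le> Lv * h" using that ab pos' by (intro mult_left_mono) auto
      thus "v x t - Lv * h \<le> v z t" "v z t \<le> v x t + Lv * h" using v_lip[OF t, of z x] by (auto simp: abs_le_iff)
    qed
    have "(v x t - Lv * h) * (b - a) \<le> V a b t" "V a b t \<le> (v x t + Lv * h) * (b - a)"
      by (rule V_bounds(1)[OF t _ near] V_bounds(2)[OF t _ near], use ab pos in simp, assumption, assumption)+
    hence "v x t - Lv * h \<le> V a b t / h" "V a b t / h \<le> v x t + Lv * h"
      using ab(1) pos by (simp_all add: le_divide_eq divide_le_eq)
    thus ?thesis by (simp add: abs_le_iff)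
  qed
  have "\<bar>q - v x t\<bar> \<le> Lv * h"
  proof (cases "0 \<le> f x t")
    case True
    have "V x0 x t - V x0 (x - h) t = V (x - h) x t" using V_split[OF t x, of x] pos by simp
    thus ?thesis using diff[of x "x - h"] True by (simp add: q_def)
  next
    case False
    have "V x0 (x + h) t - V x0 x t = V x (x + h) t" using V_split[OF t, of x0 x "x + h"] x pos by simp
    thus ?thesis using diff[of "x + h" x] False by (simp add: q_def)
  qed
  moreover have "trunc_inv \<epsilon> (v x t) = 1 / v x t" using trunc_inv_eq[OF pos(1)] v_bounds(1)[OF t] by simp
  ultimately have *: "\<bar>trunc_inv \<epsilon> q - 1 / v x t\<bar> \<le> 4 / \<epsilon>\<^sup>2 * (Lv * h)"
    using trunc_inv_lipschitz[OF pos(1), of q "v x t"] mult_left_mono[of "\<bar>q - v x t\<bar>" "Lv * h" "4 / \<epsilon>\<^sup>2"] by simp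
  have "step s t (\<lambda>z. V x0 z t) x - (V x0 x t + s * (f x t / v x t)) = s * (f x t * (trunc_inv \<epsilon> q - 1 / v x t))"
    by (simp add: step_def upwind_op_def upwind_def q_def algebra_simps)
  also have "\<bar>\<dots>\<bar> = s * (\<bar>f x t\<bar> * \<bar>trunc_inv \<epsilon> q - 1 / v x t\<bar>)" using s by (simp add: abs_mult)
  also have "\<dots> \<le> s * (Fm * (4 / \<epsilon>\<^sup>2 * (Lv * h)))"
    using s f_bound * pos by (intro mult_left_mono mult_mono) auto
  also have "\<dots> = s * (consistency * h)" by (simp add: consistency_def)
  finally show ?thesis .
qed

text \<open>Error per unit time: \<open>Cs\<close> from \<open>v_sub\<close>, and one
  \<open>consistency\<close> for each endpoint of an interval.\<close>

definition err :: real where "err = (Cs + 2 * consistency) * h"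

text \<open>If y - x > 2 h, the stencil of x lies to the left of the stencil of y. Up to constants
  differing by \<open>m\<close>, the primitive of \<open>v\<close> bounds \<open>u\<close> from
  above on the first and from below on the second; monotonicity carries both bounds over the step,
  where \<open>step_V\<close> and \<open>v_sub\<close> evaluate them. Short intervals escape this
  argument, and the negative \<open>m\<close> pays for them.\<close>

lemma step_growth:
  assumes t: "t \<ge> 0" and s: "0 \<le> s" "s \<le> dt"
    and u: "\<And>x y. x \<le> y \<Longrightarrow> u y - u x \<ge> V x y t + m"
    and L: "\<And>x y. \<bar>step s t u x - step s t u y\<bar> \<le> L * \<bar>x - y\<bar>" "L \<ge> 0" and m: "m \<le> - 2 * (M + L) * h"
    and xy: "x \<le> y"
  shows "step s t u y - step s t u x \<ge> V x y (t + s) + m - s * err"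
proof (cases "y - x \<le> 2 * h")
  case True
  have M: "M \<ge> 0" using v_bounds[of 0 0] pos by simp
  have "V x y (t + s) \<le> M * (y - x)" 
    by (rule V_bounds(2)[where a = \<epsilon>]) (use t s xy v_bounds[of "t + s"] in auto)
  also have "\<dots> \<le> M * (2 * h)" using True M by (intro mult_left_mono) auto
  finally have 1: "V x y (t + s) \<le> M * (2 * h)" .
  have "step s t u x - step s t u y \<le> L * \<bar>x - y\<bar>" using L(1)[of x y] by simp
  also have "\<dots> \<le> L * (2 * h)" using True L xy by (intro mult_left_mono) auto
  finally have 2: "step s t u x - step s t u y \<le> L * (2 * h)" .
  have "s * err \<ge> 0" unfolding err_def using s pos pos' consistency_nonneg by (intro mult_nonneg_nonneg add_nonneg_nonneg) auto
  thus ?thesis using 1 2 m by (simp add: algebra_simps)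
next
  case False
  define x0 where "x0 = x - h"
  define W where "W z = V x0 z t" for z
  \<comment> \<open>The least constant with u \<le> W + b on the stencil of x. It is attained at
    some z to the left of the stencil of y, so the growth of \<open>u\<close> from z gives the lower
    bound there.\<close>
  define b where "b = Max ((\<lambda>z. u z - W z) ` {x - h, x, x + h})"
  have bu: "u z \<le> W z + b" if "z \<in> {x - h, x, x + h}" for z
  proof -
    have "u z - W z \<le> b" unfolding b_def by (rule Max_ge) (use that in auto)
    thus ?thesis by simp
  qed
  have "b \<in> (\<lambda>z. u z - W z) ` {x - h, x, x + h}" unfolding b_def by (rule Max_in) auto
  then obtain z where z: "z \<in> {x - h, x, x + h}" "b = u z - W z" by blast
  have al: "W w + (b + m) \<le> u w" if w: "w \<in> {y - h, y, y + h}" for w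
  proof -
    have zw: "x0 \<le> z" "z \<le> w" using z(1) w False pos by (auto simp: x0_def)
    have "W w = W z + V z w t" unfolding W_def by (rule V_split[OF t zw])
    thus ?thesis using u[OF zw(2)] z(2) by simp
  qed
  have "step s t (\<lambda>z. W z + (b + m)) y \<le> step s t u y"
    by (intro step_mono s al) auto
  moreover have "step s t u x \<le> step s t (\<lambda>z. W z + b) x"
    by (intro step_mono s bu) auto
  ultimately have 1: "step s t u y - step s t u x \<ge> step s t W y - step s t W x + m"
    unfolding step_add_const by simp
  have 2: "step s t W y \<ge> W y + s * (f y t / v y t) - s * (consistency * h)"
    using step_V[OF t s(1), of x0 y] False pos unfolding W_def[abs_def] by (auto simp: x0_def abs_le_iff)
  have 3: "step s t W x \<le> W x + s * (f x t / v x t) + s * (consistency * h)"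
    using step_V[OF t s(1), of x0 x] pos unfolding W_def[abs_def] by (auto simp: x0_def abs_le_iff)
  have 4: "W y - W x = V x y t" unfolding W_def using V_split[OF t, of x0 x y] xy pos by (simp add: x0_def)
  have 5: "V x y (t + s) - V x y t \<le> s * (f y t / v y t - f x t / v x t) + Cs * s\<^sup>2" by (rule v_sub[OF xy s(1) t])
  have "Cs * s\<^sup>2 \<le> Cs * (s * h)"
    unfolding power2_eq_square using s dt_le pos' by (intro mult_left_mono) auto
  hence "V x y (t + s) \<le> V x y t + s * (f y t / v y t) - s * (f x t / v x t) + Cs * (s * h)"
    using 5 by (simp add: right_diff_distrib)
  moreover have "s * err = Cs * (s * h) + 2 * (s * (consistency * h))"
    unfolding err_def by (simp add: algebra_simps)
  ultimately show ?thesis using 1 2 3 4 by linarith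
qed

text \<open>The defect 2 (M + L) h is granted from time 0 on, so that short intervals pass at every
  step; a step of length s adds s err. \<open>L\<close> bounds the space Lipschitz constant up to
  time T.\<close>

lemma sol_growth:
  assumes t: "0 \<le> t" "t \<le> T" and xy: "x \<le> y"
  defines "L \<equiv> L0 + T * slope_rate"
  shows "sol y t - sol x t \<ge> V x y t - 2 * (M + L) * h - t * err"
proof -
  have L0: "L0 \<ge> 0" using u0_lip[of 0 1] by simp
  have Lip: "\<bar>a\<bar> \<le> L * \<bar>x - y\<bar>" if "\<bar>a\<bar> \<le> (L0 + r * slope_rate) * \<bar>x - y\<bar>" "r \<le> T" for a r x y
  proof -
    have "(L0 + r * slope_rate) * \<bar>x - y\<bar> \<le> L * \<bar>x - y\<bar>"
      unfolding L_def using that slope_rate_nonneg by (intro mult_right_mono add_left_mono) auto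
    thus ?thesis using that by linarith
  qed
  have Lp: "L \<ge> 0" unfolding L_def using L0 t slope_rate_nonneg by (intro add_nonneg_nonneg mult_nonneg_nonneg) auto
  have M: "M \<ge> 0" using v_bounds[of 0 0] pos by simp
  have err: "err \<ge> 0" unfolding err_def using pos pos' consistency_nonneg by (intro mult_nonneg_nonneg add_nonneg_nonneg) auto
  have gs: "step r (real n * dt) (grid_sol n) y - step r (real n * dt) (grid_sol n) x
      \<ge> V x y (real n * dt + r) + (- 2 * (M + L) * h - real n * dt * err) - r * err"
    if IH: "\<And>x y. x \<le> y \<Longrightarrow> grid_sol n y - grid_sol n x \<ge> V x y (real n * dt) + (- 2 * (M + L) * h - real n * dt * err)"
      and r: "0 \<le> r" "r \<le> dt" "real n * dt + r \<le> T" and "x \<le> y" for n r x y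
  proof (rule step_growth[OF _ r(1,2) IH _ Lp _ \<open>x \<le> y\<close>])
    fix x y
    have n0: "0 \<le> real n * dt" using pos by simp
    have "\<bar>step r (real n * dt) (grid_sol n) x - step r (real n * dt) (grid_sol n) y\<bar>
       \<le> (L0 + (real n * dt + r) * slope_rate) * \<bar>x - y\<bar>"
      using step_lipschitz[OF r(1,2) n0 grid_sol_lipschitz, of n x y] by (simp add: algebra_simps)
    from Lip[OF this r(3)] show "\<bar>step r (real n * dt) (grid_sol n) x - step r (real n * dt) (grid_sol n) y\<bar> \<le> L * \<bar>x - y\<bar>" .
  qed (use pos err in auto)
  have grid: "grid_sol n y - grid_sol n x \<ge> V x y (real n * dt) + (- 2 * (M + L) * h - real n * dt * err)"
    if "real n * dt \<le> T" "x \<le> y" for n x y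
    using that
  proof (induction n arbitrary: x y)
    case 0
    have "- 2 * (M + L) * h \<le> 0" using M Lp pos by (intro mult_nonpos_nonneg) auto
    thus ?case using u0_growth[OF 0(2)]
      by (simp only: grid_sol.simps of_nat_0 mult_zero_left diff_zero)
  next
    case (Suc n)
    have "real n * dt \<le> T" "real n * dt + dt \<le> T" using Suc(2) pos by (auto simp: algebra_simps)
    from gs[OF Suc(1)[OF this(1)] _ _ this(2) Suc(3)] show ?case using pos by (simp add: algebra_simps)
  qed
  obtain n where n: "real n * dt \<le> t" "t \<le> real (Suc n) * dt" using grid_index[OF t(1)] .
  have "V x y (real n * dt + (t - real n * dt)) + (- 2 * (M + L) * h - real n * dt * err) - (t - real n * dt) * err
     \<le> step (t - real n * dt) (real n * dt) (grid_sol n) y - step (t - real n * dt) (real n * dt) (grid_sol n) x"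
    by (rule gs[OF grid _ _ _ xy]) (use n t pos in \<open>auto simp: algebra_simps\<close>)
  thus ?thesis unfolding sol_between[OF n] by (simp add: algebra_simps)
qed

end

section \<open>Comparison of viscosity solutions\<close>

lemma visc_subD:
  assumes "visc_sub F U u" "\<And>q. q \<in> U \<Longrightarrow> (\<phi> has_derivative (\<lambda>h. D q \<bullet> h)) (at q)" "continuous_on U D"
    "z \<in> U" "e > 0" "\<And>q. q \<in> ball z e \<Longrightarrow> q \<in> U \<Longrightarrow> u q - \<phi> q \<le> u z - \<phi> z"
  shows "F z (D z) \<le> 0"
proof -
  have "\<exists>e>0. \<forall>q \<in> ball z e \<inter> U. u q - \<phi> q \<le> u z - \<phi> z" using assms(5,6) by auto
  moreover have "\<forall>q\<in>U. (\<phi> has_derivative (\<lambda>h. D q \<bullet> h)) (at q)" using assms(2) by simp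
  ultimately have "(\<forall>q \<in> U. (\<phi> has_derivative (\<lambda>h. D q \<bullet> h)) (at q)) \<and> continuous_on U D \<and> z \<in> U \<and>
      (\<exists>e>0. \<forall>q \<in> ball z e \<inter> U. u q - \<phi> q \<le> u z - \<phi> z)" using assms(3,4) by blast
  thus ?thesis
    by (rule assms(1)[unfolded visc_sub_def, THEN spec[of _ \<phi>], THEN spec[of _ D], THEN spec[of _ z], THEN mp])
qed

lemma visc_superD:
  assumes "visc_super F U u" "\<And>q. q \<in> U \<Longrightarrow> (\<phi> has_derivative (\<lambda>h. D q \<bullet> h)) (at q)" "continuous_on U D"
    "z \<in> U" "e > 0" "\<And>q. q \<in> ball z e \<Longrightarrow> q \<in> U \<Longrightarrow> u q - \<phi> q \<ge> u z - \<phi> z"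
  shows "F z (D z) \<ge> 0"
proof -
  have "\<exists>e>0. \<forall>q \<in> ball z e \<inter> U. u q - \<phi> q \<ge> u z - \<phi> z" using assms(5,6) by auto
  moreover have "\<forall>q\<in>U. (\<phi> has_derivative (\<lambda>h. D q \<bullet> h)) (at q)" using assms(2) by simp
  ultimately have "(\<forall>q \<in> U. (\<phi> has_derivative (\<lambda>h. D q \<bullet> h)) (at q)) \<and> continuous_on U D \<and> z \<in> U \<and>
      (\<exists>e>0. \<forall>q \<in> ball z e \<inter> U. u q - \<phi> q \<ge> u z - \<phi> z)" using assms(3,4) by blast
  thus ?thesis
    by (rule assms(1)[unfolded visc_super_def, THEN spec[of _ \<phi>], THEN spec[of _ D], THEN spec[of _ z], THEN mp])
qed

text \<open>Stated for increments at every time, because the doubling argument evaluates it at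
  maximum points, which cannot be kept outside a null set.\<close>

definition slope_ge :: "real \<Rightarrow> real \<Rightarrow> (real \<times> real \<Rightarrow> real) \<Rightarrow> bool" where
  "slope_ge m T u \<longleftrightarrow> (\<forall>x y t. 0 \<le> x \<longrightarrow> x \<le> y \<longrightarrow> y \<le> 1 \<longrightarrow> 0 \<le> t \<longrightarrow> t \<le> T \<longrightarrow> m * (y - x) \<le> u (y, t) - u (x, t))"

text \<open>Dividing by s and letting s tend to 0 leaves n d, the derivative of the quadratic
  penalty.\<close>

lemma quadratic_increment_slope:
  fixes n d \<epsilon> r :: real
  assumes "n > 0" "r > 0" "\<And>s. 0 < s \<Longrightarrow> s \<le> r \<Longrightarrow> \<epsilon> * s \<le> n / 2 * ((d + s)\<^sup>2 - d\<^sup>2)"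
  shows "\<epsilon> \<le> n * d"
proof (rule field_le_epsilon)
  fix e :: real assume e: "e > 0"
  define s where "s = min r (e / n)"
  have s: "0 < s" "s \<le> r" "s \<le> e / n" using assms e by (auto simp: s_def)
  have "\<epsilon> * s \<le> n / 2 * ((d + s)\<^sup>2 - d\<^sup>2)" by (rule assms(3)[OF s(1,2)])
  also have "\<dots> = (n * d + n * s / 2) * s" by (simp add: power2_eq_square algebra_simps)
  finally have "\<epsilon> \<le> n * d + n * s / 2" using s(1) by (rule mult_right_le_imp_le)
  moreover have "n * s \<le> e" using s(3) assms(1) by (simp add: field_simps)
  ultimately show "\<epsilon> \<le> n * d + e" using e by linarith
qed

lemma norm_diff_Pair_square: "(norm (p - q :: real \<times> real))\<^sup>2 = (fst p - fst q)\<^sup>2 + (snd p - snd q)\<^sup>2"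
  by (simp add: norm_prod_def)

lemma quadratic_has_derivative:
  "((\<lambda>q. n / 2 * (norm (q - w :: real \<times> real))\<^sup>2) has_derivative (\<lambda>h. (n *\<^sub>R (q - w)) \<bullet> h)) (at q)"
  unfolding power2_norm_eq_inner
  by (auto intro!: derivative_eq_intros simp: inner_commute algebra_simps)

lemma penalty_has_derivative:
  assumes "snd q < (T::real)"
  shows "((\<lambda>q::real \<times> real. \<eta> / (T - snd q)) has_derivative (\<lambda>h. (0, \<eta> / (T - snd q)\<^sup>2) \<bullet> h)) (at q)"
  using assms by (auto intro!: derivative_eq_intros simp: inner_prod_def power2_eq_square)

context
  fixes a b f :: "real \<times> real \<Rightarrow> real" and T \<epsilon> :: real and F :: "real \<times> real \<Rightarrow> real \<times> real \<Rightarrow> real"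
  assumes T: "T > 0" and \<epsilon>: "\<epsilon> > 0"
    and ca: "continuous_on ({0..1} \<times> {0..T}) a" and cb: "continuous_on ({0..1} \<times> {0..T}) b"
    and cf: "continuous_on ({0..1} \<times> {0..T}) f"
    and F: "\<And>z q. z \<in> {0<..<1} \<times> {0<..<T} \<Longrightarrow> F z q = fst q * snd q - f z"
    and sub: "visc_sub F ({0<..<1} \<times> {0<..<T}) a" and super: "visc_super F ({0<..<1} \<times> {0<..<T}) b"
    and bd: "\<And>z. z \<in> {0..1} \<times> {0..T} \<Longrightarrow> fst z = 0 \<or> fst z = 1 \<or> snd z = 0 \<Longrightarrow> a z \<le> b z"
    and slope: "slope_ge \<epsilon> T a \<or> slope_ge \<epsilon> T b"
begin

text \<open>Doubling of variables. The penalisation gives both functions the same first slope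
  \<open>p = n (x - y)\<close>, so a lower bound on the slope of only one of them makes \<open>p\<close> positive.\<close>

lemma viscosity_comparison_open:
  assumes z0: "z0 \<in> {0..1} \<times> {0..T}" "snd z0 < T"
  shows "a z0 \<le> b z0"
proof (rule ccontr)
  define Q U where "Q = {0..1::real} \<times> {0..T}" and "U = {0<..<1::real} \<times> {0<..<T}"
  have cQ: "compact Q" unfolding Q_def by (intro compact_Times) auto
  assume "\<not> a z0 \<le> b z0"
  define m where "m = (a z0 - b z0) / 2"
  have m: "m > 0" using \<open>\<not> a z0 \<le> b z0\<close> by (simp add: m_def)
  \<comment> \<open>Makes the time penalty at z0 equal to \<open>m\<close>, half of the assumed gap
    2 m.\<close>
  define c where "c = m * (T - snd z0)"
  have c: "c > 0" using m z0 by (simp add: c_def)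
  obtain Ma where Ma: "\<And>z. z \<in> Q \<Longrightarrow> \<bar>a z\<bar> \<le> Ma"
    using compact_imp_bounded[OF compact_continuous_image[OF ca[folded Q_def] cQ]] unfolding bounded_iff by (auto simp: Q_def)
  obtain Mb where Mb: "\<And>z. z \<in> Q \<Longrightarrow> \<bar>b z\<bar> \<le> Mb"
    using compact_imp_bounded[OF compact_continuous_image[OF cb[folded Q_def] cQ]] unfolding bounded_iff by (auto simp: Q_def)
  define M where "M = Ma + Mb"
  have M: "a z - b w \<le> M" if "z \<in> Q" "w \<in> Q" for z w using Ma[OF that(1)] Mb[OF that(2)] by (simp add: M_def)
  have M0: "M \<ge> 0" using Ma[of z0] Mb[of z0] z0 by (simp add: M_def Q_def)
  \<comment> \<open>At time T - r the penalty c / r is at least M + 1, above the bound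
    \<open>M\<close> of a - b; so the maximum does not sit on the top of \<open>Q1\<close>.\<close>
  define r where "r = min (T - snd z0) (c / (M + 1))"
  define T1 where "T1 = T - r"
  have r: "r > 0" "r \<le> T - snd z0" "r \<le> c / (M + 1)" using z0 c M0 by (auto simp: r_def)
  have T1: "snd z0 \<le> T1" "T1 < T" "T - T1 = r" using r by (auto simp: T1_def)
  obtain da where da: "da > 0" "\<And>z w. z \<in> Q \<Longrightarrow> w \<in> Q \<Longrightarrow> dist w z < da \<Longrightarrow> dist (a w) (a z) < m"
    using compact_uniformly_continuous[OF ca[folded Q_def] cQ] m unfolding uniformly_continuous_on_def by metis
  obtain db where db: "db > 0" "\<And>z w. z \<in> Q \<Longrightarrow> w \<in> Q \<Longrightarrow> dist w z < db \<Longrightarrow> dist (b w) (b z) < m"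
    using compact_uniformly_continuous[OF cb[folded Q_def] cQ] m unfolding uniformly_continuous_on_def by metis
  have "\<epsilon> * c / T\<^sup>2 > 0" using \<epsilon> c T by simp
  then obtain df where df: "df > 0" "\<And>z w. z \<in> Q \<Longrightarrow> w \<in> Q \<Longrightarrow> dist w z < df \<Longrightarrow> dist (f w) (f z) < \<epsilon> * c / T\<^sup>2"
    using compact_uniformly_continuous[OF cf[folded Q_def] cQ] unfolding uniformly_continuous_on_def by metis
  \<comment> \<open>\<open>da\<close> and \<open>db\<close> keep the maximum off the parabolic
    boundary, \<open>df\<close> limits the oscillation of \<open>f\<close>, and \<open>r\<close>
    keeps the second point below time T.\<close>
  define d where "d = Min {da, db, df, r}"
  have d: "d > 0" "d \<le> da" "d \<le> db" "d \<le> df" "d \<le> r" using da db df r by (auto simp: d_def)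
  \<comment> \<open>Large enough that a quadratic penalty of at most \<open>M\<close> forces |z - w|
    < d.\<close>
  define n where "n = 2 * (M + 1) / d\<^sup>2"
  have n: "n > 0" using M0 d by (simp add: n_def)
  define \<Phi> where "\<Phi> p = a (fst p) - b (snd p) - n / 2 * (norm (fst p - snd p))\<^sup>2 - c / (T - snd (fst p))" for p
  define Q1 where "Q1 = {0..1::real} \<times> {0..T1}"
  have Q1Q: "Q1 \<subseteq> Q" using T1 by (auto simp: Q1_def Q_def)
  have z01: "z0 \<in> Q1" "z0 \<in> Q" using z0 T1 by (auto simp: Q1_def Q_def)
  have "continuous_on (Q1 \<times> Q) \<Phi>"
    unfolding \<Phi>_def
  proof (intro continuous_intros)
    show "continuous_on (Q1 \<times> Q) (\<lambda>x. a (fst x))"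
      by (rule continuous_on_compose2[OF ca[folded Q_def]]) (use Q1Q in \<open>auto intro!: continuous_intros\<close>)
    show "continuous_on (Q1 \<times> Q) (\<lambda>x. b (snd x))"
      by (rule continuous_on_compose2[OF cb[folded Q_def]]) (auto intro!: continuous_intros)
  qed (use T1 in \<open>auto simp: Q1_def\<close>)
  moreover have "compact (Q1 \<times> Q)" unfolding Q1_def Q_def by (intro compact_Times) auto
  moreover have "(z0, z0) \<in> Q1 \<times> Q" using z01 by simp
  ultimately obtain p where p: "p \<in> Q1 \<times> Q" "\<And>q. q \<in> Q1 \<times> Q \<Longrightarrow> \<Phi> q \<le> \<Phi> p"
    using continuous_attains_sup[of "Q1 \<times> Q" \<Phi>] by blast
  obtain z w where p_eq: "p = (z, w)" by (cases p)
  have z: "z \<in> Q1" "z \<in> Q" and w: "w \<in> Q" using p(1) Q1Q p_eq by auto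
  have Tz: "T - snd z > 0" "T - snd z \<le> T" using z T1 by (auto simp: Q1_def)
  have "\<Phi> (z0, z0) = m" using z0 by (simp add: \<Phi>_def m_def c_def field_simps)
  hence max: "m \<le> a z - b w - n / 2 * (norm (z - w))\<^sup>2 - c / (T - snd z)"
    using p(2)[OF \<open>(z0, z0) \<in> _\<close>] by (simp add: p_eq \<Phi>_def)
  have pen: "n / 2 * (norm (z - w))\<^sup>2 \<ge> 0" "c / (T - snd z) \<ge> 0" using n c Tz by auto
  have abm: "m \<le> a z - b w" using max pen by linarith
  have "n / 2 * (norm (z - w))\<^sup>2 \<le> M" using max pen M[OF z(2) w] m by linarith
  hence "(M + 1) * (norm (z - w))\<^sup>2 \<le> M * d\<^sup>2" using d by (simp add: n_def field_simps)
  also have "\<dots> < (M + 1) * d\<^sup>2" using d by simp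
  finally have "(norm (z - w))\<^sup>2 < d\<^sup>2" using M0 by simp
  hence zw: "dist z w < d" using d by (simp add: power_less_imp_less_base dist_norm)
  have "c / (T - snd z) \<le> M" using max pen M[OF z(2) w] m by linarith
  have "snd z \<noteq> T1"
  proof
    assume "snd z = T1"
    hence "c / r \<le> M" using \<open>c / (T - snd z) \<le> M\<close> T1 by simp
    moreover have "M + 1 \<le> c / r" using r(1,3) M0 by (simp add: field_simps)
    ultimately show False by simp
  qed
  hence z1: "snd z < T1" using z by (auto simp: Q1_def)
  have "snd w < T"
  proof -
    have "snd w - snd z \<le> dist z w" using dist_snd_le[of z w] by (simp add: dist_real_def)
    thus ?thesis using zw d z1 T1 by simp
  qed
  have nz: "\<not> (fst z = 0 \<or> fst z = 1 \<or> snd z = 0)"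
  proof
    assume "fst z = 0 \<or> fst z = 1 \<or> snd z = 0"
    hence "a z \<le> b z" using bd z(2) by (simp add: Q_def)
    moreover have "dist (b z) (b w) < m" using db(2)[OF w z(2)] zw d by simp
    ultimately show False using abm by (simp add: dist_real_def)
  qed
  have nw: "\<not> (fst w = 0 \<or> fst w = 1 \<or> snd w = 0)"
  proof
    assume "fst w = 0 \<or> fst w = 1 \<or> snd w = 0"
    hence "a w \<le> b w" using bd w by (simp add: Q_def)
    moreover have "dist (a z) (a w) < m" using da(2)[OF w z(2)] zw d by simp
    ultimately show False using abm by (simp add: dist_real_def)
  qed
  have zU: "z \<in> U" using z nz z1 T1 by (cases z) (auto simp: U_def Q_def)
  have wU: "w \<in> U" using w nw \<open>snd w < T\<close> by (cases w) (auto simp: U_def Q_def)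
  define P R where "P = n * (fst z - fst w)" and "R = n * (snd z - snd w)"
  have "F z (n *\<^sub>R (z - w) + (0, c / (T - snd z)\<^sup>2)) \<le> 0"
  proof (rule visc_subD[OF sub[folded U_def], where \<phi> = "\<lambda>q. n / 2 * (norm (q - w))\<^sup>2 + c / (T - snd q)" and D = "\<lambda>q. n *\<^sub>R (q - w) + (0, c / (T - snd q)\<^sup>2)"])
    fix q assume "q \<in> U"
    hence "snd q < T" by (auto simp: U_def)
    from has_derivative_add[OF quadratic_has_derivative penalty_has_derivative[OF this]]
    show "((\<lambda>q. n / 2 * (norm (q - w))\<^sup>2 + c / (T - snd q)) has_derivative (\<lambda>h. (n *\<^sub>R (q - w) + (0, c / (T - snd q)\<^sup>2)) \<bullet> h)) (at q)"
      by (simp add: inner_add_left)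
  next
    show "continuous_on U (\<lambda>q. n *\<^sub>R (q - w) + (0, c / (T - snd q)\<^sup>2))"
      by (intro continuous_intros) (auto simp: U_def)
    show "0 < T1 - snd z" using z1 by simp
    fix q assume q: "q \<in> ball z (T1 - snd z)" "q \<in> U"
    have "snd q - snd z \<le> dist z q" using dist_snd_le[of z q] by (simp add: dist_real_def)
    hence "(q, w) \<in> Q1 \<times> Q" using q w by (auto simp: Q1_def U_def)
    from p(2)[OF this] show "a q - (n / 2 * (norm (q - w))\<^sup>2 + c / (T - snd q)) \<le> a z - (n / 2 * (norm (z - w))\<^sup>2 + c / (T - snd z))"
      by (simp add: \<Phi>_def p_eq)
  qed (rule zU)
  hence 1: "P * (R + c / (T - snd z)\<^sup>2) \<le> f z" using F[OF zU[unfolded U_def]] by (simp add: P_def R_def)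
  have "F w ((- n) *\<^sub>R (w - z)) \<ge> 0"
  proof (rule visc_superD[OF super[folded U_def], where \<phi> = "\<lambda>q. - n / 2 * (norm (q - z))\<^sup>2" and D = "\<lambda>q. (- n) *\<^sub>R (q - z)" and e = 1])
    fix q assume "q \<in> U"
    show "((\<lambda>q. - n / 2 * (norm (q - z))\<^sup>2) has_derivative (\<lambda>h. ((- n) *\<^sub>R (q - z)) \<bullet> h)) (at q)"
      by (rule quadratic_has_derivative)
    have "(z, q) \<in> Q1 \<times> Q" using \<open>q \<in> U\<close> z by (auto simp: Q_def U_def)
    from p(2)[OF this] show "b w - - n / 2 * (norm (w - z))\<^sup>2 \<le> b q - - n / 2 * (norm (q - z))\<^sup>2"
      by (simp add: \<Phi>_def p_eq norm_minus_commute)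
  qed (auto intro!: continuous_intros wU)
  hence 2: "P * R \<ge> f w" using F[OF wU[unfolded U_def]] by (simp add: P_def R_def algebra_simps)
  have zb: "0 \<le> fst z" "fst z < 1" "0 \<le> snd z" "snd z \<le> T" using zU by (auto simp: U_def mem_Times_iff)
  have wb: "0 < fst w" "fst w \<le> 1" "0 \<le> snd w" "snd w \<le> T" using wU by (auto simp: U_def mem_Times_iff)
  \<comment> \<open>Moving z to the right if \<open>a\<close> has the slope bound, or w to the left
    if \<open>b\<close> has it, gains at least \<epsilon> s and widens the signed separation by s;
    at a maximum the quadratic penalty must absorb this gain.\<close>
  have "\<epsilon> \<le> P"
    using slope
  proof
    assume sl: "slope_ge \<epsilon> T a"
    show ?thesis unfolding P_def
    proof (rule quadratic_increment_slope[OF n, of "1 - fst z"])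
      show "0 < 1 - fst z" using zb by simp
      fix s assume s: "0 < s" "s \<le> 1 - fst z"
      have "((fst z + s, snd z), w) \<in> Q1 \<times> Q" using s z w zb by (auto simp: Q1_def mem_Times_iff)
      note le = p(2)[OF this]
      have "\<epsilon> * ((fst z + s) - fst z) \<le> a (fst z + s, snd z) - a (fst z, snd z)"
        using sl[unfolded slope_ge_def, rule_format, of "fst z" "fst z + s" "snd z"] s zb by simp
      thus "\<epsilon> * s \<le> n / 2 * ((fst z - fst w + s)\<^sup>2 - (fst z - fst w)\<^sup>2)"
        using le unfolding \<Phi>_def p_eq norm_diff_Pair_square by (simp add: algebra_simps)
    qed
  next
    assume sl: "slope_ge \<epsilon> T b"
    show ?thesis unfolding P_def
    proof (rule quadratic_increment_slope[OF n, of "fst w"])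
      show "0 < fst w" by (rule wb)
      fix s assume s: "0 < s" "s \<le> fst w"
      have "(z, (fst w - s, snd w)) \<in> Q1 \<times> Q" using s z wb by (auto simp: Q_def mem_Times_iff)
      note le = p(2)[OF this]
      have "\<epsilon> * (fst w - (fst w - s)) \<le> b (fst w, snd w) - b (fst w - s, snd w)"
        using sl[unfolded slope_ge_def, rule_format, of "fst w - s" "fst w" "snd w"] s wb by simp
      thus "\<epsilon> * s \<le> n / 2 * ((fst z - fst w + s)\<^sup>2 - (fst z - fst w)\<^sup>2)"
        using le unfolding \<Phi>_def p_eq norm_diff_Pair_square by (simp add: algebra_simps)
    qed
  qed
  \<comment> \<open>The time penalty separates the two viscosity inequalities by P c / (T - snd
    z)^2, bounded below thanks to P \<ge> \<epsilon>; the two values of \<open>f\<close> are too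
    close for that.\<close>
  have "\<epsilon> * (c / T\<^sup>2) \<le> P * (c / (T - snd z)\<^sup>2)"
    using \<open>\<epsilon> \<le> P\<close> \<epsilon> c Tz by (intro mult_mono divide_left_mono power_mono) auto
  also have "\<dots> \<le> f z - f w" using 1 2 by (simp add: distrib_left)
  also have "\<dots> < \<epsilon> * c / T\<^sup>2" using df(2)[OF w z(2)] zw d by (simp add: dist_real_def)
  finally show False by simp
qed

text \<open>The time penalty is singular at T, so the final time is reached by continuity.\<close>

lemma viscosity_comparison:
  assumes z0: "z0 \<in> {0..1} \<times> {0..T}"
  shows "a z0 \<le> b z0"
proof -
  define s where "s k = T * (real k / real (Suc k))" for k
  have s: "0 \<le> s k" "s k < T" for k using T by (auto simp: s_def field_simps)
  have "(\<lambda>k. real k / real (Suc k)) \<longlonglongrightarrow> 1" by (rule LIMSEQ_n_over_Suc_n)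
  hence "s \<longlonglongrightarrow> T" unfolding s_def using tendsto_mult_left[of "\<lambda>k. real k / real (Suc k)" 1 sequentially T] by simp
  hence lim: "(\<lambda>k. (fst z0, s k)) \<longlonglongrightarrow> (fst z0, T)" by (intro tendsto_Pair tendsto_const)
  have Q: "(fst z0, T) \<in> {0..1} \<times> {0..T}" "\<And>k. (fst z0, s k) \<in> {0..1} \<times> {0..T}" using z0 T s by (auto intro: less_imp_le)
  show ?thesis
  proof (cases "snd z0 = T")
    case True
    have "a (fst z0, T) \<le> b (fst z0, T)"
    proof (rule LIMSEQ_le)
      show "(\<lambda>k. a (fst z0, s k)) \<longlonglongrightarrow> a (fst z0, T)" "(\<lambda>k. b (fst z0, s k)) \<longlonglongrightarrow> b (fst z0, T)"
        using continuous_on_tendsto_compose[OF ca lim Q(1)] continuous_on_tendsto_compose[OF cb lim Q(1)] Q(2) by auto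
      show "\<exists>N. \<forall>k\<ge>N. a (fst z0, s k) \<le> b (fst z0, s k)"
        using viscosity_comparison_open[OF Q(2)] s by auto
    qed
    thus ?thesis using True by (metis prod.collapse)
  next
    case False
    thus ?thesis using viscosity_comparison_open[OF z0] z0 by auto
  qed
qed

end

section \<open>Limits of the scheme\<close>

lemma partial_derivatives:
  fixes \<phi> :: "real \<times> real \<Rightarrow> real"
  assumes "(\<phi> has_derivative (\<lambda>h. D \<bullet> h)) (at (x, t))"
  shows "((\<lambda>y. \<phi> (y, t)) has_real_derivative fst D) (at x)"
    and "((\<lambda>s. \<phi> (x, s)) has_real_derivative snd D) (at t)"
proof -
  have "((\<lambda>y. (y, t)) has_derivative (\<lambda>h. (h, 0))) (at x)" "((\<lambda>s. (x, s)) has_derivative (\<lambda>h. (0, h))) (at t)"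
    by (auto intro!: derivative_eq_intros)
  from has_derivative_compose[OF this(1) assms] has_derivative_compose[OF this(2) assms]
  show "((\<lambda>y. \<phi> (y, t)) has_real_derivative fst D) (at x)" "((\<lambda>s. \<phi> (x, s)) has_real_derivative snd D) (at t)"
    by (simp_all add: has_field_derivative_def inner_prod_def mult_commute_abs)
qed

lemma dist_Pair_le_sum: "dist (y, s) (x, t :: real) \<le> \<bar>y - x :: real\<bar> + \<bar>s - t\<bar>"
  unfolding dist_Pair_Pair dist_real_def by (rule order_trans[OF sqrt_sum_squares_le_sum_abs]) simp

text \<open>A function touching from above increases to the right of x at least as fast as \<kappa>;
  one touching from below increases up to x from the left at least as fast. One side is enough to
  bound its slope.\<close>

lemma touching_slope:
  fixes \<kappa> \<phi> :: "real \<times> real \<Rightarrow> real"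
  assumes \<sigma>: "\<sigma> = 1 \<or> \<sigma> = -1"
    and d: "((\<lambda>y. \<phi> (y, t)) has_real_derivative p) (at x)" and r: "r > 0"
    and touch: "\<And>y. \<bar>y - x\<bar> < r \<Longrightarrow> \<sigma> * (\<kappa> (y, t) - \<phi> (y, t)) \<le> \<sigma> * (\<kappa> (x, t) - \<phi> (x, t))"
    and slope: "\<And>y y'. \<bar>y - x\<bar> < r \<Longrightarrow> \<bar>y' - x\<bar> < r \<Longrightarrow> y \<le> y' \<Longrightarrow> \<epsilon> * (y' - y) \<le> \<kappa> (y', t) - \<kappa> (y, t)"
  shows "\<epsilon> \<le> p"
proof (rule ccontr)
  assume "\<not> \<epsilon> \<le> p"
  hence neg: "p - \<epsilon> < 0" by simp
  have d': "((\<lambda>y. \<phi> (y, t) - \<epsilon> * y) has_real_derivative p - \<epsilon>) (at x)"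
    by (auto intro!: derivative_eq_intros d)
  obtain e1 where e1: "e1 > 0" "\<And>h. 0 < h \<Longrightarrow> h < e1 \<Longrightarrow> \<phi> (x + h, t) - \<epsilon> * (x + h) < \<phi> (x, t) - \<epsilon> * x"
    using DERIV_neg_dec_right[OF d' neg] by blast
  obtain e2 where e2: "e2 > 0" "\<And>h. 0 < h \<Longrightarrow> h < e2 \<Longrightarrow> \<phi> (x, t) - \<epsilon> * x < \<phi> (x - h, t) - \<epsilon> * (x - h)"
    using DERIV_neg_dec_left[OF d' neg] by blast
  define h where "h = Min {e1, e2, r} / 2"
  have h: "h > 0" "h < e1" "h < e2" "h < r" using e1(1) e2(1) r by (auto simp: h_def)
  show False
    using \<sigma>
  proof
    assume "\<sigma> = 1"
    thus False using e1(2)[OF h(1,2)] touch[of "x + h"] slope[of x "x + h"] h by (simp add: algebra_simps)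
  next
    assume "\<sigma> = -1"
    thus False using e2(2)[OF h(1,3)] touch[of "x - h"] slope[of "x - h" x] h by (simp add: algebra_simps)
  qed
qed

text \<open>The Barles-Souganidis argument, for touching from above (\<sigma> = 1) and from below
  (\<sigma> = -1) at once. \<open>scheme\<close> combines monotonicity with the update: domination
  of \<open>u j\<close> by \<psi> on the stencil at the earlier time passes to the updated values.
  The mean value theorem replaces differences of the test function by derivatives at nearby points,
  which merge at z in the limit.\<close>

lemma upwind_limit_test:
  fixes u :: "nat \<Rightarrow> real \<Rightarrow> real \<Rightarrow> real" and \<kappa> \<phi> :: "real \<times> real \<Rightarrow> real" and D :: "real \<times> real \<Rightarrow> real \<times> real"
  assumes \<sigma>: "\<sigma> = 1 \<or> \<sigma> = -1" and \<epsilon>: "\<epsilon> > 0"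
    and h: "\<And>j. h j > 0" "h \<longlonglongrightarrow> 0" and \<tau>: "\<tau> \<longlonglongrightarrow> 0"
    and U: "open U" "\<And>q. q \<in> U \<Longrightarrow> snd q > 0"
    and unif: "\<And>e. e > 0 \<Longrightarrow> \<exists>N. \<forall>j\<ge>N. \<forall>q\<in>U. \<bar>u j (fst q) (snd q) - \<kappa> q\<bar> < e"
    and cont: "\<And>j. continuous_on U (\<lambda>q. u j (fst q) (snd q))"
    and scheme: "\<And>j t. t > 0 \<Longrightarrow> \<exists>t'. 0 \<le> t' \<and> t' < t \<and> t - t' \<le> \<tau> j \<and>
       (\<forall>x \<psi>. (\<forall>y\<in>{x - h j, x, x + h j}. \<sigma> * u j y t' \<le> \<sigma> * \<psi> y) \<longrightarrow>
          \<sigma> * u j x t \<le> \<sigma> * (\<psi> x + (t - t') * upwind_op \<epsilon> f (h j) t' \<psi> x))"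
    and cf: "isCont (\<lambda>q. f (fst q) (snd q)) z"
    and \<phi>: "\<And>q. q \<in> U \<Longrightarrow> (\<phi> has_derivative (\<lambda>h. D q \<bullet> h)) (at q)" and cD: "continuous_on U D"
    and z: "z \<in> U" and e: "e > 0"
    and touch: "\<And>q. q \<in> ball z e \<Longrightarrow> q \<in> U \<Longrightarrow> \<sigma> * (\<kappa> q - \<phi> q) \<le> \<sigma> * (\<kappa> z - \<phi> z)"
  shows "\<sigma> * snd (D z) \<le> \<sigma> * (f (fst z) (snd z) * trunc_inv \<epsilon> (fst (D z)))"
proof -
  have \<sigma>2: "\<sigma> * \<sigma> = 1" "\<bar>\<sigma>\<bar> = 1" using \<sigma> by auto
  have "open (U \<inter> ball z e)" using U by auto
  then obtain r where r: "r > 0" "cball z r \<subseteq> U \<inter> ball z e"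
    using z e by (meson IntI centre_in_ball open_contains_cball)
  \<comment> \<open>Bends the test function so that the touching at z becomes strict without
    changing the gradient there. The factor is written (2 \<sigma>) / 2 to fit
    \<open>quadratic_has_derivative\<close>.\<close>
  define \<phi>' where "\<phi>' q = \<phi> q + (2 * \<sigma>) / 2 * (norm (q - z))\<^sup>2" for q
  define D' where "D' q = D q + (2 * \<sigma>) *\<^sub>R (q - z)" for q
  have \<phi>': "(\<phi>' has_derivative (\<lambda>h. D' q \<bullet> h)) (at q)" if "q \<in> U" for q
    unfolding \<phi>'_def[abs_def] D'_def inner_add_left
    by (rule has_derivative_add[OF \<phi>[OF that] quadratic_has_derivative])
  have c\<phi>': "continuous_on U \<phi>'"
    by (intro continuous_at_imp_continuous_on ballI has_derivative_continuous[OF \<phi>'])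
  have main: "\<exists>A B C. A \<in> ball z d \<and> B \<in> ball z d \<and> C \<in> ball z d \<and>
      \<sigma> * snd (D' A) \<le> \<sigma> * (f (fst B) (snd B) * trunc_inv \<epsilon> (fst (D' C)))" if d: "0 < d" "d \<le> r" for d
  proof -
    \<comment> \<open>The uniform errors at p and at z add up to d^2/16, which places the maximum
      point within d/4 of z.\<close>
    have "d\<^sup>2 / 32 > 0" using d by simp
    from unif[OF this] obtain N1 where N1: "\<And>j q. j \<ge> N1 \<Longrightarrow> q \<in> U \<Longrightarrow> \<bar>u j (fst q) (snd q) - \<kappa> q\<bar> < d\<^sup>2 / 32" by blast
    have "eventually (\<lambda>j. h j < d / 4) sequentially" "eventually (\<lambda>j. \<tau> j < d / 4) sequentially"
      using order_tendstoD(2)[OF h(2), of "d / 4"] order_tendstoD(2)[OF \<tau>, of "d / 4"] d by auto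
    hence "eventually (\<lambda>j. j \<ge> N1 \<and> h j < d / 4 \<and> \<tau> j < d / 4) sequentially"
      by (intro eventually_conj eventually_ge_at_top)
    from eventually_happens'[OF sequentially_bot this]
    obtain j where j: "j \<ge> N1" "h j < d / 4" "\<tau> j < d / 4" by blast
    define g where "g q = \<sigma> * (u j (fst q) (snd q) - \<phi>' q)" for q
    have sub: "cball z r \<subseteq> U" using r by auto
    have "continuous_on (cball z r) g" unfolding g_def
      by (intro continuous_intros continuous_on_subset[OF cont sub] continuous_on_subset[OF c\<phi>' sub])
    then obtain p where p: "p \<in> cball z r" "\<And>q. q \<in> cball z r \<Longrightarrow> g q \<le> g p"
      using continuous_attains_sup[of "cball z r" g] r(1) by auto
    have pU: "p \<in> U" using p(1) sub by auto
    have "(dist p z)\<^sup>2 \<le> (d / 4)\<^sup>2"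
    proof -
      have g1: "g q = \<sigma> * (u j (fst q) (snd q) - \<kappa> q) + \<sigma> * (\<kappa> q - \<phi> q) - (norm (q - z))\<^sup>2" for q
      proof -
        have "\<sigma> * (\<sigma> * (norm (q - z))\<^sup>2) = (norm (q - z))\<^sup>2" using \<sigma>2(1) by (simp add: mult.assoc[symmetric])
        thus ?thesis unfolding g_def \<phi>'_def by (simp add: algebra_simps)
      qed
      have "g z \<le> g p" using p(2)[of z] r(1) by simp
      moreover have "\<sigma> * (\<kappa> p - \<phi> p) \<le> \<sigma> * (\<kappa> z - \<phi> z)"
        by (rule touch) (use subsetD[OF r(2) p(1)] in simp_all)
      moreover have ab: "\<bar>\<sigma> * (u j (fst q) (snd q) - \<kappa> q)\<bar> < d\<^sup>2 / 32" if "q \<in> U" for q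
        using N1[OF j(1) that] \<sigma>2 by (simp add: abs_mult)
      ultimately have "(norm (p - z))\<^sup>2 \<le> d\<^sup>2 / 32 + d\<^sup>2 / 32"
        using ab[OF pU] ab[OF z] unfolding g1[of z] g1[of p] by simp
      thus ?thesis by (simp add: dist_norm power_divide)
    qed
    hence pz: "dist p z \<le> d / 4" by (rule power2_le_imp_le) (use d in simp)
    obtain x t where pe: "p = (x, t)" by (cases p)
    have "t > 0" using U(2)[OF pU] pe by simp
    from scheme[OF this, of j] obtain t' where t': "0 \<le> t'" "t' < t" "t - t' \<le> \<tau> j"
      and sch: "\<And>x \<psi>. (\<forall>y\<in>{x - h j, x, x + h j}. \<sigma> * u j y t' \<le> \<sigma> * \<psi> y) \<Longrightarrow>
          \<sigma> * u j x t \<le> \<sigma> * (\<psi> x + (t - t') * upwind_op \<epsilon> f (h j) t' \<psi> x)"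
      by blast
    have near: "(y, s) \<in> ball z d" if "\<bar>y - x\<bar> \<le> h j" "t' \<le> s" "s \<le> t" for y s
    proof -
      have "dist (y, s) p \<le> \<bar>y - x\<bar> + \<bar>s - t\<bar>" unfolding pe by (rule dist_Pair_le_sum)
      also have "\<dots> < d / 4 + d / 4" using that t' j by auto
      finally have "dist (y, s) z < d" using pz dist_triangle[of "(y, s)" z p] d by simp
      thus ?thesis by (simp add: dist_commute)
    qed
    have nearU: "(y, s) \<in> U" "(y, s) \<in> cball z r" if "\<bar>y - x\<bar> \<le> h j" "t' \<le> s" "s \<le> t" for y s
      using near[OF that] d sub by auto
    \<comment> \<open>Shifts the test function to agree with the discrete solution at the maximum
      point (x, t).\<close>
    define c where "c = u j x t - \<phi>' (x, t)"
    have "\<sigma> * u j x t \<le> \<sigma> * ((\<phi>' (x, t') + c) + (t - t') * upwind_op \<epsilon> f (h j) t' (\<lambda>y. \<phi>' (y, t') + c) x)"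
    proof (rule sch[of x "\<lambda>y. \<phi>' (y, t') + c"], rule ballI)
      fix y assume "y \<in> {x - h j, x, x + h j}"
      hence "g (y, t') \<le> g p" using h(1)[of j] t' by (intro p(2) nearU) auto
      thus "\<sigma> * u j y t' \<le> \<sigma> * (\<phi>' (y, t') + c)" unfolding g_def pe c_def by (simp add: algebra_simps)
    qed
    hence "\<sigma> * (\<phi>' (x, t) - \<phi>' (x, t')) \<le> (t - t') * (\<sigma> * upwind_op \<epsilon> f (h j) t' (\<lambda>y. \<phi>' (y, t')) x)"
      unfolding c_def by (simp add: upwind_op_def algebra_simps)
    moreover obtain a where a: "t' < a" "a < t" "\<phi>' (x, t) - \<phi>' (x, t') = (t - t') * snd (D' (x, a))"
      using MVT2[OF t'(2), of "\<lambda>s. \<phi>' (x, s)" "\<lambda>s. snd (D' (x, s))"] partial_derivatives(2)[OF \<phi>'[OF nearU(1)]] h(1)[of j] by auto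
    ultimately have "(t - t') * (\<sigma> * snd (D' (x, a))) \<le> (t - t') * (\<sigma> * upwind_op \<epsilon> f (h j) t' (\<lambda>y. \<phi>' (y, t')) x)" by (simp add: mult.left_commute)
    hence 1: "\<sigma> * snd (D' (x, a)) \<le> \<sigma> * upwind_op \<epsilon> f (h j) t' (\<lambda>y. \<phi>' (y, t')) x" using t'(2) by simp
    have dx: "((\<lambda>y. \<phi>' (y, t')) has_real_derivative fst (D' (y, t'))) (at y)" if "\<bar>y - x\<bar> \<le> h j" for y
      using partial_derivatives(1)[OF \<phi>'[OF nearU(1)]] that t' by simp
    obtain a1 where a1: "x - h j < a1" "a1 < x" "\<phi>' (x, t') - \<phi>' (x - h j, t') = h j * fst (D' (a1, t'))"
      using MVT2[of "x - h j" x "\<lambda>y. \<phi>' (y, t')" "\<lambda>y. fst (D' (y, t'))"] dx h(1)[of j] by auto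
    obtain a2 where a2: "x < a2" "a2 < x + h j" "\<phi>' (x + h j, t') - \<phi>' (x, t') = h j * fst (D' (a2, t'))"
      using MVT2[of x "x + h j" "\<lambda>y. \<phi>' (y, t')" "\<lambda>y. fst (D' (y, t'))"] dx h(1)[of j] by auto
    define a3 where "a3 = (if 0 \<le> f x t' then a1 else a2)"
    have "upwind_op \<epsilon> f (h j) t' (\<lambda>y. \<phi>' (y, t')) x = f x t' * trunc_inv \<epsilon> (fst (D' (a3, t')))"
      unfolding upwind_op_def a1(3) a2(3) upwind_def a3_def using h(1)[of j] by simp
    moreover have "\<bar>a3 - x\<bar> \<le> h j" using a1 a2 by (auto simp: a3_def)
    ultimately show ?thesis
      using 1 a t' h(1)[of j] by (intro exI[of _ "(x, a)"] exI[of _ "(x, t')"] exI[of _ "(a3, t')"] conjI near) auto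
  qed
  have "\<forall>k. \<exists>A B C. A \<in> ball z (r / real (Suc k)) \<and> B \<in> ball z (r / real (Suc k)) \<and> C \<in> ball z (r / real (Suc k)) \<and>
      \<sigma> * snd (D' A) \<le> \<sigma> * (f (fst B) (snd B) * trunc_inv \<epsilon> (fst (D' C)))"
    using r(1) by (intro allI main) (auto simp: field_simps)
  hence "\<exists>A B C. \<forall>k. A k \<in> ball z (r / real (Suc k)) \<and> B k \<in> ball z (r / real (Suc k)) \<and> C k \<in> ball z (r / real (Suc k)) \<and>
      \<sigma> * snd (D' (A k)) \<le> \<sigma> * (f (fst (B k)) (snd (B k)) * trunc_inv \<epsilon> (fst (D' (C k))))"
    by (simp only: choice_iff)
  then obtain A B C where ABC: "\<And>k. A k \<in> ball z (r / real (Suc k))" "\<And>k. B k \<in> ball z (r / real (Suc k))" "\<And>k. C k \<in> ball z (r / real (Suc k))"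
    "\<And>k. \<sigma> * snd (D' (A k)) \<le> \<sigma> * (f (fst (B k)) (snd (B k)) * trunc_inv \<epsilon> (fst (D' (C k))))"
    by blast
  have lim: "X \<longlonglongrightarrow> z" if X: "\<And>k. X k \<in> ball z (r / real (Suc k))" for X
  proof (rule metric_tendsto_imp_tendsto)
    have "(\<lambda>k. r * inverse (real (Suc k))) \<longlonglongrightarrow> r * 0" by (intro tendsto_mult tendsto_const LIMSEQ_inverse_real_of_nat)
    thus "(\<lambda>k. r / real (Suc k)) \<longlonglongrightarrow> 0" by (simp add: divide_inverse)
    show "\<forall>\<^sub>F k in sequentially. dist (X k) z \<le> dist (r / real (Suc k)) 0"
      using X r(1) by (intro always_eventually allI) (auto simp: dist_commute intro: less_imp_le)
  qed
  have "isCont D z" using cD U(1) z by (simp add: continuous_on_eq_continuous_at)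
  hence cD': "isCont D' z" unfolding D'_def by (intro continuous_intros)
  have Dz: "D' z = D z" by (simp add: D'_def)
  have "(\<lambda>k. \<sigma> * snd (D' (A k))) \<longlonglongrightarrow> \<sigma> * snd (D z)"
    using isCont_tendsto_compose[OF cD' lim[OF ABC(1)]] unfolding Dz by (intro tendsto_intros)
  moreover have "(\<lambda>k. \<sigma> * (f (fst (B k)) (snd (B k)) * trunc_inv \<epsilon> (fst (D' (C k))))) \<longlonglongrightarrow> \<sigma> * (f (fst z) (snd z) * trunc_inv \<epsilon> (fst (D z)))"
    using isCont_tendsto_compose[OF cD' lim[OF ABC(3)]] isCont_tendsto_compose[OF cf lim[OF ABC(2)]] unfolding Dz
    by (intro tendsto_intros isCont_tendsto_compose[OF continuous_trunc_inv[OF \<epsilon>]])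
  ultimately show ?thesis using ABC(4) by (intro LIMSEQ_le) auto
qed

context upwind_data
begin

text \<open>Arzela-Ascoli along a fixed ratio dt / h. All claims but the viscosity test pass to the
  limit pointwise, the increment bound losing only O(h).\<close>

lemma upwind_limit:
  assumes T_pos: "T > 0"
    and f_zero: "\<And>t. f 0 t = 0" "\<And>t. f 1 t = 0"
    and f_cont: "continuous_on UNIV (\<lambda>q. f (fst q) (snd q))"
  obtains L and \<kappa> :: "real \<times> real \<Rightarrow> real" where
    "L-lipschitz_on ({0..1} \<times> {0..T}) \<kappa>"
    "\<And>x. x \<in> {0..1} \<Longrightarrow> \<kappa> (x, 0) = u0 x"
    "\<And>t. t \<in> {0..T} \<Longrightarrow> \<kappa> (0, t) = u0 0" "\<And>t. t \<in> {0..T} \<Longrightarrow> \<kappa> (1, t) = u0 1"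
    "\<And>x y t. 0 \<le> x \<Longrightarrow> x \<le> y \<Longrightarrow> y \<le> 1 \<Longrightarrow> t \<in> {0..T} \<Longrightarrow> integral {x..y} (\<lambda>z. v z t) \<le> \<kappa> (y, t) - \<kappa> (x, t)"
    "\<And>\<sigma> \<phi> D z e. \<sigma> = 1 \<or> \<sigma> = -1 \<Longrightarrow> \<forall>q \<in> {0<..<1} \<times> {0<..<T}. (\<phi> has_derivative (\<lambda>h. D q \<bullet> h)) (at q) \<Longrightarrow>
      continuous_on ({0<..<1} \<times> {0<..<T}) D \<Longrightarrow> z \<in> {0<..<1} \<times> {0<..<T} \<Longrightarrow> e > 0 \<Longrightarrow>
      \<forall>q \<in> ball z e \<inter> {0<..<1} \<times> {0<..<T}. \<sigma> * (\<kappa> q - \<phi> q) \<le> \<sigma> * (\<kappa> z - \<phi> z) \<Longrightarrow>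
      \<sigma> * snd (D z) \<le> \<sigma> * (f (fst z) (snd z) * trunc_inv \<epsilon> (fst (D z)))"
proof -
  note pos = T_pos data_pos
  \<comment> \<open>The ratio dt / h: at most 1 for \<open>dt_le\<close>, the other bound for
    \<open>CFL\<close>. \<open>Fm + 1\<close> avoids a division by 0.\<close>
  define lam where "lam = min 1 (\<epsilon>\<^sup>2 / (4 * (Fm + 1)))"
  have lam: "lam > 0" "lam \<le> 1" "4 * Fm * lam \<le> \<epsilon>\<^sup>2"
  proof -
    show "lam > 0" "lam \<le> 1" using pos by (auto simp: lam_def)
    have "lam \<le> \<epsilon>\<^sup>2 / (4 * (Fm + 1))" by (simp add: lam_def)
    hence "4 * (Fm + 1) * lam \<le> \<epsilon>\<^sup>2" using pos by (simp add: field_simps)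
    moreover have "4 * Fm * lam \<le> 4 * (Fm + 1) * lam" using \<open>lam > 0\<close> by simp
    ultimately show "4 * Fm * lam \<le> \<epsilon>\<^sup>2" by linarith
  qed
  define h where "h j = inverse (real (Suc j))" for j
  define dt where "dt j = lam * h j" for j
  have h: "h j > 0" for j by (simp add: h_def)
  have h0: "h \<longlonglongrightarrow> 0" unfolding h_def by (rule LIMSEQ_inverse_real_of_nat)
  have dt0: "dt \<longlonglongrightarrow> 0" unfolding dt_def using tendsto_mult_left[OF h0, of lam] by simp
  have loc: "upwind_scheme f v \<epsilon> Fm Lf u0 L0 M Lv Cs (h j) (dt j)" for j
  proof unfold_locales
    show "4 * Fm * dt j \<le> \<epsilon>\<^sup>2 * h j" using mult_right_mono[OF lam(3), of "h j"] h[of j] by (simp add: dt_def mult.assoc)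
    show "0 < dt j" using lam h by (simp add: dt_def)
    show "dt j \<le> h j" using lam(2) h[of j] by (simp add: dt_def)
  qed (rule h)
  define u where "u j = upwind_scheme.sol f \<epsilon> u0 (h j) (dt j)" for j
  define Lx where "Lx = L0 + T * (2 / \<epsilon> * Lf)"
  define Lt where "Lt = 2 * Fm / \<epsilon>"
  define Q where "Q = {0..1::real} \<times> {0..T}"
  have L0: "L0 \<ge> 0" using order_trans[OF abs_ge_zero u0_lip[of 0 1]] by simp
  have Lx: "Lx \<ge> 0" and Lt: "Lt \<ge> 0" using pos L0 by (auto simp: Lx_def Lt_def)
  have ux: "\<bar>u j x t - u j y t\<bar> \<le> Lx * \<bar>x - y\<bar>" if "t \<in> {0..T}" for j x y t
  proof -
    have "\<bar>u j x t - u j y t\<bar> \<le> (L0 + t * (2 / \<epsilon> * Lf)) * \<bar>x - y\<bar>"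
      unfolding u_def using upwind_scheme.sol_lipschitz_x[OF loc[of j], where t = t and x = x and y = y] that
      by (simp add: upwind_scheme.slope_rate_def[OF loc])
    also have "\<dots> \<le> Lx * \<bar>x - y\<bar>"
      unfolding Lx_def using that pos by (intro mult_right_mono add_left_mono) auto
    finally show ?thesis .
  qed
  have ut: "\<bar>u j x t - u j x s\<bar> \<le> Lt * \<bar>t - s\<bar>" if "t \<ge> 0" "s \<ge> 0" for j x s t
  proof (cases "s \<le> t")
    case True
    thus ?thesis unfolding u_def Lt_def using upwind_scheme.sol_lipschitz_t[OF loc[of j] that(2) True, where x = x]
      by (simp add: upwind_scheme.speed_def[OF loc])
  next
    case False
    thus ?thesis unfolding u_def Lt_def using upwind_scheme.sol_lipschitz_t[OF loc[of j] that(1), where t = s and x = x]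
      by (simp add: upwind_scheme.speed_def[OF loc] abs_minus_commute)
  qed
  define L where "L = Lx + Lt"
  have L: "L \<ge> 0" using Lx Lt by (simp add: L_def)
  have uL: "\<bar>u j (fst p) (snd p) - u j (fst q) (snd q)\<bar> \<le> L * dist p q" if "p \<in> Q" "q \<in> Q" for j p q
  proof -
    have "\<bar>u j (fst p) (snd p) - u j (fst q) (snd p)\<bar> \<le> Lx * \<bar>fst p - fst q\<bar>" using that by (intro ux) (auto simp: Q_def)
    also have "\<dots> \<le> Lx * dist p q" using Lx dist_fst_le[of p q] by (intro mult_left_mono) (auto simp: dist_real_def)
    finally have 1: "\<bar>u j (fst p) (snd p) - u j (fst q) (snd p)\<bar> \<le> Lx * dist p q" .
    have "\<bar>u j (fst q) (snd p) - u j (fst q) (snd q)\<bar> \<le> Lt * \<bar>snd p - snd q\<bar>" using that by (intro ut) (auto simp: Q_def)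
    also have "\<dots> \<le> Lt * dist p q" using Lt dist_snd_le[of p q] by (intro mult_left_mono) (auto simp: dist_real_def)
    finally show ?thesis using 1 by (simp add: L_def algebra_simps)
  qed
  have u_fixed: "u j 0 t = u0 0" "u j 1 t = u0 1" for j t
    unfolding u_def by (rule upwind_scheme.sol_fixed[OF loc f_zero(1)], rule upwind_scheme.sol_fixed[OF loc f_zero(2)])
  have u_init: "u j x 0 = u0 x" for j x unfolding u_def by (rule upwind_scheme.sol_0[OF loc])
  have cQ: "compact Q" unfolding Q_def by (intro compact_Times) auto
  obtain \<kappa> k where \<kappa>: "continuous_on Q \<kappa>" "strict_mono (k :: nat \<Rightarrow> nat)"
    "\<And>e. 0 < e \<Longrightarrow> \<exists>N. \<forall>n x. n \<ge> N \<and> x \<in> Q \<longrightarrow> norm (u (k n) (fst x) (snd x) - \<kappa> x) < e"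
  proof (rule Arzela_Ascoli[OF cQ, of "\<lambda>j p. u j (fst p) (snd p)" "\<bar>u0 0\<bar> + Lx"])
    fix j p assume p: "p \<in> Q"
    have "\<bar>u j (fst p) (snd p) - u j 0 (snd p)\<bar> \<le> Lx * \<bar>fst p - 0\<bar>" using p by (intro ux) (auto simp: Q_def)
    also have "\<dots> \<le> Lx * 1" using p Lx by (intro mult_left_mono) (auto simp: Q_def)
    finally show "norm (u j (fst p) (snd p)) \<le> \<bar>u0 0\<bar> + Lx" using u_fixed(1)[of j "snd p"] by simp
  next
    fix p :: "real \<times> real" and e :: real assume p: "p \<in> Q" "0 < e"
    show "\<exists>d>0. \<forall>n y. y \<in> Q \<and> norm (p - y) < d \<longrightarrow> norm (u n (fst p) (snd p) - u n (fst y) (snd y)) < e"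
    proof (intro exI[of _ "e / (L + 1)"] conjI allI impI)
      show "0 < e / (L + 1)" using p L by simp
      fix n y assume y: "y \<in> Q \<and> norm (p - y) < e / (L + 1)"
      have "norm (u n (fst p) (snd p) - u n (fst y) (snd y)) \<le> L * dist p y" using uL[OF p(1)] y by simp
      also have "\<dots> \<le> (L + 1) * dist p y" by (simp add: mult_right_mono)
      also have "\<dots> < (L + 1) * (e / (L + 1))" using y L by (intro mult_strict_left_mono) (auto simp: dist_norm)
      finally show "norm (u n (fst p) (snd p) - u n (fst y) (snd y)) < e" using L by simp
    qed
  qed blast
  have lim: "(\<lambda>n. u (k n) x t) \<longlonglongrightarrow> \<kappa> (x, t)" if "(x, t) \<in> Q" for x t
  proof (rule LIMSEQ_I)
    fix e :: real assume "e > 0"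
    from \<kappa>(3)[OF this] that show "\<exists>N. \<forall>n\<ge>N. norm (u (k n) x t - \<kappa> (x, t)) < e" by fastforce
  qed
  have hk: "(\<lambda>n. h (k n)) \<longlonglongrightarrow> 0" and dtk: "(\<lambda>n. dt (k n)) \<longlonglongrightarrow> 0"
    using LIMSEQ_subseq_LIMSEQ[OF h0 \<kappa>(2)] LIMSEQ_subseq_LIMSEQ[OF dt0 \<kappa>(2)] by (simp_all add: o_def)
  show ?thesis
  proof (rule that[of L \<kappa>])
    show "L-lipschitz_on ({0..1} \<times> {0..T}) \<kappa>"
    proof (rule lipschitz_onI[OF _ L])
      fix p q :: "real \<times> real" assume "p \<in> {0..1} \<times> {0..T}" "q \<in> {0..1} \<times> {0..T}"
      hence pq: "p \<in> Q" "q \<in> Q" by (auto simp: Q_def)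
      have "(\<lambda>n. \<bar>u (k n) (fst p) (snd p) - u (k n) (fst q) (snd q)\<bar>) \<longlonglongrightarrow> \<bar>\<kappa> p - \<kappa> q\<bar>"
        using lim[of "fst p" "snd p"] lim[of "fst q" "snd q"] pq by (intro tendsto_intros) auto
      thus "dist (\<kappa> p) (\<kappa> q) \<le> L * dist p q" unfolding dist_real_def[of "\<kappa> p"]
        by (rule LIMSEQ_le_const2) (use uL[OF pq] in auto)
    qed
    have const: "\<kappa> (x, t) = c" if "(x, t) \<in> Q" "\<And>j. u j x t = c" for x t c
      using lim[OF that(1)] LIMSEQ_unique[OF _ tendsto_const] unfolding that(2) by fastforce
    show "\<kappa> (x, 0) = u0 x" if "x \<in> {0..1}" for x using that pos u_init by (intro const) (auto simp: Q_def)
    show "\<kappa> (0, t) = u0 0" "\<kappa> (1, t) = u0 1" if "t \<in> {0..T}" for t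
      using that u_fixed by (auto simp: Q_def intro!: const)
    show "integral {x..y} (\<lambda>z. v z t) \<le> \<kappa> (y, t) - \<kappa> (x, t)" if "0 \<le> x" "x \<le> y" "y \<le> 1" "t \<in> {0..T}" for x y t
    proof -
      define K where "K = 2 * (M + Lx) + t * (Cs + 2 * (Fm * (4 / \<epsilon>\<^sup>2) * Lv))"
      have ge: "integral {x..y} (\<lambda>z. v z t) - K * h j \<le> u j y t - u j x t" for j
        using upwind_scheme.sol_growth[OF loc[of j], where t = t and T = T and x = x and y = y] that
        unfolding K_def Lx_def u_def
        by (simp add: upwind_scheme.slope_rate_def[OF loc] upwind_scheme.err_def[OF loc]
            upwind_scheme.consistency_def[OF loc] algebra_simps)
      have "(\<lambda>n. u (k n) y t - u (k n) x t + K * h (k n)) \<longlonglongrightarrow> \<kappa> (y, t) - \<kappa> (x, t) + K * 0"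
        using that by (intro tendsto_intros lim hk) (auto simp: Q_def)
      hence "integral {x..y} (\<lambda>z. v z t) \<le> \<kappa> (y, t) - \<kappa> (x, t) + K * 0"
        by (rule LIMSEQ_le_const) (use ge in \<open>auto simp: algebra_simps\<close>)
      thus ?thesis by simp
    qed
    fix \<sigma> :: real and \<phi> D z and e :: real
    let ?U = "{0<..<1::real} \<times> {0<..<T}"
    assume \<sigma>: "\<sigma> = 1 \<or> \<sigma> = -1" and \<phi>: "\<forall>q \<in> ?U. (\<phi> has_derivative (\<lambda>h. D q \<bullet> h)) (at q)" and D: "continuous_on ?U D"
      and z: "z \<in> ?U" and e: "e > 0" and touch: "\<forall>q \<in> ball z e \<inter> ?U. \<sigma> * (\<kappa> q - \<phi> q) \<le> \<sigma> * (\<kappa> z - \<phi> z)"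
    have UQ: "?U \<subseteq> Q" by (auto simp: Q_def)
    show "\<sigma> * snd (D z) \<le> \<sigma> * (f (fst z) (snd z) * trunc_inv \<epsilon> (fst (D z)))"
    proof (rule upwind_limit_test[OF \<sigma> pos(2), of "\<lambda>n. h (k n)" "\<lambda>n. dt (k n)" ?U "\<lambda>n. u (k n)" \<kappa> f z \<phi> D e])
      show "open ?U" by (intro open_Times) auto
      show "\<exists>N. \<forall>j\<ge>N. \<forall>q\<in>?U. \<bar>u (k j) (fst q) (snd q) - \<kappa> q\<bar> < e" if "e > 0" for e
      proof -
        from \<kappa>(3)[OF that] obtain N where N: "\<And>n x. n \<ge> N \<Longrightarrow> x \<in> Q \<Longrightarrow> norm (u (k n) (fst x) (snd x) - \<kappa> x) < e" by blast
        thus ?thesis using UQ by (intro exI[of _ N]) auto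
      qed
      show "continuous_on ?U (\<lambda>q. u (k j) (fst q) (snd q))" for j
        by (rule lipschitz_on_continuous_on[of L], rule lipschitz_onI[OF _ L], unfold dist_real_def)
           (rule uL, use UQ in auto)
      show "isCont (\<lambda>q. f (fst q) (snd q)) z" using f_cont by (simp add: continuous_on_eq_continuous_at del: split_paired_All)
      fix j and t :: real assume "t > 0"
      interpret S: upwind_scheme f v \<epsilon> Fm Lf u0 L0 M Lv Cs "h (k j)" "dt (k j)" by (rule loc)
      obtain t' where t': "0 \<le> t'" "t' < t" "t - t' \<le> dt (k j)"
        and eq: "\<And>x. S.sol x t = S.step (t - t') t' (\<lambda>y. S.sol y t') x" using S.sol_step[OF \<open>t > 0\<close>] by blast
      show "\<exists>t'. 0 \<le> t' \<and> t' < t \<and> t - t' \<le> dt (k j) \<and>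
         (\<forall>x \<psi>. (\<forall>y\<in>{x - h (k j), x, x + h (k j)}. \<sigma> * u (k j) y t' \<le> \<sigma> * \<psi> y) \<longrightarrow>
            \<sigma> * u (k j) x t \<le> \<sigma> * (\<psi> x + (t - t') * upwind_op \<epsilon> f (h (k j)) t' \<psi> x))"
      proof (intro exI[of _ t'] conjI t' allI impI)
        fix x \<psi> assume le: "\<forall>y\<in>{x - h (k j), x, x + h (k j)}. \<sigma> * u (k j) y t' \<le> \<sigma> * \<psi> y"
        have "\<sigma> * S.step (t - t') t' (\<lambda>y. S.sol y t') x \<le> \<sigma> * S.step (t - t') t' \<psi> x"
          using \<sigma>
        proof
          assume "\<sigma> = 1"
          thus ?thesis using le t' by (auto simp: u_def intro!: S.step_mono)
        next
          assume "\<sigma> = -1"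
          thus ?thesis using le t' by (auto simp: u_def intro!: S.step_mono)
        qed
        thus "\<sigma> * u (k j) x t \<le> \<sigma> * (\<psi> x + (t - t') * upwind_op \<epsilon> f (h (k j)) t' \<psi> x)"
          unfolding u_def eq S.step_def[symmetric] .
      qed
    qed (use h hk dtk \<phi> D z e touch in auto)
  qed
qed

end

section \<open>The velocity field generated by the heat flow\<close>

lemma G_pos: "\<epsilon> > 0 \<Longrightarrow> G \<epsilon> y > 0"
  by (simp add: G_def add_nonneg_pos)

lemma G_ge: "\<epsilon> > 0 \<Longrightarrow> \<epsilon> \<le> G \<epsilon> y"
  unfolding G_def by (rule real_le_rsqrt) simp

lemma G_le: "\<epsilon> > 0 \<Longrightarrow> G \<epsilon> y \<le> \<bar>y\<bar> + \<epsilon>"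
  unfolding G_def using sqrt_sum_squares_le_sum_abs[of y \<epsilon>] by simp

lemma abs_le_G: "\<bar>y\<bar> \<le> G \<epsilon> y"
  unfolding G_def by (rule real_le_rsqrt) simp

lemma G_square: "(G \<epsilon> y)\<^sup>2 = y\<^sup>2 + \<epsilon>\<^sup>2"
  by (simp add: G_def)

lemma G_DERIV:
  assumes "\<epsilon> > 0" "(w has_real_derivative w') (at x)"
  shows "((\<lambda>x. G \<epsilon> (w x)) has_real_derivative w x * w' / G \<epsilon> (w x)) (at x)"
proof -
  have "(w x)\<^sup>2 + \<epsilon>\<^sup>2 > 0" using assms(1) by (simp add: add_nonneg_pos)
  thus ?thesis unfolding G_def
    by (auto intro!: derivative_eq_intros assms(2) simp: divide_simps)
qed

text \<open>With \<open>w = \<rho>\<^sub>x\<close>, \<open>w\<^sub>1 = w\<^sub>x\<close>, \<open>w\<^sub>2 = w\<^sub>x\<^sub>x\<close>, the flux \<open>w w\<^sub>1 / G w\<close> is the \<open>x\<close>-derivative of \<open>G w\<close>;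
  since \<open>G\<close> is convex, its own derivative dominates \<open>(G w)\<^sub>t\<close>, that is, \<open>G (\<rho>\<^sub>x)\<close> is a
  subsolution of the conservation law satisfied by \<open>\<kappa>\<^sub>x\<close>.\<close>

lemma G_flux_DERIV:
  assumes "\<epsilon> > 0" "(w has_real_derivative w1 x) (at x)" "(w1 has_real_derivative w2) (at x)"
  shows "\<exists>d \<ge> w x * w2 / G \<epsilon> (w x). ((\<lambda>x. w x * w1 x / G \<epsilon> (w x)) has_real_derivative d) (at x)"
proof -
  define g where "g = G \<epsilon> (w x)"
  have g: "g > 0" "g\<^sup>2 = (w x)\<^sup>2 + \<epsilon>\<^sup>2" using G_pos[OF assms(1)] G_square by (auto simp: g_def)
  have "((\<lambda>x. w x * w1 x / G \<epsilon> (w x)) has_real_derivative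
      ((w1 x * w1 x + w2 * w x) * g - (w x * w1 x) * (w x * w1 x / g)) / (g * g)) (at x)"
    unfolding g_def
    by (intro DERIV_divide DERIV_mult assms(2,3) G_DERIV[OF assms(1,2)]) (use g in \<open>simp add: g_def\<close>)
  \<comment> \<open>The excess is G''(w) w1^2, since G'' = \<epsilon>^2 / G^3; this is where
    convexity enters.\<close>
  moreover have "((w1 x * w1 x + w2 * w x) * g - (w x * w1 x) * (w x * w1 x / g)) / (g * g) - w x * w2 / g
      = (w1 x)\<^sup>2 * \<epsilon>\<^sup>2 / g ^ 3"
  proof -
    have "((w1 x * w1 x + w2 * w x) * g - (w x * w1 x) * (w x * w1 x / g)) / (g * g) - w x * w2 / g
      = (w1 x)\<^sup>2 * (g\<^sup>2 - (w x)\<^sup>2) / g ^ 3"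
      using g(1) by (simp add: field_simps power2_eq_square power3_eq_cube)
    thus ?thesis using g(2) by simp
  qed
  moreover have "(w1 x)\<^sup>2 * \<epsilon>\<^sup>2 / g ^ 3 \<ge> 0" using g(1) by simp
  ultimately show ?thesis unfolding g_def[symmetric]
    by (intro exI[of _ "((w1 x * w1 x + w2 * w x) * g - (w x * w1 x) * (w x * w1 x / g)) / (g * g)"]) linarith
qed

lemma abs_mult_le:
  fixes a b :: real
  assumes "\<bar>a\<bar> \<le> A" "\<bar>b\<bar> \<le> B"
  shows "\<bar>a * b\<bar> \<le> A * B"
  unfolding abs_mult using assms by (intro mult_mono) (auto intro: order_trans[OF abs_ge_zero])

lemma mean_value_DERIV:
  fixes f :: "real \<Rightarrow> real"
  assumes "a < b" "continuous_on {a..b} f" and d: "\<And>x. a < x \<Longrightarrow> x < b \<Longrightarrow> (f has_real_derivative f' x) (at x)"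
  obtains z where "a < z" "z < b" "f b - f a = (b - a) * f' z"
proof -
  obtain l z where z: "a < z" "z < b" "(f has_real_derivative l) (at z)" "f b - f a = (b - a) * l"
    using MVT[OF assms(1,2)] d by (meson real_differentiable_def)
  have "l = f' z" by (rule DERIV_unique[OF z(3) d[OF z(1,2)]])
  thus ?thesis using z that by blast
qed

text \<open>\<open>w\<close> is \<rho>_x continued to the line and \<open>w1\<close>,
  \<open>w2\<close>, \<open>w3\<close> its space derivatives; by the heat equation \<open>w2\<close>
  and \<open>w3\<close> are the time derivatives of \<open>w\<close> and \<open>w1\<close>.\<close>

locale heat_gradient =
  fixes w w1 w2 w3 :: "real \<Rightarrow> real \<Rightarrow> real" and c0 c1 c2 c3 \<epsilon> :: real
  assumes eps: "\<epsilon> > 0"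
    and wx: "\<And>x t. ((\<lambda>x. w x t) has_real_derivative w1 x t) (at x)" "\<And>x t. ((\<lambda>x. w1 x t) has_real_derivative w2 x t) (at x)"
    and wt: "\<And>x t. t > 0 \<Longrightarrow> (w x has_real_derivative w2 x t) (at t)" "\<And>x t. t > 0 \<Longrightarrow> (w1 x has_real_derivative w3 x t) (at t)"
    and wC: "\<And>x t. \<bar>w x t\<bar> \<le> c0" "\<And>x t. \<bar>w1 x t\<bar> \<le> c1" "\<And>x t. \<bar>w2 x t\<bar> \<le> c2" "\<And>x t. \<bar>w3 x t\<bar> \<le> c3"
    and w_cont: "continuous_on UNIV (\<lambda>p. w (fst p) (snd p))" "continuous_on UNIV (\<lambda>p. w1 (fst p) (snd p))"
      "continuous_on UNIV (\<lambda>p. w2 (fst p) (snd p))"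
begin

text \<open>This is \<rho>_t \<rho>_x, because \<rho>_t = \<rho>_xx.\<close>

definition flux :: "real \<Rightarrow> real \<Rightarrow> real" where "flux x t = w1 x t * w x t"

definition vel :: "real \<Rightarrow> real \<Rightarrow> real" where "vel x t = G \<epsilon> (w x t)"

lemma c_nonneg: "c0 \<ge> 0" "c1 \<ge> 0" "c2 \<ge> 0" "c3 \<ge> 0"
  using wC[of 0 0] by (auto intro: order_trans[OF abs_ge_zero])

lemma cont_w:
  assumes "continuous_on S f" "continuous_on S g"
  shows "continuous_on S (\<lambda>x. w (f x) (g x))" "continuous_on S (\<lambda>x. w1 (f x) (g x))" "continuous_on S (\<lambda>x. w2 (f x) (g x))"
  using continuous_on_compose2[OF w_cont(1) continuous_on_Pair[OF assms]] continuous_on_compose2[OF w_cont(2) continuous_on_Pair[OF assms]]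
    continuous_on_compose2[OF w_cont(3) continuous_on_Pair[OF assms]] by simp_all

lemma flux_bound: "\<bar>flux x t\<bar> \<le> c1 * c0"
  unfolding flux_def by (intro abs_mult_le wC)

lemma flux_cont: "continuous_on S (\<lambda>q. flux (fst q) (snd q))"
  unfolding flux_def by (intro continuous_intros cont_w)

lemma flux_lipschitz: "\<bar>flux x t - flux y t\<bar> \<le> (c2 * c0 + c1 * c1) * \<bar>x - y\<bar>"
proof (rule lipschitz_of_bounded_deriv)
  show "((\<lambda>x. flux x t) has_real_derivative w2 x t * w x t + w1 x t * w1 x t) (at x)" for x
    unfolding flux_def by (auto intro!: derivative_eq_intros wx)
  show "\<bar>w2 x t * w x t + w1 x t * w1 x t\<bar> \<le> c2 * c0 + c1 * c1" for x
    using abs_mult_le[OF wC(3)[of x t] wC(1)[of x t]] abs_mult_le[OF wC(2)[of x t] wC(2)[of x t]] by linarith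
qed

lemma vel_bounds: "\<epsilon> \<le> vel x t" "vel x t \<le> c0 + \<epsilon>"
  using G_ge[OF eps] G_le[OF eps, of "w x t"] wC(1)[of x t] by (auto simp: vel_def)

lemma vel_pos: "vel x t > 0"
  using vel_bounds eps by (meson less_le_trans)

lemma vel_nonzero: "vel x t \<noteq> 0"
  using vel_pos[of x t] by simp

lemma vel_DERIV_x: "((\<lambda>x. vel x t) has_real_derivative flux x t / vel x t) (at x)"
  using G_DERIV[OF eps wx(1)[of t x]] by (simp add: vel_def flux_def mult.commute)

lemma vel_DERIV_t: "t > 0 \<Longrightarrow> (vel x has_real_derivative w x t * w2 x t / vel x t) (at t)"
  using G_DERIV[OF eps wt(1)[of t x]] by (simp add: vel_def[abs_def])

lemma vel_cont: "continuous_on S f \<Longrightarrow> continuous_on S g \<Longrightarrow> continuous_on S (\<lambda>x. vel (f x) (g x))"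
  unfolding vel_def G_def by (intro continuous_intros cont_w)

lemma vel_lipschitz: "\<bar>vel x t - vel y t\<bar> \<le> c1 * \<bar>x - y\<bar>"
proof (rule lipschitz_of_bounded_deriv[OF vel_DERIV_x])
  fix x
  have "\<bar>w1 x t\<bar> * \<bar>w x t\<bar> \<le> c1 * vel x t"
    unfolding vel_def using c_nonneg wC abs_le_G by (intro mult_mono) auto
  thus "\<bar>flux x t / vel x t\<bar> \<le> c1" using vel_pos[of x t] by (simp add: flux_def abs_mult divide_le_eq)
qed

text \<open>Bound from the quotient rule for the time derivative of flux / vel, with
  \<open>vel\<close> between \<epsilon> and c0 + \<epsilon>.\<close>

definition flux_rate :: real where
  "flux_rate = ((c3 * c0 + c1 * c2) * (c0 + \<epsilon>) + (c1 * c0) * c2) / (\<epsilon> * \<epsilon>)"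

lemma flux_rate_nonneg: "flux_rate \<ge> 0"
  unfolding flux_rate_def using eps c_nonneg by (intro divide_nonneg_pos add_nonneg_nonneg mult_nonneg_nonneg) auto

lemma flux_vel_lipschitz_t:
  assumes "0 \<le> s" "s \<le> t"
  shows "\<bar>flux x t / vel x t - flux x s / vel x s\<bar> \<le> flux_rate * (t - s)"
proof (cases "s < t")
  case True
  define B' where "B' t = ((w3 x t * w x t + w2 x t * w1 x t) * vel x t - flux x t * (w x t * w2 x t / vel x t)) / (vel x t * vel x t)" for t
  have cB: "continuous_on {s..t} (\<lambda>t. flux x t / vel x t)"
    unfolding flux_def using vel_nonzero by (intro continuous_intros cont_w vel_cont) auto
  have dB: "((\<lambda>t. flux x t / vel x t) has_real_derivative B' m) (at m)" if "s < m" "m < t" for m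
  proof -
    have "m > 0" using assms that by simp
    have "((\<lambda>t. flux x t) has_real_derivative w3 x m * w x m + w2 x m * w1 x m) (at m)"
      unfolding flux_def by (intro DERIV_mult wt \<open>m > 0\<close>)
    from DERIV_divide[OF this vel_DERIV_t[OF \<open>m > 0\<close>]]
    have "((\<lambda>t. flux x t / vel x t) has_real_derivative B' m) (at m)"
      unfolding B'_def using vel_pos[of x m] by simp
    thus ?thesis .
  qed
  obtain m where m: "s < m" "m < t" "flux x t / vel x t - flux x s / vel x s = (t - s) * B' m"
    by (rule mean_value_DERIV[OF True cB dB])
  have "\<bar>B' m\<bar> \<le> flux_rate"
  proof -
    have v: "\<epsilon> \<le> vel x m" "vel x m > 0" "vel x m \<le> c0 + \<epsilon>" using vel_bounds vel_pos by auto
    have "\<bar>w x m * w2 x m\<bar> \<le> vel x m * c2"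
      unfolding vel_def by (rule abs_mult_le[OF abs_le_G wC(3)])
    hence q: "\<bar>w x m * w2 x m / vel x m\<bar> \<le> c2" using v(2) by (simp add: abs_divide divide_le_eq mult.commute)
    have "\<bar>w3 x m * w x m + w2 x m * w1 x m\<bar> \<le> c3 * c0 + c1 * c2"
      using abs_mult_le[OF wC(4)[of x m] wC(1)[of x m]] abs_mult_le[OF wC(3)[of x m] wC(2)[of x m]] by (simp add: mult.commute)
    hence 1: "\<bar>(w3 x m * w x m + w2 x m * w1 x m) * vel x m\<bar> \<le> (c3 * c0 + c1 * c2) * (c0 + \<epsilon>)"
      by (rule abs_mult_le) (use v in simp)
    have 2: "\<bar>flux x m * (w x m * w2 x m / vel x m)\<bar> \<le> (c1 * c0) * c2"
      by (rule abs_mult_le[OF flux_bound q])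
    define N where "N = (w3 x m * w x m + w2 x m * w1 x m) * vel x m - flux x m * (w x m * w2 x m / vel x m)"
    have N: "\<bar>N\<bar> \<le> (c3 * c0 + c1 * c2) * (c0 + \<epsilon>) + (c1 * c0) * c2" unfolding N_def using 1 2 by linarith
    have "\<bar>B' m\<bar> = \<bar>N\<bar> / (vel x m * vel x m)" unfolding B'_def N_def abs_divide by simp
    also have "\<dots> \<le> ((c3 * c0 + c1 * c2) * (c0 + \<epsilon>) + (c1 * c0) * c2) / (\<epsilon> * \<epsilon>)"
      by (rule frac_le[OF _ N _ mult_mono]) (use N v eps in auto)
    finally show ?thesis by (simp add: flux_rate_def)
  qed
  thus ?thesis unfolding m(3) using True by (simp add: abs_mult mult.commute mult_right_mono)
qed (use assms in simp)

text \<open>By the mean value theorem the increment is s times the time derivative of the integral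
  at some m, and integrating \<open>G_flux_DERIV\<close> bounds this by the flux difference at time
  m. Returning to time t costs \<open>flux_rate * s\<close> at each endpoint, whence the factor
  2.\<close>

lemma vel_subsolution:
  assumes xy: "x \<le> y" and s: "0 \<le> s" and t: "0 \<le> t"
  shows "integral {x..y} (\<lambda>z. vel z (t + s)) - integral {x..y} (\<lambda>z. vel z t)
     \<le> s * (flux y t / vel y t - flux x t / vel x t) + 2 * flux_rate * s\<^sup>2"
proof (cases "s > 0")
  case True
  define \<theta> where "\<theta> r = integral {x..y} (\<lambda>z. vel z r)" for r
  define \<theta>' where "\<theta>' r = integral {x..y} (\<lambda>z. w z r * w2 z r / vel z r)" for r
  have d: "(\<theta> has_real_derivative \<theta>' r) (at r)" if "r > 0" for r
  proof -
    have "((\<lambda>r. integral (cbox x y) (\<lambda>z. vel z r)) has_real_derivative integral (cbox x y) (\<lambda>z. w z r * w2 z r / vel z r)) (at r within {0<..})"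
    proof (rule leibniz_rule_field_derivative)
      show "((\<lambda>r. vel z r) has_real_derivative w z r * w2 z r / vel z r) (at r within {0<..})" if "r \<in> {0<..}" for r z
        using vel_DERIV_t[of r z] that by (auto intro: has_field_derivative_at_within)
      show "(\<lambda>z. vel z r) integrable_on cbox x y" for r
        by (intro integrable_continuous vel_cont continuous_intros)
      show "continuous_on ({0<..} \<times> cbox x y) (\<lambda>(r, z). w z r * w2 z r / vel z r)"
        unfolding split_beta by (intro continuous_intros cont_w vel_cont) (simp add: vel_nonzero)
    qed (use that in auto)
    thus ?thesis using at_within_open[of r "{0<..}"] that by (simp add: \<theta>_def[abs_def] \<theta>'_def)
  qed
  have c: "continuous_on {t..t + s} \<theta>"
    using integral_continuous_on_param[of "{t..t + s}" x y "\<lambda>r z. vel z r"]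
    by (simp add: \<theta>_def[abs_def] split_beta vel_cont continuous_intros)
  have le: "\<theta>' r \<le> flux y r / vel y r - flux x r / vel x r" for r
  proof -
    have "\<forall>z. \<exists>d \<ge> w z r * w2 z r / vel z r. ((\<lambda>z. flux z r / vel z r) has_real_derivative d) (at z)"
      using G_flux_DERIV[OF eps wx(1)[of r] wx(2)[of r]] unfolding flux_def vel_def by (simp add: mult.commute)
    then obtain b where b: "\<And>z. w z r * w2 z r / vel z r \<le> b z" "\<And>z. ((\<lambda>z. flux z r / vel z r) has_real_derivative b z) (at z)"
      by metis
    have b_int: "(b has_integral (flux y r / vel y r - flux x r / vel x r)) {x..y}"
      by (rule fundamental_theorem_of_calculus[OF xy])
         (auto simp: has_real_derivative_iff_has_vector_derivative[symmetric] intro: has_field_derivative_at_within b)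
    have "((\<lambda>z. w z r * w2 z r / vel z r) has_integral \<theta>' r) {x..y}"
      unfolding \<theta>'_def by (intro integrable_integral integrable_continuous_real continuous_intros cont_w vel_cont) (simp add: vel_nonzero)
    from has_integral_le[OF this b_int b(1)] show ?thesis .
  qed
  have ts: "t < t + s" using True by simp
  obtain m where m: "t < m" "m < t + s" "\<theta> (t + s) - \<theta> t = (t + s - t) * \<theta>' m"
    by (rule mean_value_DERIV[OF ts c d]) (use t in simp)
  have R: "flux_rate * (m - t) \<le> flux_rate * s" using m flux_rate_nonneg by (intro mult_left_mono) auto
  have "\<theta>' m \<le> flux y t / vel y t - flux x t / vel x t + 2 * flux_rate * s"
  proof -
    have "\<bar>flux a m / vel a m - flux a t / vel a t\<bar> \<le> flux_rate * s" for a
      using flux_vel_lipschitz_t[OF t, of m a] m(1) R by linarith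
    from this[of x] this[of y] le[of m] show ?thesis by (simp only: abs_le_iff) linarith
  qed
  from mult_left_mono[OF this s]
  have "\<theta> (t + s) - \<theta> t \<le> s * (flux y t / vel y t - flux x t / vel x t) + 2 * flux_rate * s\<^sup>2"
    unfolding m(3) by (simp add: power2_eq_square distrib_left mult.left_commute)
  thus ?thesis unfolding \<theta>_def .
qed (use s in simp)

end

section \<open>The gradient condition on the initial datum in integrated form\<close>

definition clip :: "real \<Rightarrow> real \<Rightarrow> real" where "clip b x = max 0 (min b x)"

lemma clip_lipschitz: "\<bar>clip b x - clip b y\<bar> \<le> \<bar>x - y\<bar>"
  by (auto simp: clip_def max_def min_def)

lemma clip_in: "b \<ge> 0 \<Longrightarrow> clip b x \<in> {0..b}"
  by (auto simp: clip_def)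

lemma clip_id: "x \<in> {0..b} \<Longrightarrow> clip b x = x"
  by (auto simp: clip_def)

text \<open>Outside [0, 1] the datum is continued with slope \<open>M\<close>, an upper bound of
  \<open>v\<close>, so the inequality is immediate there. Inside, \<open>\<kappa>0\<close> minus the
  primitive of \<open>v\<close> is Lipschitz with a.e. nonnegative derivative.\<close>

lemma initial_growth:
  fixes \<kappa>0 v :: "real \<Rightarrow> real"
  assumes L: "\<And>x y. x \<in> {0..1} \<Longrightarrow> y \<in> {0..1} \<Longrightarrow> \<bar>\<kappa>0 x - \<kappa>0 y\<bar> \<le> L * \<bar>x - y\<bar>"
    and v: "continuous_on UNIV v" "\<And>x. v x \<le> M" "\<And>x. 0 \<le> v x"
    and AE: "AE x in lebesgue. x \<in> {0<..<1} \<longrightarrow> (\<exists>d. (\<kappa>0 has_real_derivative d) (at x) \<and> d \<ge> v x)"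
    and xy: "x \<le> y"
  shows "integral {x..y} v \<le> (\<kappa>0 (clip 1 y) + M * (y - clip 1 y)) - (\<kappa>0 (clip 1 x) + M * (x - clip 1 x))"
proof -
  define u where "u x = \<kappa>0 (clip 1 x) + M * (x - clip 1 x)" for x
  have int: "v integrable_on {a..b}" for a b
    by (intro integrable_continuous_real continuous_on_subset[OF v(1)]) simp
  have upper: "integral {a..b} v \<le> M * (b - a)" if "a \<le> b" for a b
  proof -
    have "integral {a..b} v \<le> integral {a..b} (\<lambda>_. M)" by (intro integral_le int integrable_const_ivl v)
    thus ?thesis using that by (simp add: mult.commute)
  qed
  have lower: "0 \<le> integral {a..b} v" for a b using v int by (intro integral_nonneg) auto
  have split: "integral {a..c} v = integral {a..b} v + integral {b..c} v" if "a \<le> b" "b \<le> c" for a b c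
    using Henstock_Kurzweil_Integration.integral_combine[OF that int] by simp
  have M: "M \<ge> 0" using v(2,3)[of 0] by linarith
  have left: "integral {x..y} v \<le> u y - u x" if "x \<le> y" "y \<le> 0" for x y
    using upper[OF that(1)] that by (simp add: u_def clip_def algebra_simps)
  have right: "integral {x..y} v \<le> u y - u x" if "x \<le> y" "1 \<le> x" for x y
    using upper[OF that(1)] that by (simp add: u_def clip_def algebra_simps)
  have mid: "integral {x..y} v \<le> u y - u x" if "x \<le> y" "0 \<le> x" "y \<le> 1" for x y
  proof -
    have "\<kappa>0 x - integral {x..x} v \<le> \<kappa>0 y - integral {x..y} v"
    proof (rule nondecreasing_if_AE_deriv_nonneg[OF that(1), where L' = "L + M"])
      fix p q assume "p \<in> {x..y}" "q \<in> {x..y}"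
      hence *: "\<bar>\<kappa>0 p - \<kappa>0 q\<bar> \<le> L * \<bar>p - q\<bar>" using that by (intro L) auto
      have "\<bar>integral {x..p} v - integral {x..q} v\<bar> \<le> M * \<bar>p - q\<bar>"
      proof (cases "p \<le> q")
        case True
        thus ?thesis using split[of x p q] upper[of p q] lower[of p q] \<open>p \<in> _\<close> by (simp add: algebra_simps)
      next
        case False
        thus ?thesis using split[of x q p] upper[of q p] lower[of q p] \<open>q \<in> _\<close> by (simp add: algebra_simps)
      qed
      thus "\<bar>\<kappa>0 p - integral {x..p} v - (\<kappa>0 q - integral {x..q} v)\<bar> \<le> (L + M) * \<bar>p - q\<bar>"
        using * by (simp add: distrib_right)
    next
      show "AE z in lebesgue. z \<in> {x<..<y} \<longrightarrow> (\<exists>d\<ge>0. ((\<lambda>p. \<kappa>0 p - integral {x..p} v) has_real_derivative d) (at z))"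
        using AE
      proof (rule eventually_mono, intro impI)
        fix z assume z: "z \<in> {0<..<1} \<longrightarrow> (\<exists>d. (\<kappa>0 has_real_derivative d) (at z) \<and> d \<ge> v z)" "z \<in> {x<..<y}"
        have "z \<in> {0<..<1}" using z(2) that by auto
        then obtain d where d: "(\<kappa>0 has_real_derivative d) (at z)" "d \<ge> v z" using z(1) by blast
        have "((\<lambda>p. integral {x..p} v) has_real_derivative v z) (at z within {x..y})"
          using z by (intro integral_has_real_derivative continuous_on_subset[OF v(1)]) auto
        moreover have "at z within {x..y} = at z"
          using z(2) by (intro at_within_interior) auto
        ultimately have "((\<lambda>p. integral {x..p} v) has_real_derivative v z) (at z)" by simp
        from DERIV_diff[OF d(1) this]
        show "\<exists>d\<ge>0. ((\<lambda>p. \<kappa>0 p - integral {x..p} v) has_real_derivative d) (at z)"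
          using d(2) by (intro exI[of _ "d - v z"]) auto
      qed
    qed
    thus ?thesis using that by (simp add: u_def clip_id)
  qed
  have "integral {x..y} v \<le> u y - u x"
  proof (cases "x < 0")
    case True
    show ?thesis
    proof (cases "y \<le> 0")
      case y: False
      have "integral {x..0} v \<le> u 0 - u x" using True by (intro left) auto
      moreover have "integral {0..y} v \<le> u y - u 0"
      proof (cases "y \<le> 1")
        case False
        thus ?thesis using split[of 0 1 y] mid[of 0 1] right[of 1 y] by simp
      qed (use mid y in auto)
      ultimately show ?thesis using split[of x 0 y] True y by simp
    qed (use left xy in auto)
  next
    case False
    show ?thesis
    proof (cases "1 \<le> x")
      case x: False
      show ?thesis
      proof (cases "y \<le> 1")
        case y: False
        thus ?thesis using split[of x 1 y] mid[of x 1] right[of 1 y] x False by simp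
      qed (use mid False xy in auto)
    qed (use right xy in auto)
  qed
  thus ?thesis by (simp add: u_def)
qed

section \<open>Existence and uniqueness\<close>

text \<open>Clipping both arguments extends \<kappa> to the plane, so its x-derivative exists almost
  everywhere. Where it exists, the growth over short intervals and the continuity of
  \<open>v\<close> bound it below by \<open>v\<close>.\<close>

lemma grad_constraint_if_growth:
  fixes \<kappa> :: "real \<times> real \<Rightarrow> real" and v :: "real \<Rightarrow> real \<Rightarrow> real"
  assumes T: "T > 0" and lip: "L-lipschitz_on ({0..1} \<times> {0..T}) \<kappa>"
    and growth: "\<And>x y t. 0 \<le> x \<Longrightarrow> x \<le> y \<Longrightarrow> y \<le> 1 \<Longrightarrow> t \<in> {0..T} \<Longrightarrow> integral {x..y} (\<lambda>z. v z t) \<le> \<kappa> (y, t) - \<kappa> (x, t)"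
    and v: "\<And>t. continuous_on UNIV (\<lambda>z. v z t)"
    and v_eq: "\<And>x t. 0 < x \<Longrightarrow> x < 1 \<Longrightarrow> 0 < t \<Longrightarrow> G \<epsilon> (px \<rho> (x, t)) = v x t"
  shows "grad_constraint \<epsilon> T \<rho> \<kappa>"
proof -
  define K where "K p = \<kappa> (clip 1 (fst p), clip T (snd p))" for p
  have L0: "L \<ge> 0" by (rule lipschitz_on_nonneg[OF lip])
  have clip_Q: "(clip 1 x, clip T t) \<in> {0..1} \<times> {0..T}" for x t using clip_in[of 1 x] clip_in[of T t] T by simp
  have cont_clip: "continuous_on UNIV (clip b)" for b
    by (rule lipschitz_on_continuous_on[of 1], rule lipschitz_onI) (use clip_lipschitz in \<open>auto simp: dist_real_def\<close>)
  have cK: "continuous_on UNIV K"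
    unfolding K_def
    by (rule continuous_on_compose2[OF lipschitz_on_continuous_on[OF lip]])
       (use clip_Q in \<open>auto intro!: continuous_intros continuous_on_compose2[OF cont_clip]\<close>)
  have LK: "\<bar>K (x, t) - K (y, t)\<bar> \<le> L * \<bar>x - y\<bar>" for x y t
  proof -
    have "\<bar>K (x, t) - K (y, t)\<bar> \<le> L * \<bar>clip 1 x - clip 1 y\<bar>"
      using lipschitz_onD[OF lip clip_Q[of x t] clip_Q[of y t]] by (simp add: K_def dist_real_def dist_Pair_Pair)
    also have "\<dots> \<le> L * \<bar>x - y\<bar>" by (intro mult_left_mono clip_lipschitz L0)
    finally show ?thesis .
  qed
  have "AE p in lebesgue. \<exists>d. ((\<lambda>y. K (y, snd p)) has_real_derivative d) (at (fst p))"
    by (rule AE_partial_derivative[OF cK LK])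
  thus ?thesis unfolding grad_constraint_def
  proof (rule eventually_mono, intro impI)
    fix p assume ex: "\<exists>d. ((\<lambda>y. K (y, snd p)) has_real_derivative d) (at (fst p))" and p: "p \<in> {0<..<1} \<times> {0<..<T}"
    obtain x t where pe: "p = (x, t)" by (cases p)
    have xt: "0 < x" "x < 1" "0 < t" "t < T" using p by (auto simp: pe)
    obtain d where "((\<lambda>y. K (y, t)) has_real_derivative d) (at x)" using ex by (auto simp: pe)
    hence d: "((\<lambda>y. \<kappa> (y, t)) has_real_derivative d) (at x)"
      by (rule has_field_derivative_transform_within_open[where S = "{0<..<1}"]) (use xt in \<open>auto simp: K_def clip_id\<close>)
    have "v x t \<le> d"
    proof (rule ccontr)
      assume "\<not> v x t \<le> d"
      define c where "c = (v x t + d) / 2"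
      have c: "d < c" "c < v x t" using \<open>\<not> v x t \<le> d\<close> by (auto simp: c_def)
      have "((\<lambda>y. \<kappa> (y, t) - c * y) has_real_derivative d - c) (at x)" by (auto intro!: derivative_eq_intros d)
      from DERIV_neg_dec_right[OF this] c
      obtain e1 where e1: "e1 > 0" "\<And>h. 0 < h \<Longrightarrow> h < e1 \<Longrightarrow> \<kappa> (x + h, t) - c * (x + h) < \<kappa> (x, t) - c * x" by auto
      have "isCont (\<lambda>z. v z t) x" using v by (simp add: continuous_on_eq_continuous_at)
      hence "\<forall>\<^sub>F z in at x. v z t > c" using order_tendstoD(1)[of "\<lambda>z. v z t" "v x t" "at x" c] c by (simp add: isCont_def)
      then obtain e2 where e2: "e2 > 0" "\<And>z. z \<noteq> x \<Longrightarrow> \<bar>z - x\<bar> < e2 \<Longrightarrow> v z t > c"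
        unfolding eventually_at by (auto simp: dist_real_def)
      define h where "h = Min {e1, e2, 1 - x} / 2"
      have h: "h > 0" "h < e1" "h < e2" "h < 1 - x" using e1(1) e2(1) xt by (auto simp: h_def)
      have "c * h \<le> integral {x..x + h} (\<lambda>z. v z t)"
      proof -
        have "integral {x..x + h} (\<lambda>_. c) \<le> integral {x..x + h} (\<lambda>z. v z t)"
        proof (intro integral_le integrable_const_ivl integrable_continuous_real continuous_on_subset[OF v])
          fix z assume "z \<in> {x..x + h}"
          thus "c \<le> v z t" using e2(2)[of z] h c by (cases "z = x") auto
        qed simp
        thus ?thesis using h by (simp add: mult.commute)
      qed
      also have "\<dots> \<le> \<kappa> (x + h, t) - \<kappa> (x, t)" using xt h by (intro growth) auto
      finally show False using e1(2)[OF h(1,2)] by (simp add: algebra_simps)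
    qed
    thus "\<exists>d. ((\<lambda>y. \<kappa> (y, snd p)) has_real_derivative d) (at (fst p)) \<and> d \<ge> G \<epsilon> (px \<rho> p)"
      using d v_eq xt by (auto simp: pe)
  qed
qed

theorem theorem5p1:
  fixes T \<epsilon> :: real and \<kappa>0 \<rho>0 :: "real \<Rightarrow> real" and \<rho> :: "real \<times> real \<Rightarrow> real"
  assumes "T > 0" and "\<epsilon> > 0"
    and "\<exists>L. L-lipschitz_on {0..1} \<kappa>0"
    and "smooth_compact_I \<rho>0"
    and "AE x in lebesgue. x \<in> {0<..<1} \<longrightarrow>
           (\<exists>d. (\<kappa>0 has_real_derivative d) (at x) \<and> d \<ge> G \<epsilon> (deriv \<rho>0 x))"
    and "heat_solution \<rho>0 \<rho>"
  shows "\<exists>\<kappa>. (\<exists>L. L-lipschitz_on ({0..1} \<times> {0..T}) \<kappa>) \<and>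
             visc_dirichlet T \<rho> \<kappa>0 \<kappa> \<and> grad_constraint \<epsilon> T \<rho> \<kappa> \<and>
             (\<forall>\<kappa>'. visc_dirichlet T \<rho> \<kappa>0 \<kappa>' \<and> grad_constraint \<epsilon> T \<rho> \<kappa>' \<longrightarrow>
                 (\<forall>p \<in> {0..1} \<times> {0..T}. \<kappa>' p = \<kappa> p))"
proof -
  obtain r :: "nat \<Rightarrow> real \<Rightarrow> real \<Rightarrow> real" and C where
    rx: "\<And>k x t. ((\<lambda>x. r k x t) has_real_derivative r (Suc k) x t) (at x)"
    and rt: "\<And>k x t. t > 0 \<Longrightarrow> (r k x has_real_derivative r (k + 2) x t) (at t)"
    and rC: "\<And>k x t. \<bar>r k x t\<bar> \<le> C k"
    and rc: "\<And>k. continuous_on UNIV (\<lambda>p. r k (fst p) (snd p))"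
    and r0: "\<And>k x. x \<in> {0..<1} \<Longrightarrow> r k x 0 = (deriv ^^ k) \<rho>0 x"
    and rb: "\<And>k t n. even k \<Longrightarrow> r k (of_int n) t = 0"
    using smooth_heat_extension[OF assms(4)] by blast
  have rb01: "r k 0 t = 0" "r k 1 t = 0" if "even k" for k t using rb[OF that, of 0] rb[OF that, of 1] by simp_all
  have \<rho>01: "\<rho>0 1 = 0" using assms(4) unfolding smooth_compact_I_def by auto
  have r00: "r 0 x 0 = \<rho>0 x" if "x \<in> {0..1}" for x
    using that r0[of x 0] rb01(2)[of 0 0] \<rho>01 by (cases "x = 1") auto
  note \<rho>_eq = heat_solution_unique[OF assms(6) rx rt rc r00 rb01(1)[OF even_zero] rb01(2)[OF even_zero]]
  \<comment> \<open>Thus \<open>w\<close> = \<rho>_x, and \<open>w1\<close> = \<rho>_xx = \<rho>_t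
    has even order, so it vanishes at x = 0 and x = 1.\<close>
  define w w1 w2 w3 where "w = r 1" and "w1 = r 2" and "w2 = r 3" and "w3 = r 4"
  have \<rho>_partials: "px \<rho> (x, t) = w x t" "pt \<rho> (x, t) = w1 x t" if "0 < x" "x < 1" "0 < t" for x t
    using heat_solution_partials[OF \<rho>_eq rx rt that] by (simp_all add: w_def w1_def)
  have w_init: "w x 0 = deriv \<rho>0 x" if "x \<in> {0..<1}" for x using r0[OF that, of 1] by (simp add: w_def)
  have w1_bd: "w1 0 t = 0" "w1 1 t = 0" for t using rb01[of 2] by (simp_all add: w1_def)
  interpret heat_gradient w w1 w2 w3 "C 1" "C 2" "C 3" "C 4" \<epsilon>
  proof unfold_locales
    show "((\<lambda>x. w x t) has_real_derivative w1 x t) (at x)" "((\<lambda>x. w1 x t) has_real_derivative w2 x t) (at x)" for x t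
      using rx[of 1 t x] rx[of 2 t x] by (simp_all add: w_def w1_def w2_def numeral_2_eq_2 numeral_3_eq_3)
    show "(w x has_real_derivative w2 x t) (at t)" "(w1 x has_real_derivative w3 x t) (at t)" if "t > 0" for x t
      using rt[OF that, of 1 x] rt[OF that, of 2 x] by (simp_all add: w_def w1_def w2_def w3_def eval_nat_numeral)
  qed (use assms(2) rC rc in \<open>auto simp: w_def w1_def w2_def w3_def\<close>)
  obtain L\<kappa> where L\<kappa>: "L\<kappa>-lipschitz_on {0..1} \<kappa>0" using assms(3) by blast
  have L\<kappa>0: "L\<kappa> \<ge> 0" by (rule lipschitz_on_nonneg[OF L\<kappa>])
  have \<kappa>0_lip: "\<bar>\<kappa>0 x - \<kappa>0 y\<bar> \<le> L\<kappa> * \<bar>x - y\<bar>" if "x \<in> {0..1}" "y \<in> {0..1}" for x y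
    using lipschitz_onD[OF L\<kappa> that] by (simp add: dist_real_def)
  define M where "M = C 1 + \<epsilon>"
  have M: "M \<ge> 0" using c_nonneg assms(2) by (simp add: M_def)
  define u0 where "u0 x = \<kappa>0 (clip 1 x) + M * (x - clip 1 x)" for x
  have u0: "u0 x = \<kappa>0 x" if "x \<in> {0..1}" for x using that by (simp add: u0_def clip_id)
  have u0_lip: "\<bar>u0 x - u0 y\<bar> \<le> (L\<kappa> + M) * \<bar>x - y\<bar>" for x y
  proof -
    have "\<bar>\<kappa>0 (clip 1 x) - \<kappa>0 (clip 1 y)\<bar> \<le> L\<kappa> * \<bar>clip 1 x - clip 1 y\<bar>" by (intro \<kappa>0_lip clip_in) auto
    also have "\<dots> \<le> L\<kappa> * \<bar>x - y\<bar>" by (intro mult_left_mono clip_lipschitz L\<kappa>0)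
    finally have 1: "\<bar>\<kappa>0 (clip 1 x) - \<kappa>0 (clip 1 y)\<bar> \<le> L\<kappa> * \<bar>x - y\<bar>" .
    have "\<bar>(x - clip 1 x) - (y - clip 1 y)\<bar> \<le> \<bar>x - y\<bar>" by (auto simp: clip_def max_def min_def)
    hence 2: "\<bar>M * ((x - clip 1 x) - (y - clip 1 y))\<bar> \<le> M * \<bar>x - y\<bar>"
      unfolding abs_mult using M by (simp add: mult_left_mono)
    have "u0 x - u0 y = (\<kappa>0 (clip 1 x) - \<kappa>0 (clip 1 y)) + M * ((x - clip 1 x) - (y - clip 1 y))"
      by (simp add: u0_def algebra_simps)
    thus ?thesis using 1 2 by (simp add: distrib_right)
  qed
  have vel_cont': "continuous_on UNIV (\<lambda>z. vel z t)" for t by (intro vel_cont continuous_intros)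
  have growth0: "integral {x..y} (\<lambda>z. vel z 0) \<le> u0 y - u0 x" if "x \<le> y" for x y
    unfolding u0_def
  proof (rule initial_growth[OF \<kappa>0_lip vel_cont' _ _ _ that])
    show "vel x 0 \<le> M" "0 \<le> vel x 0" for x using vel_bounds(2) vel_pos[of x 0] by (auto simp: M_def)
    show "AE x in lebesgue. x \<in> {0<..<1} \<longrightarrow> (\<exists>d. (\<kappa>0 has_real_derivative d) (at x) \<and> vel x 0 \<le> d)"
      using assms(5)
    proof (rule eventually_mono, intro impI)
      fix x assume x: "x \<in> {0<..<1} \<longrightarrow> (\<exists>d. (\<kappa>0 has_real_derivative d) (at x) \<and> d \<ge> G \<epsilon> (deriv \<rho>0 x))" "x \<in> {0<..<1::real}"
      have "vel x 0 = G \<epsilon> (deriv \<rho>0 x)" using w_init[of x] x(2) by (simp add: vel_def)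
      thus "\<exists>d. (\<kappa>0 has_real_derivative d) (at x) \<and> vel x 0 \<le> d" using x by simp
    qed
  qed
  have flux0: "flux 0 t = 0" "flux 1 t = 0" for t using w1_bd by (simp_all add: flux_def)
  let ?U = "{0<..<1::real} \<times> {0<..<T}"
  interpret D: upwind_data flux vel \<epsilon> "C 2 * C 1" "C 3 * C 1 + C 2 * C 2" u0 "L\<kappa> + M" M "C 2" "2 * flux_rate"
    by unfold_locales
       (use assms(2) c_nonneg flux_rate_nonneg flux_bound flux_lipschitz u0_lip vel_bounds vel_lipschitz vel_subsolution growth0
         in \<open>auto simp: M_def\<close>)
  obtain \<kappa> :: "real \<times> real \<Rightarrow> real" and L where
    k_lip: "L-lipschitz_on ({0..1} \<times> {0..T}) \<kappa>"
    and k_init: "\<And>x. x \<in> {0..1} \<Longrightarrow> \<kappa> (x, 0) = u0 x"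
    and k_bd: "\<And>t. t \<in> {0..T} \<Longrightarrow> \<kappa> (0, t) = u0 0" "\<And>t. t \<in> {0..T} \<Longrightarrow> \<kappa> (1, t) = u0 1"
    and k_growth: "\<And>x y t. 0 \<le> x \<Longrightarrow> x \<le> y \<Longrightarrow> y \<le> 1 \<Longrightarrow> t \<in> {0..T} \<Longrightarrow> integral {x..y} (\<lambda>z. vel z t) \<le> \<kappa> (y, t) - \<kappa> (x, t)"
    and k_test: "\<And>\<sigma> \<phi> D z e. \<sigma> = 1 \<or> \<sigma> = -1 \<Longrightarrow> \<forall>q \<in> ?U. (\<phi> has_derivative (\<lambda>h. D q \<bullet> h)) (at q) \<Longrightarrow>
      continuous_on ?U D \<Longrightarrow> z \<in> ?U \<Longrightarrow> e > 0 \<Longrightarrow>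
      \<forall>q \<in> ball z e \<inter> ?U. \<sigma> * (\<kappa> q - \<phi> q) \<le> \<sigma> * (\<kappa> z - \<phi> z) \<Longrightarrow>
      \<sigma> * snd (D z) \<le> \<sigma> * (flux (fst z) (snd z) * trunc_inv \<epsilon> (fst (D z)))"
  proof -
    show thesis by (rule D.upwind_limit[OF assms(1) flux0 flux_cont]) (fact that)
  qed
  have slope: "\<epsilon> * (y - x) \<le> \<kappa> (y, t) - \<kappa> (x, t)" if "0 \<le> x" "x \<le> y" "y \<le> 1" "t \<in> {0..T}" for x y t
  proof -
    have "integral {x..y} (\<lambda>_. \<epsilon>) \<le> integral {x..y} (\<lambda>z. vel z t)"
      by (intro integral_le integrable_const_ivl integrable_continuous_real continuous_on_subset[OF vel_cont'] vel_bounds) simp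
    thus ?thesis using k_growth[OF that] that(2) by (simp add: mult.commute)
  qed
  have Ham: "Ham \<rho> z q = fst q * snd q - flux (fst z) (snd z)" if "z \<in> ?U" for z q
    using \<rho>_partials[of "fst z" "snd z"] that by (auto simp: Ham_def flux_def mem_Times_iff)
  have test: "\<sigma> * Ham \<rho> z (D z) \<le> 0"
    if \<sigma>: "\<sigma> = 1 \<or> \<sigma> = -1" and \<phi>: "\<forall>q \<in> ?U. (\<phi> has_derivative (\<lambda>h. D q \<bullet> h)) (at q)" and D: "continuous_on ?U D"
      and z: "z \<in> ?U" and e: "e > 0" and touch: "\<forall>q \<in> ball z e \<inter> ?U. \<sigma> * (\<kappa> q - \<phi> q) \<le> \<sigma> * (\<kappa> z - \<phi> z)"
    for \<sigma> \<phi> D z e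
  proof -
    obtain x t where ze: "z = (x, t)" by (cases z)
    have xt: "0 < x" "x < 1" "0 < t" "t < T" using z by (auto simp: ze)
    define p where "p = fst (D z)"
    define d where "d = Min {e, x, 1 - x}"
    have d: "d > 0" "d \<le> e" "d \<le> x" "d \<le> 1 - x" using e xt by (auto simp: d_def)
    have "\<epsilon> \<le> p"
    proof (rule touching_slope[OF \<sigma> _ d(1)])
      show "((\<lambda>y. \<phi> (y, t)) has_real_derivative p) (at x)"
        unfolding p_def ze using \<phi> z by (intro partial_derivatives(1)) (auto simp: ze)
      show "\<sigma> * (\<kappa> (y, t) - \<phi> (y, t)) \<le> \<sigma> * (\<kappa> (x, t) - \<phi> (x, t))" if "\<bar>y - x\<bar> < d" for y
      proof -
        have "(y, t) \<in> ball z e \<inter> ?U" using that d xt by (auto simp: ze dist_Pair_Pair dist_real_def)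
        thus ?thesis using touch by (simp add: ze)
      qed
      show "\<epsilon> * (y' - y) \<le> \<kappa> (y', t) - \<kappa> (y, t)" if "\<bar>y - x\<bar> < d" "\<bar>y' - x\<bar> < d" "y \<le> y'" for y y'
        using that d xt by (intro slope) auto
    qed
    \<comment> \<open>The truncation is inactive at the slope of the test function, and
      multiplication by p > 0 turns the equation solved for the time derivative back into the
      product form.\<close>
    hence p: "p > 0" "trunc_inv \<epsilon> p = 1 / p" using assms(2) trunc_inv_eq[OF assms(2)] by auto
    have "p * (\<sigma> * snd (D z)) \<le> p * (\<sigma> * (flux (fst z) (snd z) * trunc_inv \<epsilon> p))"
      unfolding p_def using p(1) by (intro mult_left_mono k_test[OF \<sigma> \<phi> D z e touch]) (simp add: p_def)
    also have "\<dots> = \<sigma> * flux (fst z) (snd z)" using p by simp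
    finally show ?thesis unfolding Ham[OF z] p_def[symmetric] by (simp add: algebra_simps)
  qed
  have sub: "visc_sub (Ham \<rho>) ?U \<kappa>"
    unfolding visc_sub_def
  proof (intro allI impI, elim conjE exE)
    fix \<phi> D z e assume "\<forall>q \<in> ?U. (\<phi> has_derivative (\<lambda>h. D q \<bullet> h)) (at q)" "continuous_on ?U D" "z \<in> ?U" "0 < (e :: real)"
      "\<forall>q\<in>ball z e \<inter> ?U. \<kappa> q - \<phi> q \<le> \<kappa> z - \<phi> z"
    thus "Ham \<rho> z (D z) \<le> 0" using test[of 1 \<phi> D z e] by simp
  qed
  have super: "visc_super (Ham \<rho>) ?U \<kappa>"
    unfolding visc_super_def
  proof (intro allI impI, elim conjE exE)
    fix \<phi> D z e assume \<phi>: "\<forall>q \<in> ?U. (\<phi> has_derivative (\<lambda>h. D q \<bullet> h)) (at q)" "continuous_on ?U D" "z \<in> ?U" "0 < (e :: real)"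
      and le: "\<forall>q\<in>ball z e \<inter> ?U. \<kappa> q - \<phi> q \<ge> \<kappa> z - \<phi> z"
    have "\<forall>q\<in>ball z e \<inter> ?U. -1 * (\<kappa> q - \<phi> q) \<le> -1 * (\<kappa> z - \<phi> z)"
      using le unfolding mult_minus1 neg_le_iff_le .
    from test[OF _ \<phi> this] show "Ham \<rho> z (D z) \<ge> 0" by simp
  qed
  have k_cont: "continuous_on ({0..1} \<times> {0..T}) \<kappa>" by (rule lipschitz_on_continuous_on[OF k_lip])
  have dir: "visc_dirichlet T \<rho> \<kappa>0 \<kappa>"
    unfolding visc_dirichlet_def using k_cont sub super k_init k_bd u0 by auto
  have grad: "grad_constraint \<epsilon> T \<rho> \<kappa>"
    by (rule grad_constraint_if_growth[OF assms(1) k_lip k_growth vel_cont'])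
       (auto simp: \<rho>_partials vel_def)
  have uniq: "\<kappa>' p = \<kappa> p" if \<kappa>': "visc_dirichlet T \<rho> \<kappa>0 \<kappa>'" and p: "p \<in> {0..1} \<times> {0..T}" for \<kappa>' p
  proof -
    have k'_cont: "continuous_on ({0..1} \<times> {0..T}) \<kappa>'" and k'_visc: "visc_sub (Ham \<rho>) ?U \<kappa>'" "visc_super (Ham \<rho>) ?U \<kappa>'"
      and k'_init: "\<And>x. x \<in> {0<..<1} \<Longrightarrow> \<kappa>' (x, 0) = \<kappa>0 x"
      and k'_bd: "\<And>t. t \<in> {0..T} \<Longrightarrow> \<kappa>' (0, t) = \<kappa>0 0" "\<And>t. t \<in> {0..T} \<Longrightarrow> \<kappa>' (1, t) = \<kappa>0 1"
      using \<kappa>' unfolding visc_dirichlet_def by auto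
    have eq: "\<kappa>' z = \<kappa> z" if z: "z \<in> {0..1} \<times> {0..T}" "fst z = 0 \<or> fst z = 1 \<or> snd z = 0" for z
    proof -
      obtain x t where ze: "z = (x, t)" by (cases z)
      consider "x = 0" | "x = 1" | "x \<in> {0<..<1}" "t = 0" using z by (force simp: ze)
      thus ?thesis
      proof cases
        case 3
        thus ?thesis using k'_init k_init[of x] u0[of x] by (simp add: ze)
      qed (use z k'_bd k_bd u0 in \<open>auto simp: ze\<close>)
    qed
    have sl: "slope_ge \<epsilon> T \<kappa>" unfolding slope_ge_def using slope by simp
    \<comment> \<open>The slope bound of \<kappa> serves in both comparisons, \<kappa> being first
      the upper and then the lower function.\<close>
    have "\<kappa>' p \<le> \<kappa> p"
      by (rule viscosity_comparison[OF assms(1,2) k'_cont k_cont flux_cont Ham k'_visc(1) super _ disjI2[OF sl] p])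
         (use eq in auto)
    moreover have "\<kappa> p \<le> \<kappa>' p"
      by (rule viscosity_comparison[OF assms(1,2) k_cont k'_cont flux_cont Ham sub k'_visc(2) _ disjI1[OF sl] p])
         (use eq in auto)
    ultimately show ?thesis by simp
  qed
  show ?thesis using k_lip dir grad uniq by blast
qed

end
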